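(* There exists a numerical (absolute) constant $C>0$ such that the following holds. Let $\omega:\mathbb R\to(0,+\infty)$ be a positive, measurable, essentially bounded function with $\mathcal L(\omega)>-\infty$, and assume that there exist $\alpha\in(0,1)$ and $K_0>0$ such that for all $x,y\in\mathbb R$, $$|\log\omega(x)-\log\omega(y)|\leq K_0|x-y|^\alpha .$$ Then, for any $0<\sigma'<\sigma<1/10$, there exists a nonzero $\psi\in L^2(\mathbb R)$ such that $\operatorname{supp}\psi\subset[0,\sigma]$, $$|\mathcal F\psi|\leq \exp\left(\left(\frac{K_0}{\cos\left(\frac{\pi\alpha}{2}\right)}\right)^{\frac{1}{1-\alpha}}\left(\frac{1}{\pi\sigma'}\right)^{\frac{\alpha}{1-\alpha}}\right)\omega \quad\text{on }\mathbb R,$$ and, for all $x$ in at least one of the two intervals $(-1,-1/2)$ or $(1/2,1)$, $$|\mathcal F\psi(x)|\geq C(\sigma-\sigma')^6\exp\left(-\left(\frac{K_0}{\cos\left(\frac{\pi\alpha}{2}\right)}\right)^{\frac{1}{1-\alpha}}\left(\frac{1}{\pi\sigma'}\right)^{\frac{\alpha}{1-\alpha}}\right)\omega(x).$$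
   Context: The Fourier transform is $\mathcal Ff(\xi)=\int_{\mathbb R}e^{-2\pi i x\xi}f(x)\,dx$. For a positive bounded measurable function $\omega$ on $\mathbb R$, the logarithmic integral is $\mathcal L(\omega)=\int_{\mathbb R}\frac{\log\omega(x)}{1+x^2}\,dx\in[-\infty,+\infty)$. For $\psi\in L^2(\mathbb R)$, $\operatorname{supp}\psi$ denotes the essential support. *)

theory Defs
  imports "HOL-Analysis.Analysis"
begin

text \<open>Bochner integral: the value is only meaningful for integrable \<open>f\<close>, e.g. for square-integrable
  functions with bounded essential support.\<close>

definition fourier_transform :: "(real \<Rightarrow> complex) \<Rightarrow> real \<Rightarrow> complex" where
  "fourier_transform f \<xi> = (\<integral>x. exp (- (2 * pi * \<i> * x * \<xi>)) * f x \<partial>lebesgue)"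

text \<open>The integral of the positive part minus that of the negative part, with values in the extended
  reals; \<^const>\<open>ennreal\<close> maps negative reals to \<open>0\<close>. For essentially bounded \<open>\<omega>\<close> the first
  term is finite, so the expression \<open>\<infinity> - \<infinity>\<close> does not occur.\<close>

definition log_integral :: "(real \<Rightarrow> real) \<Rightarrow> ereal" where
  "log_integral \<omega> =
     enn2ereal (\<integral>\<^sup>+x. ennreal (ln (\<omega> x) / (1 + x\<^sup>2)) \<partial>lebesgue)
   - enn2ereal (\<integral>\<^sup>+x. ennreal (- (ln (\<omega> x) / (1 + x\<^sup>2))) \<partial>lebesgue)"

definition essentially_bounded :: "(real \<Rightarrow> real) \<Rightarrow> bool" where
  "essentially_bounded \<omega> \<longleftrightarrow> (\<exists>M. AE x in lebesgue. \<bar>\<omega> x\<bar> \<le> M)"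

text \<open>Elements of \<open>L\<^sup>2\<close> are represented by functions, so nonzero means not almost everywhere zero.\<close>

definition in_L2 :: "(real \<Rightarrow> complex) \<Rightarrow> bool" where
  "in_L2 f \<longleftrightarrow> f \<in> borel_measurable lebesgue \<and> integrable lebesgue (\<lambda>x. (norm (f x))\<^sup>2)"

definition ess_support :: "(real \<Rightarrow> complex) \<Rightarrow> real set" where
  "ess_support f = - \<Union>{U. open U \<and> (AE x in lebesgue. x \<in> U \<longrightarrow> f x = 0)}"

end

theory Submission
  imports Defs "HOL-Probability.Probability" "HOL-Complex_Analysis.Complex_Analysis"
begin

text \<open>
  Write \<open>B\<close> for the exponent in the theorem, \<open>h = ln \<circ> \<omega>\<close>, and consider the Poisson extension \<open>u\<close> of \<open>h\<close>
  to height \<open>y\<close> in the upper half-plane. Because the integral of \<open>\<bar>t\<bar> powr \<alpha>\<close> against the Poisson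
  kernel is \<open>y powr \<alpha> / cos (\<pi>\<alpha>/2)\<close>, the Hoelder condition gives two bounds: \<open>\<bar>u - h\<bar>\<close> is at most
  \<open>K0 y\<^sup>\<alpha> / cos (\<pi>\<alpha>/2)\<close>, and the harmonic conjugate \<open>A\<close> of \<open>u\<close> is Lipschitz on the line with the same
  constant divided by \<open>y\<close>. Choose \<open>y\<close> so that the Lipschitz constant is \<open>\<pi>\<sigma>'\<close>; the first bound is then
  exactly \<open>B\<close>. So the factors \<open>exp (\<plusminus>B)\<close> pay for replacing \<open>\<omega>\<close> by \<open>exp u\<close>, and it remains to find \<open>\<psi>\<close> whose
  transform is comparable to \<open>exp u\<close> with absolute constants and powers of \<open>\<sigma> - \<sigma>'\<close>.

  The outer function \<open>O\<close> with boundary values \<open>exp (u + iA)\<close> is bounded and holomorphic in the half-plane.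
  A function \<open>f\<close> that is holomorphic and decays there is the transform of some \<open>\<psi>\<close> carried by \<open>[0,\<sigma>]\<close> as soon as
  \<open>f(x) exp (- \<pi>i\<sigma>x)\<close> is real on the line (\<open>paley_wiener_half_plane\<close>). Hence only the argument of \<open>O\<close> has
  to be corrected, modulo \<open>\<pi>\<close>, to a linear function. The phase \<open>\<phi>(x) = \<pi>\<sigma>'x - A(x)\<close> is nondecreasing with
  slope at most \<open>2\<pi>\<sigma>' < \<pi>/5\<close>. Let \<open>s = \<phi> - \<pi>N\<close>, where the integer \<open>N\<close> is chosen to make \<open>\<bar>s\<bar> \<le> \<pi>/2\<close>, and let
  \<open>G\<close> be holomorphic with \<open>Im G = s\<close> on the line. Then \<open>O exp G\<close> has argument \<open>A + s = \<pi>\<sigma>'x\<close> modulo \<open>\<pi>\<close>, as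
  required.

  The size of \<open>exp G\<close> is controlled in \<open>sawtooth_outer\<close>. Its logarithm is a singular integral of \<open>s\<close>. The part
  near \<open>x\<close> only sees the differences \<open>s(x+v) - s(x-v)\<close>; these are at most the increment of \<open>\<phi>\<close>, since the
  jumps of \<open>s\<close> go down, and they are nonnegative when there is no jump close to \<open>x\<close>. The rest is at most
  logarithmic. This gives \<open>\<bar>exp G\<bar> \<le> C(1+\<bar>z\<bar>)\<^sup>3\<close> everywhere and a lower bound away from the jumps. On
  \<open>[-3/2,3/2]\<close> the phase grows by less than \<open>\<pi>\<close>, so there is at most one jump, and one of the halves
  \<open>[-3/2,0]\<close>, \<open>[0,3/2]\<close> has none in its interior: this decides between \<open>(-1,-1/2)\<close> and \<open>(1/2,1)\<close>.

  Finally, the spectral length \<open>\<sigma> - \<sigma>'\<close> that is left is spent on the sixth power of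
  \<open>(exp (i\<tau>z) - 1) / (i\<tau>z)\<close> with \<open>\<tau> = \<pi>(\<sigma> - \<sigma>')/3\<close>. It turns the cubic growth into quadratic decay, and
  normalising the product to be at most \<open>exp u\<close> costs a factor comparable to \<open>\<tau>\<^sup>3\<close>, hence to
  \<open>(\<sigma> - \<sigma>')\<^sup>3 \<ge> (\<sigma> - \<sigma>')\<^sup>6\<close>.
\<close>

section \<open>Integrals of the Poisson kernel\<close>

lemma has_bochner_integral_lorentz_std:
  "has_bochner_integral lborel (\<lambda>t::real. 1 / (1 + t\<^sup>2)) pi"
proof -
  have i: "integrable lborel (\<lambda>t::real. inverse (1 + t\<^sup>2))"
    using integrable_inverse_1_plus_square by (simp add: set_integrable_def einterval_def)
  have "(LBINT t. inverse (1 + t\<^sup>2)) = pi"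
    using LBINT_inverse_1_plus_square
    by (simp add: interval_lebesgue_integral_def set_lebesgue_integral_def einterval_def)
  with i show ?thesis by (simp add: has_bochner_integral_iff divide_inverse)
qed

lemma has_bochner_integral_lorentz:
  fixes x y :: real
  assumes "y > 0"
  shows "has_bochner_integral lborel (\<lambda>t. y / ((t - x)\<^sup>2 + y\<^sup>2)) pi"
proof -
  have "has_bochner_integral lborel (\<lambda>t. 1 / (1 + (- x / y + (1 / y) * t)\<^sup>2)) (pi /\<^sub>R \<bar>1 / y\<bar>)"
    using lborel_has_bochner_integral_real_affine_iff[of "1/y" "\<lambda>t. 1 / (1 + t\<^sup>2)" pi "-x/y"]
      has_bochner_integral_lorentz_std assms by simp
  then have "has_bochner_integral lborel (\<lambda>t. 1 / (1 + (- x / y + (1 / y) * t)\<^sup>2) * (1 / y)) (pi /\<^sub>R \<bar>1 / y\<bar> * (1 / y))"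
    by (rule has_bochner_integral_mult_left)
  moreover have "1 / (1 + (- x / y + (1 / y) * t)\<^sup>2) * (1 / y) = y / ((t - x)\<^sup>2 + y\<^sup>2)" for t
  proof -
    have "- x / y + (1 / y) * t = (t - x) / y" by (simp add: diff_divide_distrib)
    then show ?thesis using assms
      by (simp add: power_divide field_simps power2_eq_square)
  qed
  ultimately show ?thesis using assms by simp
qed

text \<open>
  The reflection formula for the Gamma function is what produces the cosine in the constants of the theorem.
\<close>
lemma Beta_half_reflection:
  fixes a :: real
  assumes "0 < a" "a < 1"
  shows "Beta ((1 + a) / 2) ((1 - a) / 2) = pi / cos (pi * a / 2)"
proof -
  have "complex_of_real (Gamma ((1 + a) / 2) * Gamma ((1 - a) / 2))
      = Gamma (of_real ((1 + a) / 2)) * Gamma (1 - of_real ((1 + a) / 2))"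
    by (simp add: field_simps flip: Gamma_complex_of_real)
  also have "\<dots> = of_real pi / sin (of_real pi * of_real ((1 + a) / 2))"
    by (rule Gamma_reflection_complex)
  also have "\<dots> = of_real (pi / sin (pi * ((1 + a) / 2)))"
    by (simp only: of_real_divide of_real_mult sin_of_real [symmetric])
  finally have "Gamma ((1 + a) / 2) * Gamma ((1 - a) / 2) = pi / sin (pi * ((1 + a) / 2))"
    by (simp only: of_real_eq_iff)
  also have "sin (pi * ((1 + a) / 2)) = cos (pi * a / 2)"
  proof -
    have e: "pi * ((1 + a) / 2) = pi / 2 + pi * a / 2" by (simp add: field_simps)
    show ?thesis unfolding e sin_add by simp
  qed
  finally show ?thesis
    by (simp add: Beta_def flip: add_divide_distrib)
qed

text \<open>
  The substitution \<open>t = (u/(1-u)) powr (1/2)\<close> turns the integral over the half-line into a Beta integral.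
\<close>
lemma has_bochner_integral_powr_lorentz_std:
  fixes a :: real
  assumes a: "0 < a" "a < 1"
  shows "has_bochner_integral lborel (\<lambda>t::real. \<bar>t\<bar> powr a / (1 + t\<^sup>2)) (pi / cos (pi * a / 2))"
proof -
  define g where "g = (\<lambda>u::real. (u / (1 - u)) powr (1/2))"
  define g' where "g' = (\<lambda>u::real. (1/2) * (u / (1 - u)) powr (-1/2) * (1 / (1 - u)\<^sup>2))"
  define f where "f = (\<lambda>t::real. t powr a / (1 + t\<^sup>2))"
  define B where "B = Beta ((1 + a) / 2) ((1 - a) / 2)"
  have fg: "f (g u) * g' u = (1/2) * (u powr ((1 + a)/2 - 1) * (1 - u) powr ((1 - a)/2 - 1))"
    if "0 < u" "u < 1" for u
  proof -
    have "(g u)\<^sup>2 = u / (1 - u)" using that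
      by (simp add: g_def powr_half_sqrt)
    then have 1: "1 + (g u)\<^sup>2 = 1 / (1 - u)" using that by (simp add: field_simps)
    have 2: "g u powr a = (u / (1 - u)) powr (a/2)" by (simp add: g_def powr_powr)
    have "f (g u) * g' u = (1/2) * ((u / (1 - u)) powr (a/2) * (u / (1 - u)) powr (-1/2)) * (1 / (1 - u))"
    proof -
      have "f (g u) = (u / (1 - u)) powr (a/2) * (1 - u)" by (simp add: f_def 1 2)
      then show ?thesis using that by (simp add: g'_def power2_eq_square)
    qed
    also have "(u / (1 - u)) powr (a/2) * (u / (1 - u)) powr (-1/2) = (u / (1 - u)) powr ((a - 1) / 2)"
      by (simp add: powr_add[symmetric] field_simps)
    also have "\<dots> = u powr ((a - 1) / 2) / (1 - u) powr ((a - 1) / 2)"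
      using that by (simp add: powr_divide)
    also have "(1/2) * (u powr ((a - 1) / 2) / (1 - u) powr ((a - 1) / 2)) * (1 / (1 - u))
        = (1/2) * (u powr ((a - 1) / 2) * ((1 - u) powr (- ((a - 1) / 2)) * (1 - u) powr (-1)))"
      using that by (simp only: powr_minus) (simp add: field_simps powr_minus)
    also have "(1 - u) powr (- ((a - 1) / 2)) * (1 - u) powr (-1) = (1 - u) powr ((1 - a)/2 - 1)"
    proof -
      have e: "(1 - a)/2 - 1 = - ((a - 1) / 2) + (-1)" by (simp add: field_simps)
      show ?thesis unfolding e powr_add ..
    qed
    also have "(a - 1) / 2 = (1 + a)/2 - 1" by (simp add: field_simps)
    finally show ?thesis .
  qed
  have bint: "set_integrable lborel {0..1} (\<lambda>u. u powr ((1 + a)/2 - 1) * (1 - u) powr ((1 - a)/2 - 1))"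
    by (rule integrable_Beta) (use a in auto)
  have bval: "(LBINT u:{0..1}. u powr ((1 + a)/2 - 1) * (1 - u) powr ((1 - a)/2 - 1)) = B"
    unfolding B_def using has_integral_Beta_real[of "(1+a)/2" "(1-a)/2"] a
      set_borel_integral_eq_integral(2)[OF bint] by (simp add: integral_unique)
  have ae: "AE u in lborel. (u::real) \<in> {0..1} \<longleftrightarrow> u \<in> {0<..<1}"
    using AE_lborel_singleton[of 0] AE_lborel_singleton[of 1] by eventually_elim auto
  have sub: "set_integrable lborel (einterval 0 \<infinity>) f"
       "(LBINT t=0..\<infinity>. f t) = (LBINT u=0..1. f (g u) * g' u)"
  proof -
    have der: "DERIV g u :> g' u" if "0 < ereal u" "ereal u < 1" for u
    proof -
      from that have u: "0 < u" "u < 1" by auto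
      show ?thesis unfolding g_def g'_def using u
        by (auto intro!: derivative_eq_intros simp: field_simps power2_eq_square)
    qed
    have contf: "isCont f (g u)" if "0 < ereal u" "ereal u < 1" for u
    proof -
      from that have u: "0 < u" "u < 1" by auto
      then have "g u > 0" by (simp add: g_def)
      moreover have "1 + (g u)\<^sup>2 \<noteq> 0" by (smt (verit) zero_le_power2)
      ultimately show ?thesis unfolding f_def by (intro continuous_intros) auto
    qed
    have contg': "isCont g' u" if "0 < ereal u" "ereal u < 1" for u
    proof -
      from that have u: "0 < u" "u < 1" by auto
      then show ?thesis unfolding g'_def by (intro continuous_intros) auto
    qed
    have nn: "0 \<le> f t" for t unfolding f_def by auto
    have g'nn: "0 \<le> g' u" for u unfolding g'_def by auto
    have l0: "((ereal \<circ> g \<circ> real_of_ereal) \<longlongrightarrow> 0) (at_right 0)"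
    proof -
      have "((\<lambda>u. u / (1 - u)) \<longlongrightarrow> 0) (at_right (0::real))"
        by (auto intro!: tendsto_eq_intros)
      moreover have "\<forall>\<^sub>F u in at_right (0::real). 0 \<le> u / (1 - u)"
        using eventually_at_right_real[of 0 1] by (auto elim!: eventually_mono)
      ultimately have "(g \<longlongrightarrow> 0) (at_right 0)"
        unfolding g_def using tendsto_powr'[of "\<lambda>u. u / (1 - u)" 0 "at_right 0" "\<lambda>_. 1/2" "1/2"] by simp
      then show ?thesis by (simp add: ereal_tendsto_simps zero_ereal_def)
    qed
    have l1: "((ereal \<circ> g \<circ> real_of_ereal) \<longlongrightarrow> \<infinity>) (at_left 1)"
    proof -
      have "filterlim (\<lambda>u. sqrt (u / (1 - u))) at_top (at_left (1::real))"
        by real_asymp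
      moreover have "\<forall>\<^sub>F u in at_left (1::real). sqrt (u / (1 - u)) = g u"
        using eventually_at_left_real[of 0 1] by (auto elim!: eventually_mono simp: g_def powr_half_sqrt)
      ultimately have "filterlim g at_top (at_left 1)" by (simp cong: filterlim_cong)
      then show ?thesis by (simp add: ereal_tendsto_simps one_ereal_def)
    qed
    have int: "set_integrable lborel (einterval 0 1) (\<lambda>u. f (g u) * g' u)"
    proof -
      have "set_integrable lborel {0<..<1} (\<lambda>u. (1/2) * (u powr ((1 + a)/2 - 1) * (1 - u) powr ((1 - a)/2 - 1)))"
        by (intro set_integrable_mult_right set_integrable_subset[OF bint]) auto
      then have "set_integrable lborel {0<..<1} (\<lambda>u. f (g u) * g' u)"
        by (rule set_integrable_cong[THEN iffD1, rotated 3]) (auto simp: fg)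
      moreover have "einterval 0 1 = {0<..<1::real}" by (auto simp: einterval_def)
      ultimately show ?thesis by simp
    qed
    show "set_integrable lborel (einterval 0 \<infinity>) f"
      by (rule interval_integral_substitution_nonneg(1)[OF _ der contf contg' nn g'nn l0 l1 int]) auto
    show "(LBINT t=0..\<infinity>. f t) = (LBINT u=0..1. f (g u) * g' u)"
      by (rule interval_integral_substitution_nonneg(2)[OF _ der contf contg' nn g'nn l0 l1 int]) auto
  qed
  have "(LBINT u=0..1. f (g u) * g' u) = (LBINT u:{0<..<1}. (1/2) * (u powr ((1 + a)/2 - 1) * (1 - u) powr ((1 - a)/2 - 1)))"
  proof -
    have "einterval 0 1 = {0<..<1::real}" by (auto simp: einterval_def)
    then have "(LBINT u=0..1. f (g u) * g' u) = (LBINT u:{0<..<1}. f (g u) * g' u)"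
      by (simp add: interval_lebesgue_integral_def)
    also have "\<dots> = (LBINT u:{0<..<1}. (1/2) * (u powr ((1 + a)/2 - 1) * (1 - u) powr ((1 - a)/2 - 1)))"
      by (rule set_lebesgue_integral_cong) (use fg in auto)
    finally show ?thesis .
  qed
  also have "\<dots> = (1/2) * (LBINT u:{0<..<1}. (u powr ((1 + a)/2 - 1) * (1 - u) powr ((1 - a)/2 - 1)))"
    by (simp add: set_lebesgue_integral_def)
  also have "(LBINT u:{0<..<1}. (u powr ((1 + a)/2 - 1) * (1 - u) powr ((1 - a)/2 - 1))) = B"
    unfolding bval[symmetric] set_lebesgue_integral_def using ae
    by (intro integral_cong_AE) (auto elim!: eventually_mono simp: indicator_def)
  finally have val: "(LBINT t=0..\<infinity>. f t) = B / 2" using sub(2) by simp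
  have ei: "einterval 0 \<infinity> = {0::real<..}" by (auto simp: einterval_def)
  have hb: "has_bochner_integral lborel (\<lambda>t. indicator {0<..} t *\<^sub>R f t) (B / 2)"
    using sub(1) val by (simp add: has_bochner_integral_iff set_integrable_def
        interval_lebesgue_integral_def set_lebesgue_integral_def ei)
  then have hb2: "has_bochner_integral lborel (\<lambda>t. indicator {0<..} (- t) *\<^sub>R f (- t)) (B / 2)"
    using lborel_has_bochner_integral_real_affine_iff[of "-1" "\<lambda>t. indicator {0<..} t *\<^sub>R f t" "B/2" 0] by simp
  have "has_bochner_integral lborel (\<lambda>t. indicator {0<..} t *\<^sub>R f t + indicator {0<..} (- t) *\<^sub>R f (- t)) (B/2 + B/2)"
    by (rule has_bochner_integral_add[OF hb hb2])
  moreover have "(\<lambda>t. indicator {0<..} t *\<^sub>R f t + indicator {0<..} (- t) *\<^sub>R f (- t)) = (\<lambda>t::real. \<bar>t\<bar> powr a / (1 + t\<^sup>2))"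
    by (auto simp: fun_eq_iff f_def indicator_def)
  ultimately show ?thesis using Beta_half_reflection[OF a] by (simp add: B_def)
qed

lemma has_bochner_integral_powr_lorentz:
  fixes a x y :: real
  assumes a: "0 < a" "a < 1" and y: "y > 0"
  shows "has_bochner_integral lborel (\<lambda>t. \<bar>t - x\<bar> powr a * (y / ((t - x)\<^sup>2 + y\<^sup>2)))
           (pi * y powr a / cos (pi * a / 2))"
proof -
  have "has_bochner_integral lborel (\<lambda>t. \<bar>- x / y + (1 / y) * t\<bar> powr a / (1 + (- x / y + (1 / y) * t)\<^sup>2))
      (pi / cos (pi * a / 2) /\<^sub>R \<bar>1 / y\<bar>)"
    using lborel_has_bochner_integral_real_affine_iff[of "1/y" "\<lambda>t. \<bar>t\<bar> powr a / (1 + t\<^sup>2)" "pi / cos (pi * a / 2)" "-x/y"]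
      has_bochner_integral_powr_lorentz_std[OF a] y by simp
  then have "has_bochner_integral lborel
      (\<lambda>t. \<bar>- x / y + (1 / y) * t\<bar> powr a / (1 + (- x / y + (1 / y) * t)\<^sup>2) * (y powr a / y))
      (pi / cos (pi * a / 2) /\<^sub>R \<bar>1 / y\<bar> * (y powr a / y))"
    by (rule has_bochner_integral_mult_left)
  moreover have eq: "\<bar>- x / y + (1 / y) * t\<bar> powr a / (1 + (- x / y + (1 / y) * t)\<^sup>2) * (y powr a / y)
      = \<bar>t - x\<bar> powr a * (y / ((t - x)\<^sup>2 + y\<^sup>2))" for t
  proof -
    have 1: "- x / y + (1 / y) * t = (t - x) / y" by (simp add: diff_divide_distrib)
    have 2: "\<bar>(t - x) / y\<bar> powr a = \<bar>t - x\<bar> powr a / y powr a" using y by (simp add: powr_divide abs_divide)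
    have 3: "1 + ((t - x) / y)\<^sup>2 = ((t - x)\<^sup>2 + y\<^sup>2) / y\<^sup>2" using y by (simp add: power_divide field_simps)
    have 4: "(t - x)\<^sup>2 + y\<^sup>2 > 0" using y by (simp add: add_nonneg_pos)
    show ?thesis unfolding 1 2 3 using y 4 by (simp add: power2_eq_square)
  qed
  moreover have "pi / cos (pi * a / 2) /\<^sub>R \<bar>1 / y\<bar> * (y powr a / y) = pi * y powr a / cos (pi * a / 2)"
    using y by simp
  ultimately show ?thesis by (simp only:)
qed

section \<open>Cauchy transforms of functions on the line\<close>

text \<open>
  The subtracted term makes the Cauchy kernel decay like \<open>1/t\<^sup>2\<close>, so that it can be paired with functions of
  sublinear growth; being real, it does not affect the imaginary part, which stays the Poisson kernel times
  \<open>\<pi>\<close>. The transform \<open>cauchy_transform h\<close> is thus \<open>\<pi>i\<close> times the holomorphic function whose real part is the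
  Poisson extension of \<open>h\<close>.
\<close>
definition cauchy_kernel :: "complex \<Rightarrow> real \<Rightarrow> complex" where
  "cauchy_kernel z t = 1 / (of_real t - z) - of_real t / (1 + (of_real t)\<^sup>2)"

definition cauchy_transform :: "(real \<Rightarrow> real) \<Rightarrow> complex \<Rightarrow> complex" where
  "cauchy_transform h z = (LINT t|lborel. of_real (h t) * cauchy_kernel z t)"

definition cauchy_deriv :: "(real \<Rightarrow> real) \<Rightarrow> complex \<Rightarrow> complex" where
  "cauchy_deriv h z = (LINT t|lborel. of_real (h t) / (of_real t - z)\<^sup>2)"

definition poisson_summable :: "(real \<Rightarrow> real) \<Rightarrow> bool" where
  "poisson_summable h \<longleftrightarrow> h \<in> borel_measurable borel \<and> integrable lborel (\<lambda>t. h t / (1 + t\<^sup>2))"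

lemma Im_le_norm_of_real_diff: "\<bar>Im z\<bar> \<le> norm (of_real t - z)"
  using abs_Im_le_cmod[of "of_real t - z"] by simp

lemma of_real_neq_of_Im_pos: "Im z > 0 \<Longrightarrow> of_real t \<noteq> z"
  by auto

text \<open>
  A constant that compares the distance from \<open>z\<close> to the point \<open>t\<close> of the real line with \<open>1 + \<bar>t\<bar>\<close>, uniformly in
  \<open>t\<close>; see \<open>one_plus_abs_le\<close>.
\<close>
definition height_ratio :: "complex \<Rightarrow> real" where
  "height_ratio z = 1 + (1 + norm z) / Im z"

lemma height_ratio_pos: "Im z > 0 \<Longrightarrow> height_ratio z > 0"
  unfolding height_ratio_def by (intro add_pos_nonneg) auto

lemma one_plus_abs_le:
  assumes "Im z > 0"
  shows "1 + \<bar>t\<bar> \<le> height_ratio z * norm (of_real t - z)"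
proof -
  have "\<bar>t\<bar> \<le> norm (of_real t - z) + norm z"
    by (metis norm_of_real norm_triangle_sub add.commute real_norm_def)
  moreover have "1 + norm z \<le> (1 + norm z) / Im z * norm (of_real t - z)"
  proof -
    have "(1 + norm z) / Im z * Im z \<le> (1 + norm z) / Im z * norm (of_real t - z)"
      using Im_le_norm_of_real_diff[of z t] assms by (intro mult_left_mono) auto
    then show ?thesis using assms by simp
  qed
  ultimately show ?thesis by (simp add: height_ratio_def distrib_right)
qed

lemma one_plus_sq_le:
  assumes "Im z > 0"
  shows "1 + t\<^sup>2 \<le> (height_ratio z)\<^sup>2 * (norm (of_real t - z))\<^sup>2"
proof -
  have "1 + t\<^sup>2 \<le> (1 + \<bar>t\<bar>)\<^sup>2" by (simp add: power2_sum)
  also have "\<dots> \<le> (height_ratio z * norm (of_real t - z))\<^sup>2"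
    using one_plus_abs_le[OF assms] by (intro power_mono) auto
  finally show ?thesis by (simp add: power_mult_distrib)
qed

lemma one_plus_sq_complex_neq: "1 + (complex_of_real t)\<^sup>2 \<noteq> 0"
proof -
  have "1 + t\<^sup>2 > 0" by (simp add: add_pos_nonneg)
  then have "complex_of_real (1 + t\<^sup>2) \<noteq> 0" by (simp only: of_real_eq_0_iff)
  then show ?thesis by simp
qed

lemma cauchy_kernel_altdef:
  assumes "of_real t \<noteq> z"
  shows "cauchy_kernel z t = (1 + of_real t * z) / ((of_real t - z) * (1 + (of_real t)\<^sup>2))"
  using assms one_plus_sq_complex_neq[of t] unfolding cauchy_kernel_def
  by (simp add: diff_frac_eq) (simp add: power2_eq_square algebra_simps)

lemma norm_cauchy_kernel_le:
  assumes "Im z > 0"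
  shows "norm (cauchy_kernel z t) \<le> height_ratio z * (1 + norm z) / (1 + t\<^sup>2)"
proof -
  have p: "norm (of_real t - z) > 0" using of_real_neq_of_Im_pos[OF assms, of t] by simp
  have q: "norm (1 + (complex_of_real t)\<^sup>2) = 1 + t\<^sup>2"
  proof -
    have "norm (complex_of_real (1 + t\<^sup>2)) = \<bar>1 + t\<^sup>2\<bar>" by (rule norm_of_real)
    then show ?thesis by simp
  qed
  have "norm (1 + of_real t * z) \<le> 1 + \<bar>t\<bar> * norm z"
    by (rule norm_triangle_le) (simp add: norm_mult)
  also have "\<dots> \<le> (1 + \<bar>t\<bar>) * (1 + norm z)" by (simp add: algebra_simps)
  also have "\<dots> \<le> height_ratio z * norm (of_real t - z) * (1 + norm z)"
    using one_plus_abs_le[OF assms] by (intro mult_right_mono) auto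
  finally have "norm (1 + of_real t * z) \<le> (height_ratio z * (1 + norm z)) * norm (of_real t - z)"
    by (simp add: ac_simps)
  then have "norm (1 + of_real t * z) / norm (of_real t - z) \<le> height_ratio z * (1 + norm z)"
    using p by (simp add: divide_le_eq)
  then have "norm (1 + of_real t * z) / norm (of_real t - z) / (1 + t\<^sup>2) \<le> height_ratio z * (1 + norm z) / (1 + t\<^sup>2)"
    by (intro divide_right_mono) auto
  then show ?thesis
    using of_real_neq_of_Im_pos[OF assms, of t]
    by (simp add: cauchy_kernel_altdef norm_divide norm_mult q)
qed

lemma borel_measurable_cauchy_kernel [measurable]:
  "cauchy_kernel z \<in> borel_measurable borel"
  unfolding cauchy_kernel_def[abs_def] by measurable

lemma integrable_cauchy_kernel:
  assumes "poisson_summable h" "Im z > 0"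
  shows "integrable lborel (\<lambda>t. of_real (h t) * cauchy_kernel z t)"
proof (rule Bochner_Integration.integrable_bound)
  have [measurable]: "h \<in> borel_measurable borel" using assms by (simp add: poisson_summable_def)
  show "integrable lborel (\<lambda>t. (height_ratio z * (1 + norm z)) * (h t / (1 + t\<^sup>2)))"
    using assms by (intro integrable_mult_right) (simp add: poisson_summable_def)
  show "(\<lambda>t. of_real (h t) * cauchy_kernel z t) \<in> borel_measurable lborel" by measurable
  show "AE t in lborel. norm (of_real (h t) * cauchy_kernel z t)
      \<le> norm ((height_ratio z * (1 + norm z)) * (h t / (1 + t\<^sup>2)))"
  proof (rule AE_I2)
    fix t
    have "norm (of_real (h t) * cauchy_kernel z t) = \<bar>h t\<bar> * norm (cauchy_kernel z t)"
      by (simp add: norm_mult)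
    also have "\<dots> \<le> \<bar>h t\<bar> * (height_ratio z * (1 + norm z) / (1 + t\<^sup>2))"
      by (intro mult_left_mono norm_cauchy_kernel_le assms) auto
    also have "\<dots> = norm ((height_ratio z * (1 + norm z)) * (h t / (1 + t\<^sup>2)))"
      using height_ratio_pos[OF assms(2)] by (simp add: abs_mult add_nonneg_nonneg)
    finally show "norm (of_real (h t) * cauchy_kernel z t) \<le> norm ((height_ratio z * (1 + norm z)) * (h t / (1 + t\<^sup>2)))" .
  qed
qed

lemma integrable_cauchy_deriv:
  assumes "poisson_summable h" "Im z > 0"
  shows "integrable lborel (\<lambda>t. of_real (h t) / (of_real t - z)\<^sup>2)"
proof (rule Bochner_Integration.integrable_bound)
  have [measurable]: "h \<in> borel_measurable borel" using assms by (simp add: poisson_summable_def)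
  show "integrable lborel (\<lambda>t. (height_ratio z)\<^sup>2 * (h t / (1 + t\<^sup>2)))"
    using assms by (intro integrable_mult_right) (simp add: poisson_summable_def)
  show "(\<lambda>t. of_real (h t) / (of_real t - z)\<^sup>2) \<in> borel_measurable lborel" by measurable
  show "AE t in lborel. norm (of_real (h t) / (of_real t - z)\<^sup>2) \<le> norm ((height_ratio z)\<^sup>2 * (h t / (1 + t\<^sup>2)))"
  proof (rule AE_I2)
    fix t
    have p: "norm (of_real t - z) > 0" using of_real_neq_of_Im_pos[OF assms(2), of t] by simp
    have q: "1 + t\<^sup>2 > 0" by (simp add: add_pos_nonneg)
    have "1 / (norm (of_real t - z))\<^sup>2 \<le> (height_ratio z)\<^sup>2 / (1 + t\<^sup>2)"
      using one_plus_sq_le[OF assms(2), of t] p q by (simp add: field_simps)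
    then have "\<bar>h t\<bar> * (1 / (norm (of_real t - z))\<^sup>2) \<le> \<bar>h t\<bar> * ((height_ratio z)\<^sup>2 / (1 + t\<^sup>2))"
      by (intro mult_left_mono) auto
    then show "norm (of_real (h t) / (of_real t - z)\<^sup>2) \<le> norm ((height_ratio z)\<^sup>2 * (h t / (1 + t\<^sup>2)))"
      using q by (simp add: norm_divide norm_power abs_mult ac_simps)
  qed
qed

text \<open>
  The difference quotient of \<open>1/(t-z)\<close> differs from its derivative by \<open>(w-z)/((t-w)(t-z)\<^sup>2)\<close>, which is
  dominated by a multiple of \<open>\<bar>w-z\<bar>/(1+t\<^sup>2)\<close>; integrated against \<open>h\<close>, this error is linear in \<open>\<bar>w-z\<bar>\<close>.
\<close>
lemma cauchy_transform_quotient: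
  assumes h: "poisson_summable h" and z: "Im z > 0" and w: "norm (w - z) \<le> Im z / 2" "w \<noteq> z"
  shows "norm ((cauchy_transform h w - cauchy_transform h z) / (w - z) - cauchy_deriv h z)
       \<le> (2 / Im z * (height_ratio z)\<^sup>2 * (LINT t|lborel. \<bar>h t / (1 + t\<^sup>2)\<bar>)) * norm (w - z)"
proof -
  define D where "D = (height_ratio z)\<^sup>2"
  have Imw: "Im w \<ge> Im z / 2" 
    using abs_Im_le_cmod[of "w - z"] w by simp
  then have w0: "Im w > 0" using z by simp
  note i = integrable_cauchy_kernel[OF h w0] integrable_cauchy_kernel[OF h z] integrable_cauchy_deriv[OF h z]
  have int1: "integrable lborel (\<lambda>t. (of_real (h t) * cauchy_kernel w t - of_real (h t) * cauchy_kernel z t) / (w - z)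
      - of_real (h t) / (of_real t - z)\<^sup>2)"
    by (intro Bochner_Integration.integrable_diff integrable_divide_zero) (use i in auto)
  have eq: "(cauchy_transform h w - cauchy_transform h z) / (w - z) - cauchy_deriv h z
      = (LINT t|lborel. (of_real (h t) * cauchy_kernel w t - of_real (h t) * cauchy_kernel z t) / (w - z)
          - of_real (h t) / (of_real t - z)\<^sup>2)"
    unfolding cauchy_transform_def cauchy_deriv_def using i by simp
  have pt: "norm ((of_real (h t) * cauchy_kernel w t - of_real (h t) * cauchy_kernel z t) / (w - z)
          - of_real (h t) / (of_real t - z)\<^sup>2) \<le> (2 / Im z * D * norm (w - z)) * \<bar>h t / (1 + t\<^sup>2)\<bar>" for t
  proof -
    define a b where "a = of_real t - z" and "b = of_real t - w"
    have a: "a \<noteq> 0" and b: "b \<noteq> 0" using of_real_neq_of_Im_pos[OF z, of t] of_real_neq_of_Im_pos[OF w0, of t] by (auto simp: a_def b_def)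
    have wz: "w - z = a - b" by (simp add: a_def b_def)
    have ab: "a - b \<noteq> 0" using w(2) by (simp add: wz[symmetric])
    have k: "cauchy_kernel w t - cauchy_kernel z t = (a - b) / (a * b)"
      unfolding cauchy_kernel_def using a b by (simp add: a_def[symmetric] b_def[symmetric] field_simps)
    have "(of_real (h t) * cauchy_kernel w t - of_real (h t) * cauchy_kernel z t) / (w - z) - of_real (h t) / a\<^sup>2
       = of_real (h t) * ((cauchy_kernel w t - cauchy_kernel z t) / (w - z) - 1 / a\<^sup>2)"
      by (simp add: algebra_simps diff_divide_distrib)
    also have "(cauchy_kernel w t - cauchy_kernel z t) / (w - z) - 1 / a\<^sup>2 = (w - z) / (b * a\<^sup>2)"
      unfolding k wz using a b ab by (simp add: field_simps power2_eq_square)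
    finally have e: "norm ((of_real (h t) * cauchy_kernel w t - of_real (h t) * cauchy_kernel z t) / (w - z) - of_real (h t) / a\<^sup>2)
        = \<bar>h t\<bar> * norm (w - z) * (1 / norm b) * (1 / (norm a)\<^sup>2)"
      by (simp add: norm_mult norm_divide norm_power)
    have q: "1 + t\<^sup>2 > 0" by (simp add: add_pos_nonneg)
    have 1: "1 / norm b \<le> 2 / Im z"
    proof -
      have "norm b \<ge> Im z / 2" using Im_le_norm_of_real_diff[of w t] Imw by (simp add: b_def)
      then show ?thesis using z b by (simp add: field_simps)
    qed
    have 2: "1 / (norm a)\<^sup>2 \<le> D / (1 + t\<^sup>2)"
      using one_plus_sq_le[OF z, of t] a q by (simp add: field_simps D_def a_def)
    have "\<bar>h t\<bar> * norm (w - z) * (1 / norm b) * (1 / (norm a)\<^sup>2)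
        \<le> \<bar>h t\<bar> * norm (w - z) * (2 / Im z) * (D / (1 + t\<^sup>2))"
      using z by (intro mult_mono 1 2) auto
    also have "\<dots> = (2 / Im z * D * norm (w - z)) * \<bar>h t / (1 + t\<^sup>2)\<bar>"
      using q by (simp add: abs_divide)
    finally show ?thesis using e unfolding a_def by simp
  qed
  have "norm (LINT t|lborel. (of_real (h t) * cauchy_kernel w t - of_real (h t) * cauchy_kernel z t) / (w - z)
          - of_real (h t) / (of_real t - z)\<^sup>2)
      \<le> (LINT t|lborel. (2 / Im z * D * norm (w - z)) * \<bar>h t / (1 + t\<^sup>2)\<bar>)"
  proof (rule Bochner_Integration.integral_norm_bound_integral[OF int1])
    show "integrable lborel (\<lambda>t. (2 / Im z * D * norm (w - z)) * \<bar>h t / (1 + t\<^sup>2)\<bar>)"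
      using h by (intro integrable_mult_right integrable_abs) (simp add: poisson_summable_def)
  qed (rule pt)
  also have "\<dots> = (2 / Im z * D * norm (w - z)) * (LINT t|lborel. \<bar>h t / (1 + t\<^sup>2)\<bar>)"
    by (rule integral_mult_right_zero)
  finally show ?thesis unfolding eq by (simp only: D_def ac_simps)
qed

lemma has_field_derivative_cauchy_transform:
  assumes h: "poisson_summable h" and z: "Im z > 0"
  shows "(cauchy_transform h has_field_derivative cauchy_deriv h z) (at z)"
proof -
  define C where "C = 2 / Im z * (height_ratio z)\<^sup>2 * (LINT t|lborel. \<bar>h t / (1 + t\<^sup>2)\<bar>)"
  have "((\<lambda>w. (cauchy_transform h w - cauchy_transform h z) / (w - z) - cauchy_deriv h z) \<longlongrightarrow> 0) (at z)"
  proof (rule Lim_null_comparison)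
    show "((\<lambda>w. C * norm (w - z)) \<longlongrightarrow> 0) (at z)"
      by (auto intro!: tendsto_eq_intros)
    show "\<forall>\<^sub>F w in at z. norm ((cauchy_transform h w - cauchy_transform h z) / (w - z) - cauchy_deriv h z) \<le> C * norm (w - z)"
      unfolding eventually_at using z
      using cauchy_transform_quotient[OF h z, folded C_def]
      by (intro exI[of _ "Im z / 2"]) (auto simp: dist_norm)
  qed
  then show ?thesis by (simp add: has_field_derivative_iff LIM_zero_iff)
qed

lemma holomorphic_cauchy_transform:
  assumes "poisson_summable h"
  shows "cauchy_transform h holomorphic_on {z. Im z > 0}"
  using has_field_derivative_cauchy_transform[OF assms]
  by (auto simp: holomorphic_on_def field_differentiable_def intro: has_field_derivative_at_within)

lemma Re_cauchy_kernel:
  assumes "Im z > 0"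
  shows "Re (cauchy_kernel z t) = (t - Re z) / ((t - Re z)\<^sup>2 + (Im z)\<^sup>2) - t / (1 + t\<^sup>2)"
proof -
  have "of_real t / (1 + (of_real t)\<^sup>2) = complex_of_real (t / (1 + t\<^sup>2))" by simp
  then have "Re (of_real t / (1 + (of_real t)\<^sup>2)) = t / (1 + t\<^sup>2)" by (simp only: Re_complex_of_real)
  then show ?thesis by (simp add: cauchy_kernel_def Re_divide)
qed

lemma Im_cauchy_kernel:
  assumes "Im z > 0"
  shows "Im (cauchy_kernel z t) = Im z / ((t - Re z)\<^sup>2 + (Im z)\<^sup>2)"
proof -
  have "of_real t / (1 + (of_real t)\<^sup>2) = complex_of_real (t / (1 + t\<^sup>2))" by simp
  then have "Im (of_real t / (1 + (of_real t)\<^sup>2)) = 0" by (simp only: Im_complex_of_real)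
  then show ?thesis by (simp add: cauchy_kernel_def Im_divide)
qed

lemma has_bochner_integral_Re_cauchy_transform:
  assumes "poisson_summable h" "Im z > 0"
  shows "has_bochner_integral lborel
    (\<lambda>t. h t * ((t - Re z) / ((t - Re z)\<^sup>2 + (Im z)\<^sup>2) - t / (1 + t\<^sup>2))) (Re (cauchy_transform h z))"
proof -
  have "has_bochner_integral lborel (\<lambda>t. Re (of_real (h t) * cauchy_kernel z t)) (Re (cauchy_transform h z))"
    using integrable_cauchy_kernel[OF assms]
    by (simp add: has_bochner_integral_iff cauchy_transform_def integral_Re integrable_Re del: times_complex.sel)
  then show ?thesis by (simp add: Re_cauchy_kernel[OF assms(2)])
qed

lemma has_bochner_integral_Im_cauchy_transform:
  assumes "poisson_summable h" "Im z > 0"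
  shows "has_bochner_integral lborel
    (\<lambda>t. h t * (Im z / ((t - Re z)\<^sup>2 + (Im z)\<^sup>2))) (Im (cauchy_transform h z))"
proof -
  have "has_bochner_integral lborel (\<lambda>t. Im (of_real (h t) * cauchy_kernel z t)) (Im (cauchy_transform h z))"
    using integrable_cauchy_kernel[OF assms]
    by (simp add: has_bochner_integral_iff cauchy_transform_def integral_Im integrable_Im del: times_complex.sel)
  then show ?thesis by (simp add: Im_cauchy_kernel[OF assms(2)])
qed

text \<open>
  Since \<open>-1/(t-z)\<close> is a primitive that vanishes at both ends, a constant may be subtracted from \<open>h\<close> in
  \<open>cauchy_deriv h\<close>.
\<close>
lemma integral_inverse_square_shift:
  assumes z: "Im z > 0"
  shows "(LINT t|lborel. 1 / (of_real t - z)\<^sup>2) = 0"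
proof -
  have hc: "poisson_summable (\<lambda>_. 1)"
    using integrable_inverse_1_plus_square
    by (simp add: poisson_summable_def set_integrable_def einterval_def divide_inverse)
  have lim: "((\<lambda>t. - 1 / (of_real t - z)) \<longlongrightarrow> 0) F" if "filterlim (\<lambda>t. norm (complex_of_real t)) at_top F" for F
  proof -
    have "filterlim (\<lambda>t. of_real t - z) at_infinity F"
      using tendsto_add_filterlim_at_infinity'[OF filterlim_norm_at_top_imp_at_infinity[OF that] tendsto_const[of "-z"]]
      by simp
    then show ?thesis using tendsto_divide_0[OF tendsto_const] by blast
  qed
  have "(LBINT t=-\<infinity>..\<infinity>. 1 / (of_real t - z)\<^sup>2) = 0 - 0"
  proof (rule interval_integral_FTC_integrable[where F = "\<lambda>t. - 1 / (of_real t - z)"])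
    show "((\<lambda>t. - 1 / (of_real t - z)) has_vector_derivative 1 / (of_real t - z)\<^sup>2) (at t)" for t
      using of_real_neq_of_Im_pos[OF z, of t]
      by (auto intro!: derivative_eq_intros has_vector_derivative_real_field simp: field_simps power2_eq_square)
    show "isCont (\<lambda>t. 1 / (of_real t - z)\<^sup>2) t" for t
      using of_real_neq_of_Im_pos[OF z, of t] by (intro continuous_intros) auto
    show "set_integrable lborel (einterval (- \<infinity>) \<infinity>) (\<lambda>t. 1 / (of_real t - z)\<^sup>2)"
      using integrable_cauchy_deriv[OF hc z] by (simp add: set_integrable_def einterval_def)
    show "(((\<lambda>t. - 1 / (of_real t - z)) \<circ> real_of_ereal) \<longlongrightarrow> 0) (at_right (- \<infinity>))"
      unfolding ereal_tendsto_simps by (rule lim) (simp, real_asymp)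
    show "(((\<lambda>t. - 1 / (of_real t - z)) \<circ> real_of_ereal) \<longlongrightarrow> 0) (at_left \<infinity>)"
      unfolding ereal_tendsto_simps by (rule lim) (simp add: filterlim_abs_real)
  qed simp
  then show ?thesis by (simp add: interval_lebesgue_integral_def set_lebesgue_integral_def einterval_def)
qed

section \<open>Poisson regularisation of a Hoelder function\<close>

text \<open>
  The two estimates of this locale, \<open>poisson_extension_close\<close> and \<open>Re_cauchy_transform_lipschitz\<close>, have the same
  bound up to the factor \<open>1/y\<close>, because \<open>1/\<bar>t-z\<bar>\<^sup>2\<close> is \<open>\<pi>/y\<close> times the Poisson kernel. This is why a
  single parameter \<open>y\<close> balances closeness against the speed of the conjugate function.
\<close>
locale holder_function =
  fixes h :: "real \<Rightarrow> real" and K a :: real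
  assumes holder: "\<And>x y. \<bar>h x - h y\<bar> \<le> K * \<bar>x - y\<bar> powr a"
    and a: "0 < a" "a < 1" and K: "K \<ge> 0"
begin

lemma cos_pos: "cos (pi * a / 2) > 0"
proof (rule cos_gt_zero_pi)
  have "pi * a < pi * 1" using a by (intro mult_strict_left_mono) auto
  then show "pi * a / 2 < pi / 2" by simp
  have "pi * a / 2 > 0" using a by simp
  then show "- (pi / 2) < pi * a / 2" using pi_gt_zero by linarith
qed

lemma continuous: "continuous_on UNIV h"
proof -
  have "isCont h x" for x
  proof -
    have "((\<lambda>y. K * \<bar>y - x\<bar> powr a) \<longlongrightarrow> K * 0) (at x)"
    proof (intro tendsto_mult tendsto_const)
      have "((\<lambda>y. \<bar>y - x\<bar>) \<longlongrightarrow> 0) (at x)" by (auto intro!: tendsto_eq_intros)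
      then show "((\<lambda>y. \<bar>y - x\<bar> powr a) \<longlongrightarrow> 0) (at x)"
        using tendsto_powr'[of "\<lambda>y. \<bar>y - x\<bar>" 0 "at x" "\<lambda>_. a" a] a by simp
    qed
    then have lim: "((\<lambda>y. K * \<bar>y - x\<bar> powr a) \<longlongrightarrow> 0) (at x)" by simp
    have "((\<lambda>y. h y - h x) \<longlongrightarrow> 0) (at x)"
      by (rule Lim_null_comparison[OF _ lim], rule always_eventually) (simp add: holder)
    then show ?thesis by (simp add: isCont_def LIM_zero_iff)
  qed
  then show ?thesis by (simp add: continuous_on_eq_continuous_at)
qed

lemma borel [measurable]: "h \<in> borel_measurable borel"
  by (rule borel_measurable_continuous_onI[OF continuous])

lemma poisson_summable: "poisson_summable h"
  unfolding poisson_summable_def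
proof
  have "integrable lborel (\<lambda>t. \<bar>h 0\<bar> * (1 / (1 + t\<^sup>2)) + K * (\<bar>t\<bar> powr a / (1 + t\<^sup>2)))"
    using has_bochner_integral_lorentz_std has_bochner_integral_powr_lorentz_std[OF a]
    by (intro Bochner_Integration.integrable_add integrable_mult_right) (auto simp: has_bochner_integral_iff)
  then show "integrable lborel (\<lambda>t. h t / (1 + t\<^sup>2))"
  proof (rule Bochner_Integration.integrable_bound)
    show "AE t in lborel. norm (h t / (1 + t\<^sup>2)) \<le> norm (\<bar>h 0\<bar> * (1 / (1 + t\<^sup>2)) + K * (\<bar>t\<bar> powr a / (1 + t\<^sup>2)))"
    proof (rule AE_I2)
      fix t :: real
      have "\<bar>h t\<bar> \<le> \<bar>h 0\<bar> + K * \<bar>t\<bar> powr a" using holder[of t 0] by simp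
      then have "\<bar>h t\<bar> / (1 + t\<^sup>2) \<le> (\<bar>h 0\<bar> + K * \<bar>t\<bar> powr a) / (1 + t\<^sup>2)" by (intro divide_right_mono) auto
      also have "\<dots> = \<bar>h 0\<bar> * (1 / (1 + t\<^sup>2)) + K * (\<bar>t\<bar> powr a / (1 + t\<^sup>2))" by (simp add: add_divide_distrib)
      finally show "norm (h t / (1 + t\<^sup>2)) \<le> norm (\<bar>h 0\<bar> * (1 / (1 + t\<^sup>2)) + K * (\<bar>t\<bar> powr a / (1 + t\<^sup>2)))"
        by (simp add: abs_divide)
    qed
  qed measurable
qed (rule borel)

lemma integral_holder_lorentz:
  assumes y: "y > 0"
  shows "has_bochner_integral lborel (\<lambda>t. K * (\<bar>t - x\<bar> powr a * (y / ((t - x)\<^sup>2 + y\<^sup>2)))) (pi * (K * y powr a / cos (pi * a / 2)))"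
proof -
  have "has_bochner_integral lborel (\<lambda>t. K * (\<bar>t - x\<bar> powr a * (y / ((t - x)\<^sup>2 + y\<^sup>2)))) (K * (pi * y powr a / cos (pi * a / 2)))"
    by (rule has_bochner_integral_mult_right) (rule has_bochner_integral_powr_lorentz[OF a y])
  then show ?thesis by (simp add: ac_simps)
qed

lemma poisson_extension_close:
  assumes y: "y > 0"
  shows "\<bar>Im (cauchy_transform h (Complex x y)) - pi * h x\<bar> \<le> pi * (K * y powr a / cos (pi * a / 2))"
proof -
  have "has_bochner_integral lborel (\<lambda>t. h t * (y / ((t - x)\<^sup>2 + y\<^sup>2))) (Im (cauchy_transform h (Complex x y)))"
    using has_bochner_integral_Im_cauchy_transform[OF poisson_summable, of "Complex x y"] y by simp
  moreover have "has_bochner_integral lborel (\<lambda>t. h x * (y / ((t - x)\<^sup>2 + y\<^sup>2))) (h x * pi)"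
    by (rule has_bochner_integral_mult_right) (rule has_bochner_integral_lorentz[OF y])
  ultimately have d: "has_bochner_integral lborel (\<lambda>t. h t * (y / ((t - x)\<^sup>2 + y\<^sup>2)) - h x * (y / ((t - x)\<^sup>2 + y\<^sup>2)))
      (Im (cauchy_transform h (Complex x y)) - h x * pi)" by (rule has_bochner_integral_diff)
  note i = integral_holder_lorentz[OF y, of x]
  have "norm (LINT t|lborel. h t * (y / ((t - x)\<^sup>2 + y\<^sup>2)) - h x * (y / ((t - x)\<^sup>2 + y\<^sup>2)))
      \<le> (LINT t|lborel. K * (\<bar>t - x\<bar> powr a * (y / ((t - x)\<^sup>2 + y\<^sup>2))))"
  proof (rule Bochner_Integration.integral_norm_bound_integral)
    fix t
    have "norm (h t * (y / ((t - x)\<^sup>2 + y\<^sup>2)) - h x * (y / ((t - x)\<^sup>2 + y\<^sup>2))) = \<bar>h t - h x\<bar> * (y / ((t - x)\<^sup>2 + y\<^sup>2))"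
      unfolding left_diff_distrib[symmetric] real_norm_def abs_mult using y by simp
    also have "\<dots> \<le> (K * \<bar>t - x\<bar> powr a) * (y / ((t - x)\<^sup>2 + y\<^sup>2))"
      using y holder by (intro mult_right_mono) auto
    finally show "norm (h t * (y / ((t - x)\<^sup>2 + y\<^sup>2)) - h x * (y / ((t - x)\<^sup>2 + y\<^sup>2))) \<le> K * (\<bar>t - x\<bar> powr a * (y / ((t - x)\<^sup>2 + y\<^sup>2)))"
      by (simp only: mult.assoc)
  qed (use d i in \<open>auto simp: has_bochner_integral_iff\<close>)
  then show ?thesis using d i by (simp add: has_bochner_integral_iff mult.commute)
qed

text \<open>
  As the kernel \<open>1/(t-z)\<^sup>2\<close> has integral zero, only the oscillation \<open>h t - h x\<close> contributes.
\<close>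
lemma norm_cauchy_deriv_le:
  assumes y: "y > 0"
  shows "norm (cauchy_deriv h (Complex x y)) \<le> pi * (K * y powr a / cos (pi * a / 2)) / y"
proof -
  define z where "z = Complex x y"
  have z: "Im z > 0" using y by (simp add: z_def)
  have lc1: "poisson_summable (\<lambda>_. 1)"
    using has_bochner_integral_lorentz_std by (simp add: poisson_summable_def has_bochner_integral_iff)
  note i1 = integrable_cauchy_deriv[OF poisson_summable z]
  have i2: "integrable lborel (\<lambda>t. of_real (h x) * (1 / (of_real t - z)\<^sup>2))"
    using integrable_cauchy_deriv[OF lc1 z] by (intro integrable_mult_right) simp
  have "cauchy_deriv h z = (LINT t|lborel. of_real (h t) / (of_real t - z)\<^sup>2) - of_real (h x) * (LINT t|lborel. 1 / (of_real t - z)\<^sup>2)"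
    by (simp add: integral_inverse_square_shift[OF z] cauchy_deriv_def)
  also have "\<dots> = (LINT t|lborel. of_real (h t) / (of_real t - z)\<^sup>2 - of_real (h x) * (1 / (of_real t - z)\<^sup>2))"
    unfolding integral_mult_right_zero[symmetric] by (rule Bochner_Integration.integral_diff[OF i1 i2, symmetric])
  finally have e: "cauchy_deriv h z = (LINT t|lborel. of_real (h t) / (of_real t - z)\<^sup>2 - of_real (h x) * (1 / (of_real t - z)\<^sup>2))" .
  have j: "has_bochner_integral lborel (\<lambda>t. K * (\<bar>t - x\<bar> powr a * (y / ((t - x)\<^sup>2 + y\<^sup>2))) / y) (pi * (K * y powr a / cos (pi * a / 2)) / y)"
    by (rule has_bochner_integral_divide) (rule integral_holder_lorentz[OF y])
  have "norm (LINT t|lborel. of_real (h t) / (of_real t - z)\<^sup>2 - of_real (h x) * (1 / (of_real t - z)\<^sup>2))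
      \<le> (LINT t|lborel. K * (\<bar>t - x\<bar> powr a * (y / ((t - x)\<^sup>2 + y\<^sup>2))) / y)"
  proof (rule Bochner_Integration.integral_norm_bound_integral)
    show "integrable lborel (\<lambda>t. of_real (h t) / (of_real t - z)\<^sup>2 - of_real (h x) * (1 / (of_real t - z)\<^sup>2))"
      by (intro Bochner_Integration.integrable_diff i1 i2)
    show "integrable lborel (\<lambda>t. K * (\<bar>t - x\<bar> powr a * (y / ((t - x)\<^sup>2 + y\<^sup>2))) / y)"
      using j by (simp add: has_bochner_integral_iff)
    fix t
    have n: "(norm (of_real t - z))\<^sup>2 = (t - x)\<^sup>2 + y\<^sup>2" by (simp add: cmod_power2 z_def)
    have "of_real (h t) / (of_real t - z)\<^sup>2 - of_real (h x) * (1 / (of_real t - z)\<^sup>2) = of_real (h t - h x) / (of_real t - z)\<^sup>2"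
      by (simp add: diff_divide_distrib)
    then have "norm (of_real (h t) / (of_real t - z)\<^sup>2 - of_real (h x) * (1 / (of_real t - z)\<^sup>2)) = \<bar>h t - h x\<bar> / ((t - x)\<^sup>2 + y\<^sup>2)"
      by (simp only: norm_divide norm_power n norm_of_real)
    also have "\<dots> \<le> (K * \<bar>t - x\<bar> powr a) / ((t - x)\<^sup>2 + y\<^sup>2)" using holder by (intro divide_right_mono) auto
    also have "\<dots> = K * (\<bar>t - x\<bar> powr a * (y / ((t - x)\<^sup>2 + y\<^sup>2))) / y" using y by simp
    finally show "norm (of_real (h t) / (of_real t - z)\<^sup>2 - of_real (h x) * (1 / (of_real t - z)\<^sup>2))
      \<le> K * (\<bar>t - x\<bar> powr a * (y / ((t - x)\<^sup>2 + y\<^sup>2))) / y" .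
  qed
  then show ?thesis using j unfolding e[symmetric] by (simp add: has_bochner_integral_iff z_def)
qed

lemma Re_cauchy_transform_lipschitz:
  assumes y: "y > 0"
  shows "\<bar>Re (cauchy_transform h (Complex u y)) - Re (cauchy_transform h (Complex v y))\<bar>
       \<le> pi * (K * y powr a / cos (pi * a / 2)) / y * \<bar>u - v\<bar>"
proof -
  \<comment> \<open>The horizontal line is convex, so the bound on the derivative along it suffices.\<close>
  define S where "S = {z. Im z = y}"
  have "norm (cauchy_transform h (Complex u y) - cauchy_transform h (Complex v y))
      \<le> pi * (K * y powr a / cos (pi * a / 2)) / y * norm (Complex u y - Complex v y)"
  proof (rule field_differentiable_bound[where S = S])
    show "convex S"
    proof -
      have "S = {z. \<i> \<bullet> z = y}" by (auto simp: S_def inner_complex_def)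
      then show ?thesis by (simp only: convex_hyperplane)
    qed
    fix z assume z: "z \<in> S"
    then have "Im z > 0" "z = Complex (Re z) y" using y by (auto simp: S_def complex_eq_iff)
    then show "(cauchy_transform h has_field_derivative cauchy_deriv h z) (at z within S)"
      "norm (cauchy_deriv h z) \<le> pi * (K * y powr a / cos (pi * a / 2)) / y"
      using has_field_derivative_cauchy_transform[OF poisson_summable] norm_cauchy_deriv_le[OF y, of "Re z"]
      by (auto intro: has_field_derivative_at_within)
  qed (auto simp: S_def)
  moreover have "norm (Complex u y - Complex v y) = \<bar>u - v\<bar>"
    by (simp add: cmod_def)
  moreover have "\<bar>Re (cauchy_transform h (Complex u y)) - Re (cauchy_transform h (Complex v y))\<bar>
      \<le> norm (cauchy_transform h (Complex u y) - cauchy_transform h (Complex v y))"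
    using abs_Re_le_cmod[of "cauchy_transform h (Complex u y) - cauchy_transform h (Complex v y)"] by simp
  ultimately show ?thesis by simp
qed

lemma poisson_extension_le:
  assumes "AE t in lborel. h t \<le> M" and z: "Im z > 0"
  shows "Im (cauchy_transform h z) \<le> pi * M"
proof -
  have 1: "has_bochner_integral lborel (\<lambda>t. h t * (Im z / ((t - Re z)\<^sup>2 + (Im z)\<^sup>2))) (Im (cauchy_transform h z))"
    by (rule has_bochner_integral_Im_cauchy_transform[OF poisson_summable z])
  have 2: "has_bochner_integral lborel (\<lambda>t. M * (Im z / ((t - Re z)\<^sup>2 + (Im z)\<^sup>2))) (M * pi)"
    by (rule has_bochner_integral_mult_right) (rule has_bochner_integral_lorentz[OF z])
  have "AE t in lborel. h t * (Im z / ((t - Re z)\<^sup>2 + (Im z)\<^sup>2)) \<le> M * (Im z / ((t - Re z)\<^sup>2 + (Im z)\<^sup>2))"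
    using assms(1) by eventually_elim (rule mult_right_mono, use z in simp_all)
  then have "(LINT t|lborel. h t * (Im z / ((t - Re z)\<^sup>2 + (Im z)\<^sup>2))) \<le> (LINT t|lborel. M * (Im z / ((t - Re z)\<^sup>2 + (Im z)\<^sup>2)))"
    using 1 2 by (intro integral_mono_AE) (auto simp: has_bochner_integral_iff)
  then show ?thesis using 1 2 by (simp add: has_bochner_integral_iff mult.commute)
qed

end

section \<open>Cauchy integrals along horizontal lines\<close>

lemma norm_of_real_diff_ge:
  assumes "Im u \<noteq> 0"
  obtains D where "D > 0" "\<And>x. 1 + \<bar>x\<bar> \<le> D * norm (of_real x - u)"
proof (cases "Im u > 0")
  case True
  then show ?thesis using that one_plus_abs_le height_ratio_pos by blast
next
  case False
  then have i: "Im (cnj u) > 0" using assms by simp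
  have "norm (of_real x - cnj u) = norm (of_real x - u)" for x
    by (metis complex_cnj_cnj complex_cnj_complex_of_real complex_cnj_diff complex_mod_cnj)
  then show ?thesis using that[of "height_ratio (cnj u)"] one_plus_abs_le[OF i] height_ratio_pos[OF i] by simp
qed

lemma integrable_lorentz_std: "integrable lborel (\<lambda>x::real. 1 / (1 + x\<^sup>2))"
  using has_bochner_integral_lorentz_std by (simp add: has_bochner_integral_iff)

lemma integrable_of_inverse_square_bound:
  fixes g :: "real \<Rightarrow> complex"
  assumes "g \<in> borel_measurable borel" "\<And>x. norm (g x) \<le> C / (1 + x\<^sup>2)"
  shows "integrable lborel g" "norm (LINT x|lborel. g x) \<le> C * pi"
proof -
  have i: "integrable lborel (\<lambda>x::real. C * (1 / (1 + x\<^sup>2)))"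
    by (intro integrable_mult_right integrable_lorentz_std)
  show "integrable lborel g"
    by (rule Bochner_Integration.integrable_bound[OF i]) (use assms in \<open>auto simp: divide_inverse intro!: AE_I2 order.trans[OF assms(2)]\<close>)
  then have "norm (LINT x|lborel. g x) \<le> (LINT x|lborel. C * (1 / (1 + x\<^sup>2)))"
    by (rule Bochner_Integration.integral_norm_bound_integral[OF _ i]) (use assms in auto)
  also have "\<dots> = C * pi"
    unfolding integral_mult_right_zero using has_bochner_integral_lorentz_std by (simp add: has_bochner_integral_iff)
  finally show "norm (LINT x|lborel. g x) \<le> C * pi" .
qed

lemma borel_measurable_on_horizontal_line:
  assumes "f holomorphic_on {w. Im w > 0}" "a > 0"
  shows "(\<lambda>x. f (Complex x a)) \<in> borel_measurable borel"
proof (rule borel_measurable_continuous_onI)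
  have "continuous_on UNIV (\<lambda>x. Complex x a)"
    by (simp add: Complex_eq continuous_intros)
  then show "continuous_on UNIV (\<lambda>x. f (Complex x a))"
    by (rule continuous_on_compose2[OF holomorphic_on_imp_continuous_on[OF assms(1)]]) (use assms in auto)
qed

lemma has_contour_integral_horizontal:
  assumes "(g has_contour_integral I) (linepath (Complex p a) (Complex q a))" "p < q"
  shows "((\<lambda>x. g (Complex x a)) has_integral I) {p..q}"
proof -
  have "((\<lambda>w. g (w + \<i> * a)) has_contour_integral I) (linepath (of_real p) (of_real q))"
    using assms(1) unfolding has_contour_integral_linepath
    by (simp add: linepath_def Complex_eq algebra_simps flip: scaleR_add_left)
  then have "((\<lambda>x. g (of_real x + \<i> * a)) has_integral I) {p..q}"
    using assms(2) by (subst (asm) has_contour_integral_linepath_Reals_iff) auto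
  then show ?thesis by (simp add: Complex_eq)
qed

lemma tendsto_integral_symmetric:
  fixes g :: "real \<Rightarrow> complex"
  assumes g: "integrable lborel g"
  shows "(\<lambda>n. integral {-real n..real n} g) \<longlonglongrightarrow> (LINT x|lborel. g x)"
proof -
  have "(\<lambda>n. LINT x|lborel. indicator {-real n..real n} x *\<^sub>R g x) \<longlonglongrightarrow> (LINT x|lborel. g x)"
  proof (rule integral_dominated_convergence[where w = "\<lambda>x. norm (g x)"])
    show "AE x in lborel. (\<lambda>n. indicator {-real n..real n} x *\<^sub>R g x) \<longlonglongrightarrow> g x"
    proof (rule AE_I2)
      fix x :: real
      have "\<forall>\<^sub>F n in sequentially. \<bar>x\<bar> \<le> real n"
        using eventually_ge_at_top[of "nat \<lceil>\<bar>x\<bar>\<rceil>"] by eventually_elim linarith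
      then have "\<forall>\<^sub>F n in sequentially. indicator {-real n..real n} x *\<^sub>R g x = g x"
        by eventually_elim (auto simp: indicator_def)
      then show "(\<lambda>n. indicator {-real n..real n} x *\<^sub>R g x) \<longlonglongrightarrow> g x"
        by (rule tendsto_eventually)
    qed
  qed (use g in \<open>auto simp: indicator_def\<close>)
  moreover have "(LINT x|lborel. indicator {-real n..real n} x *\<^sub>R g x) = integral {-real n..real n} g" for n
  proof -
    have "set_integrable lborel {-real n..real n} g"
      using g unfolding set_integrable_def by (rule integrable_mult_indicator[rotated]) auto
    from set_borel_integral_eq_integral(2)[OF this] show ?thesis by (simp add: set_lebesgue_integral_def)
  qed
  ultimately show ?thesis by simp
qed

text \<open>
  Cauchy's formula on the rectangles with corners \<open>\<plusminus>n + ia\<close>, \<open>\<plusminus>n + ib\<close>: the vertical sides have fixed length and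
  the integrand tends to zero on them. Decay like \<open>1/\<bar>w\<bar>\<close> makes both line integrals converge and admits
  \<open>f(w) = (w - z) g(w)\<close> with \<open>g\<close> of quadratic decay.
\<close>
lemma cauchy_formula_strip:
  assumes holf: "f holomorphic_on {w. Im w > 0}"
    and a: "0 < a" "a < Im z" "Im z < b"
    and B: "\<And>w. a \<le> Im w \<Longrightarrow> Im w \<le> b \<Longrightarrow> norm (f w) \<le> B / (1 + norm w)"
  shows "(LINT x|lborel. f (Complex x a) / (Complex x a - z)) - (LINT x|lborel. f (Complex x b) / (Complex x b - z))
      = 2 * pi * \<i> * f z"
proof -
  define g where "g = (\<lambda>w. f w / (w - z))"
  have B0: "B \<ge> 0"
    using order.trans[OF norm_ge_zero B[of z]] a by (simp add: zero_le_divide_iff) (smt (verit) norm_ge_zero)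
  have int: "integrable lborel (\<lambda>x. g (Complex x c))" if c: "c \<in> {a, b}" for c
  proof -
    have "Im (z - \<i> * c) \<noteq> 0" using c a by auto
    then obtain D where D: "D > 0" "\<And>x. 1 + \<bar>x\<bar> \<le> D * norm (of_real x - (z - \<i> * c))"
      using norm_of_real_diff_ge by blast
    have c0: "c > 0" using c a by auto
    show ?thesis
    proof (rule integrable_of_inverse_square_bound)
      show "(\<lambda>x. g (Complex x c)) \<in> borel_measurable borel"
        unfolding g_def using borel_measurable_on_horizontal_line[OF holf c0] by (simp add: Complex_eq)
      fix x
      have nz: "Complex x c - z \<noteq> 0" using c a by (auto simp: complex_eq_iff)
      have 1: "1 + \<bar>x\<bar> \<le> D * norm (Complex x c - z)" using D(2)[of x] by (simp add: Complex_eq algebra_simps)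
      have 2: "1 + \<bar>x\<bar> \<le> 1 + norm (Complex x c)" using abs_Re_le_cmod[of "Complex x c"] by simp
      have "1 + x\<^sup>2 \<le> (1 + \<bar>x\<bar>) * (1 + \<bar>x\<bar>)" by (simp add: algebra_simps power2_eq_square)
      also have "\<dots> \<le> (1 + norm (Complex x c)) * (D * norm (Complex x c - z))"
        using 1 2 by (intro mult_mono) auto
      finally have 3: "1 + x\<^sup>2 \<le> (1 + norm (Complex x c)) * (D * norm (Complex x c - z))" .
      have "norm (g (Complex x c)) \<le> B / (1 + norm (Complex x c)) / norm (Complex x c - z)"
        unfolding g_def norm_divide using B[of "Complex x c"] c a by (intro divide_right_mono) auto
      also have "\<dots> = B * D / ((1 + norm (Complex x c)) * (D * norm (Complex x c - z)))"
        using D(1) nz by simp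
      also have "\<dots> \<le> B * D / (1 + x\<^sup>2)"
      proof (rule divide_left_mono[OF 3])
        have p: "1 + x\<^sup>2 > 0" by (simp add: add_pos_nonneg)
        with 3 have "(1 + norm (Complex x c)) * (D * norm (Complex x c - z)) > 0" by linarith
        with p show "0 < (1 + norm (Complex x c)) * (D * norm (Complex x c - z)) * (1 + x\<^sup>2)"
          by (rule mult_pos_pos[rotated])
      qed (use B0 D(1) in auto)
      finally show "norm (g (Complex x c)) \<le> B * D / (1 + x\<^sup>2)" .
    qed
  qed
  define J where "J = (\<lambda>n::nat. integral {-real n..real n} (\<lambda>x. g (Complex x a)) - integral {-real n..real n} (\<lambda>x. g (Complex x b)))"
  have lim: "J \<longlonglongrightarrow> (LINT x|lborel. g (Complex x a)) - (LINT x|lborel. g (Complex x b))"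
    unfolding J_def by (intro tendsto_diff tendsto_integral_symmetric int) auto
  have side: "norm (J n - 2 * pi * \<i> * f z) \<le> 2 * (B * (b - a) / (real n - norm z))"
    if n: "real n > norm z" for n
  proof -
    define R where "R = real n"
    have R: "R > norm z" "R > 0" using n norm_ge_zero[of z] unfolding R_def by linarith+
    define a1 a2 a3 a4 where "a1 = Complex (-R) a" and "a2 = Complex R a" and "a3 = Complex R b" and "a4 = Complex (-R) b"
    have z1: "\<bar>Re z\<bar> < R" using abs_Re_le_cmod[of z] R by linarith
    have zbox: "z \<in> box a1 a3" using z1 a by (auto simp: a1_def a3_def in_box_complex_iff)
    have sub: "w \<in> {w. Im w > 0} - {z}" if "w \<in> path_image (rectpath a1 a3)" for w
      using that a R z1 by (subst (asm) path_image_rectpath) (auto simp: a1_def a3_def)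
    have "(g has_contour_integral (2 * pi * \<i> * winding_number (rectpath a1 a3) z * f z)) (rectpath a1 a3)"
      unfolding g_def
    proof (rule Cauchy_integral_formula_convex_simple[OF _ holf])
      show "convex {w. Im w > 0}" by (rule convex_halfspace_Im_gt)
      show "z \<in> interior {w. Im w > 0}" using a by (simp add: interior_open open_halfspace_Im_gt)
      show "path_image (rectpath a1 a3) \<subseteq> {w. 0 < Im w} - {z}" using sub by blast
    qed auto
    then have ci: "(g has_contour_integral (2 * pi * \<i> * f z)) (rectpath a1 a3)"
      by (simp add: winding_number_rectpath[OF zbox])
    have cont: "continuous_on ({w. Im w > 0} - {z}) g"
      unfolding g_def by (intro continuous_intros continuous_on_subset[OF holomorphic_on_imp_continuous_on[OF holf]]) auto
    have rp: "rectpath a1 a3 = linepath a1 a2 +++ linepath a2 a3 +++ linepath a3 a4 +++ linepath a4 a1"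
      by (simp add: rectpath_def Let_def a1_def a2_def a3_def a4_def)
    have pim: "path_image (rectpath a1 a3) = closed_segment a1 a2 \<union> closed_segment a2 a3 \<union> closed_segment a3 a4 \<union> closed_segment a4 a1"
      unfolding rp by (simp add: path_image_join Un_assoc)
    have seg: "g contour_integrable_on linepath u v" if "closed_segment u v \<subseteq> path_image (rectpath a1 a3)" for u v
      by (rule contour_integrable_continuous_linepath) (use that sub in \<open>blast intro: continuous_on_subset[OF cont]\<close>)
    have i1: "g contour_integrable_on linepath a1 a2" and i2: "g contour_integrable_on linepath a2 a3"
      and i3: "g contour_integrable_on linepath a3 a4" and i4: "g contour_integrable_on linepath a4 a1"
      by (rule seg, simp add: pim; blast)+
    have sum: "contour_integral (rectpath a1 a3) g = contour_integral (linepath a1 a2) g + contour_integral (linepath a2 a3) g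
        + contour_integral (linepath a3 a4) g + contour_integral (linepath a4 a1) g"
      unfolding rp using i1 i2 i3 i4 by simp
    have bot: "contour_integral (linepath a1 a2) g = integral {-R..R} (\<lambda>x. g (Complex x a))"
      using has_contour_integral_horizontal[of g _ "-R" a R] has_contour_integral_integral[OF i1] R
      unfolding a1_def a2_def by (intro integral_unique [symmetric]) auto
    have "contour_integral (linepath a3 a4) g = - contour_integral (linepath a4 a3) g"
    proof (rule contour_integral_reverse_linepath)
      show "continuous_on (closed_segment a3 a4) g"
        by (rule continuous_on_subset[OF cont]) (use sub pim in blast)
    qed
    moreover have "contour_integral (linepath a4 a3) g = integral {-R..R} (\<lambda>x. g (Complex x b))"
    proof -
      have "g contour_integrable_on linepath a4 a3" by (rule seg) (auto simp: pim closed_segment_commute)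
      from has_contour_integral_integral[OF this] show ?thesis
        using has_contour_integral_horizontal[of g _ "-R" b R] R
        unfolding a3_def a4_def by (intro integral_unique [symmetric]) auto
    qed
    ultimately have J: "J n - 2 * pi * \<i> * f z = - (contour_integral (linepath a2 a3) g + contour_integral (linepath a4 a1) g)"
      using sum contour_integral_unique[OF ci] bot by (simp add: J_def R_def algebra_simps)
    have gb: "norm (g w) \<le> B / (R - norm z)" if w: "\<bar>Re w\<bar> = R" "a \<le> Im w" "Im w \<le> b" for w
    proof -
      have "norm w \<ge> R" using abs_Re_le_cmod[of w] w by simp
      then have 1: "norm (w - z) \<ge> R - norm z" using norm_triangle_ineq2[of w z] by linarith
      have 2: "norm (f w) \<le> B"
      proof -
        have "norm (f w) \<le> B / (1 + norm w)" using B w by auto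
        also have "\<dots> \<le> B" using B0 by (simp add: divide_le_eq mult_left_le add_pos_nonneg algebra_simps)
        finally show ?thesis .
      qed
      show ?thesis unfolding g_def norm_divide using 1 2 R B0 by (intro frac_le) auto
    qed
    have s1: "norm (contour_integral (linepath a2 a3) g) \<le> B / (R - norm z) * norm (a3 - a2)"
    proof (rule contour_integral_bound_linepath[OF i2])
      fix w assume "w \<in> closed_segment a2 a3"
      then have "Re w = R \<and> a \<le> Im w \<and> Im w \<le> b"
        using a by (auto simp: a2_def a3_def closed_segment_same_Re closed_segment_eq_real_ivl)
      then show "norm (g w) \<le> B / (R - norm z)" using R by (intro gb) auto
    qed (use B0 R in auto)
    have s2: "norm (contour_integral (linepath a4 a1) g) \<le> B / (R - norm z) * norm (a1 - a4)"
    proof (rule contour_integral_bound_linepath[OF i4])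
      fix w assume "w \<in> closed_segment a4 a1"
      then have "Re w = -R \<and> a \<le> Im w \<and> Im w \<le> b"
        using a by (auto simp: a4_def a1_def closed_segment_same_Re closed_segment_eq_real_ivl)
      then show "norm (g w) \<le> B / (R - norm z)" using R by (intro gb) auto
    qed (use B0 R in auto)
    have n1: "norm (a3 - a2) = b - a" "norm (a1 - a4) = b - a"
      using a by (auto simp: a1_def a2_def a3_def a4_def cmod_def)
    have "norm (J n - 2 * pi * \<i> * f z) \<le> norm (contour_integral (linepath a2 a3) g) + norm (contour_integral (linepath a4 a1) g)"
      unfolding J norm_minus_cancel by (rule norm_triangle_ineq)
    also have "\<dots> \<le> 2 * (B * (b - a) / (R - norm z))" using s1 s2 unfolding n1 by simp
    finally show ?thesis by (simp add: R_def)
  qed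
  have "(\<lambda>n. J n - 2 * pi * \<i> * f z) \<longlonglongrightarrow> 0"
  proof (rule Lim_null_comparison)
    show "\<forall>\<^sub>F n in sequentially. norm (J n - 2 * pi * \<i> * f z) \<le> 2 * (B * (b - a) / (real n - norm z))"
      using eventually_gt_at_top[of "nat \<lceil>norm z\<rceil>"] by eventually_elim (rule side, linarith)
    show "(\<lambda>n. 2 * (B * (b - a) / (real n - norm z))) \<longlonglongrightarrow> 0" by real_asymp
  qed
  then have "J \<longlonglongrightarrow> 2 * pi * \<i> * f z" by (simp add: LIM_zero_iff)
  with lim show ?thesis unfolding g_def by (rule LIMSEQ_unique)
qed

lemma one_plus_norm_mult_le:
  fixes w :: complex
  shows "(norm w + c) * (1 + norm w) \<le> 2 * (1 + \<bar>c\<bar>) * (1 + (norm w)\<^sup>2)"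
proof -
  have "(norm w + c) * (1 + norm w) \<le> ((1 + \<bar>c\<bar>) * (1 + norm w)) * (1 + norm w)"
  proof (intro mult_right_mono)
    have "0 \<le> \<bar>c\<bar> * norm w" by simp
    then show "norm w + c \<le> (1 + \<bar>c\<bar>) * (1 + norm w)"
      unfolding distrib_right distrib_left using abs_ge_self[of c] by linarith
  qed simp
  also have "\<dots> = (1 + \<bar>c\<bar>) * (1 + norm w)\<^sup>2" by (simp add: power2_eq_square)
  also have "\<dots> \<le> (1 + \<bar>c\<bar>) * (2 * (1 + (norm w)\<^sup>2))"
    using zero_le_power2[of "1 - norm w"] by (intro mult_left_mono) (auto simp: power2_eq_square algebra_simps)
  also have "\<dots> = 2 * (1 + \<bar>c\<bar>) * (1 + (norm w)\<^sup>2)" by (simp only: mult.assoc mult.left_commute)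
  finally show ?thesis .
qed

lemma one_plus_le_two_one_plus_square: "1 + (r::real) \<le> 2 * (1 + r\<^sup>2)"
proof -
  have "2 * (1 + r\<^sup>2) - (1 + r) = (1 - r)\<^sup>2 / 2 + (1 + 3 * r\<^sup>2) / 2"
    by (simp add: power2_diff field_simps)
  moreover have "0 \<le> (1 - r)\<^sup>2 / 2 + (1 + 3 * r\<^sup>2) / 2" by simp
  ultimately show ?thesis by linarith
qed

text \<open>
  The strip formula for \<open>f(w) = (w - z) g(w)\<close>, which vanishes at \<open>z\<close>.
\<close>
lemma horizontal_integral_shift:
  assumes holg: "g holomorphic_on {w. Im w > 0}" and a: "0 < a" "a \<le> b"
    and B: "\<And>w. a \<le> Im w \<Longrightarrow> Im w \<le> b \<Longrightarrow> norm (g w) \<le> B / (1 + (norm w)\<^sup>2)"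
  shows "(LINT x|lborel. g (Complex x a)) = (LINT x|lborel. g (Complex x b))"
proof (cases "a = b")
  case False
  with a have ab: "a < b" by simp
  define z where "z = Complex 0 ((a + b) / 2)"
  have z: "a < Im z" "Im z < b" using ab by (auto simp: z_def)
  have B0: "B \<ge> 0"
  proof -
    have "0 \<le> B / (1 + (norm z)\<^sup>2)" using order.trans[OF norm_ge_zero B[of z]] z by simp
    moreover have "1 + (norm z)\<^sup>2 > 0" by (simp add: add_pos_nonneg)
    ultimately show ?thesis by (simp add: zero_le_divide_iff)
  qed
  define f where "f = (\<lambda>w. g w * (w - z))"
  have "(LINT x|lborel. f (Complex x a) / (Complex x a - z)) - (LINT x|lborel. f (Complex x b) / (Complex x b - z))
      = 2 * pi * \<i> * f z"
  proof (rule cauchy_formula_strip[OF _ a(1) z])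
    show "f holomorphic_on {w. 0 < Im w}" unfolding f_def by (intro holomorphic_intros holg)
    fix w assume w: "a \<le> Im w" "Im w \<le> b"
    have p: "1 + (norm w)\<^sup>2 > 0" "1 + norm w > 0" by (simp_all add: add_pos_nonneg)
    have "norm (f w) \<le> B / (1 + (norm w)\<^sup>2) * (norm w + norm z)"
      unfolding f_def norm_mult using B[OF w] B0 p by (intro mult_mono norm_triangle_ineq4) auto
    also have "\<dots> \<le> (B * (2 * (1 + norm z))) / (1 + norm w)"
    proof -
      have "B * ((norm w + norm z) * (1 + norm w)) \<le> B * (2 * (1 + norm z) * (1 + (norm w)\<^sup>2))"
        using one_plus_norm_mult_le[of w "norm z"] B0 by (intro mult_left_mono) auto
      then show ?thesis using p by (simp add: divide_le_eq le_divide_eq)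
    qed
    finally show "norm (f w) \<le> (B * (2 * (1 + norm z))) / (1 + norm w)" .
  qed
  moreover have "f (Complex x c) / (Complex x c - z) = g (Complex x c)" if "c \<in> {a, b}" for x c
  proof -
    have "Complex x c - z \<noteq> 0" using that z by (auto simp: complex_eq_iff)
    then show ?thesis by (simp add: f_def)
  qed
  ultimately show ?thesis by (simp add: f_def)
qed simp

text \<open>
  In the strip formula the upper line is moved to infinity; its integral is at most \<open>B\<pi>/(b - Im z)\<close>.
\<close>
lemma cauchy_formula_half_plane:
  assumes holf: "f holomorphic_on {w. Im w > 0}" and a: "0 < a" "a < Im z"
    and B: "\<And>w. 0 < Im w \<Longrightarrow> norm (f w) \<le> B / (1 + (norm w)\<^sup>2)"
  shows "(LINT x|lborel. f (Complex x a) / (Complex x a - z)) = 2 * pi * \<i> * f z"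
proof -
  have B0: "B \<ge> 0"
  proof -
    have "0 \<le> B / (1 + (norm z)\<^sup>2)" using order.trans[OF norm_ge_zero B[of z]] a by simp
    moreover have "1 + (norm z)\<^sup>2 > 0" by (simp add: add_pos_nonneg)
    ultimately show ?thesis by (simp add: zero_le_divide_iff)
  qed
  define I where "I = (LINT x|lborel. f (Complex x a) / (Complex x a - z))"
  have bd: "norm (I - 2 * pi * \<i> * f z) \<le> B * pi / (b - Im z)" if b: "Im z < b" for b
  proof -
    have "I - (LINT x|lborel. f (Complex x b) / (Complex x b - z)) = 2 * pi * \<i> * f z"
      unfolding I_def
    proof (rule cauchy_formula_strip[OF holf a b])
      fix w assume w: "a \<le> Im w" "Im w \<le> b"
      have p: "1 + (norm w)\<^sup>2 > 0" "1 + norm w > 0" by (simp_all add: add_pos_nonneg)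
      have "norm (f w) \<le> B / (1 + (norm w)\<^sup>2)" using w a by (intro B) auto
      also have "\<dots> \<le> (2 * B) / (1 + norm w)"
      proof -
        have "1 + norm w \<le> 2 * (1 + (norm w)\<^sup>2)" by (rule one_plus_le_two_one_plus_square)
        then have "B * (1 + norm w) \<le> B * (2 * (1 + (norm w)\<^sup>2))" using B0 by (intro mult_left_mono) auto
        then show ?thesis using p by (simp add: divide_le_eq le_divide_eq algebra_simps)
      qed
      finally show "norm (f w) \<le> (2 * B) / (1 + norm w)" .
    qed
    then have e: "I - 2 * pi * \<i> * f z = (LINT x|lborel. f (Complex x b) / (Complex x b - z))"
      by (simp add: algebra_simps)
    have b0: "b > 0" using a b by simp
    have "norm (LINT x|lborel. f (Complex x b) / (Complex x b - z)) \<le> (B / (b - Im z)) * pi"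
    proof (rule integrable_of_inverse_square_bound(2))
      show "(\<lambda>x. f (Complex x b) / (Complex x b - z)) \<in> borel_measurable borel"
        using borel_measurable_on_horizontal_line[OF holf b0] by (simp add: Complex_eq)
      fix x
      have 1: "norm (f (Complex x b)) \<le> B / (1 + x\<^sup>2)"
      proof -
        have "norm (f (Complex x b)) \<le> B / (1 + (norm (Complex x b))\<^sup>2)" using b0 by (intro B) auto
        also have "\<dots> \<le> B / (1 + x\<^sup>2)"
          using B0 by (intro divide_left_mono mult_pos_pos) (auto simp: cmod_power2 add_pos_nonneg)
        finally show ?thesis .
      qed
      have 2: "b - Im z \<le> norm (Complex x b - z)" using abs_Im_le_cmod[of "Complex x b - z"] by simp
      have "norm (f (Complex x b) / (Complex x b - z)) \<le> (B / (1 + x\<^sup>2)) / (b - Im z)"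
        unfolding norm_divide using 1 2 b B0 by (intro frac_le) auto
      then show "norm (f (Complex x b) / (Complex x b - z)) \<le> B / (b - Im z) / (1 + x\<^sup>2)" by (simp add: ac_simps)
    qed
    then show ?thesis unfolding e by simp
  qed
  have "norm (I - 2 * pi * \<i> * f z) \<le> 0"
  proof (rule tendsto_lowerbound)
    show "(\<lambda>n. B * pi / (real n - Im z)) \<longlonglongrightarrow> 0" by real_asymp
    show "\<forall>\<^sub>F n in sequentially. norm (I - 2 * pi * \<i> * f z) \<le> B * pi / (real n - Im z)"
      using eventually_gt_at_top[of "nat \<lceil>Im z\<rceil>"] by eventually_elim (rule bd, linarith)
  qed simp
  then show ?thesis by (simp add: I_def)
qed

section \<open>A Paley-Wiener theorem from the half-plane\<close>

lemma integral_exp_half_line: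
  fixes c :: complex
  assumes "Re c < 0"
  shows "integrable lborel (\<lambda>t. indicator {0<..} t *\<^sub>R exp (c * of_real t))"
    and "(LINT t|lborel. indicator {0<..} t *\<^sub>R exp (c * of_real t)) = - 1 / c"
proof -
  have ei: "einterval 0 \<infinity> = {0::real<..}" by (auto simp: einterval_def)
  have r: "integrable lborel (\<lambda>t. indicator {0<..} t *\<^sub>R exp (- (t * (- Re c))))"
    using integrable_I0i_exp_mscale[of "- Re c"] assms
    by (simp add: interval_lebesgue_integrable_def set_integrable_def ei zero_ereal_def[symmetric])
  show i: "integrable lborel (\<lambda>t. indicator {0<..} t *\<^sub>R exp (c * of_real t))"
    by (rule Bochner_Integration.integrable_bound[OF r]) (auto simp: indicator_def ac_simps)
  have "(LBINT t=0..\<infinity>. exp (c * of_real t)) = 0 - 1 / c"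
  proof (rule interval_integral_FTC_integrable[where F = "\<lambda>t. exp (c * of_real t) / c"])
    show "((\<lambda>t. exp (c * of_real t) / c) has_vector_derivative exp (c * of_real t)) (at t)" for t
      using assms by (auto intro!: derivative_eq_intros has_vector_derivative_real_field)
    show "isCont (\<lambda>t. exp (c * of_real t)) t" for t by (intro continuous_intros)
    show "set_integrable lborel (einterval 0 \<infinity>) (\<lambda>t. exp (c * of_real t))"
      using i by (simp add: set_integrable_def ei)
    have "((\<lambda>t. exp (c * of_real t) / c) \<longlongrightarrow> exp (c * of_real 0) / c) (at_right 0)"
      using assms by (intro tendsto_intros) auto
    then show "(((\<lambda>t. exp (c * of_real t) / c) \<circ> real_of_ereal) \<longlongrightarrow> 1 / c) (at_right 0)"
      unfolding zero_ereal_def ereal_tendsto_simps by simp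
    have "((\<lambda>t. exp (c * of_real t) / c) \<longlongrightarrow> 0) at_top"
    proof (rule Lim_null_comparison)
      show "\<forall>\<^sub>F t in at_top. norm (exp (c * of_real t) / c) \<le> exp (Re c * t) / norm c"
        by (simp add: norm_divide)
      have "((\<lambda>t. exp (r * t)) \<longlongrightarrow> 0) at_top" if "r < 0" for r :: real using that by real_asymp
      from tendsto_divide_zero[OF this[OF assms]]
      show "((\<lambda>t. exp (Re c * t) / norm c) \<longlongrightarrow> 0) at_top" .
    qed
    then show "(((\<lambda>t. exp (c * of_real t) / c) \<circ> real_of_ereal) \<longlongrightarrow> 0) (at_left \<infinity>)"
      unfolding ereal_tendsto_simps .
  qed simp
  then show "(LINT t|lborel. indicator {0<..} t *\<^sub>R exp (c * of_real t)) = - 1 / c"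
    by (simp add: interval_lebesgue_integral_def set_lebesgue_integral_def ei)
qed

lemma integrable_product_bound:
  fixes g :: "real \<times> real \<Rightarrow> complex" and u v :: "real \<Rightarrow> real"
  assumes g: "g \<in> borel_measurable (lborel \<Otimes>\<^sub>M lborel)"
    and u: "integrable lborel u" "\<And>x. u x \<ge> 0" and v: "integrable lborel v" "\<And>x. v x \<ge> 0"
    and b: "\<And>x y. norm (g (x, y)) \<le> u x * v y"
  shows "integrable (lborel \<Otimes>\<^sub>M lborel) g"
proof (rule Bochner_Integration.integrable_bound[OF _ g])
  have [measurable]: "u \<in> borel_measurable lborel" "v \<in> borel_measurable lborel" using u v by auto
  show "integrable (lborel \<Otimes>\<^sub>M lborel) (\<lambda>(x, y). u x * v y)"
  proof (rule lborel_pair.Fubini_integrable)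
    show "integrable lborel (\<lambda>x. LINT y|lborel. norm (case (x, y) of (x, y) \<Rightarrow> u x * v y))"
      using u v by (simp add: abs_mult)
    show "AE x in lborel. integrable lborel (\<lambda>y. case (x, y) of (x, y) \<Rightarrow> u x * v y)"
      using v by simp
  qed measurable
  show "AE x in lborel \<Otimes>\<^sub>M lborel. norm (g x) \<le> norm (case x of (x, y) \<Rightarrow> u x * v y)"
    using b u(2) v(2) by (auto intro!: AE_I2)
qed

text \<open>
  Let \<open>\<psi>\<close> be the Fourier integral of \<open>f\<close> along the line \<open>Im w = a\<close>, times \<open>exp (2\<pi>ta)\<close>. It does not depend on
  \<open>a\<close>. Letting \<open>a\<close> tend to infinity shows that \<open>\<psi>\<close> vanishes for \<open>t < 0\<close>; letting \<open>a\<close> tend to zero, the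
  symmetry \<open>f(x) = exp (2\<pi>i\<sigma>x) cnj (f(x))\<close> of the boundary values exchanges \<open>t\<close> and \<open>\<sigma> - t\<close>, so that \<open>\<psi>\<close>
  vanishes for \<open>t > \<sigma>\<close> as well. The symmetry is only required as an asymptotic statement, almost everywhere;
  the boundary values themselves need not exist. The inversion formula is Cauchy's formula with \<open>1/(w - z)\<close>
  written as an integral of exponentials over the half-line.
\<close>
lemma paley_wiener_half_plane:
  fixes f :: "complex \<Rightarrow> complex" and \<sigma> B :: real
  assumes holf: "f holomorphic_on {w. Im w > 0}" and \<sigma>: "\<sigma> \<ge> 0"
    and B: "\<And>w. 0 < Im w \<Longrightarrow> norm (f w) \<le> B / (1 + (norm w)\<^sup>2)"
    and sym: "AE x in lborel. (\<lambda>n. f (Complex x (1 / real (Suc n)))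
        - exp (2 * pi * \<i> * \<sigma> * x) * cnj (f (Complex x (1 / real (Suc n))))) \<longlonglongrightarrow> 0"
  obtains \<psi> :: "real \<Rightarrow> complex" and M :: real
  where "\<psi> \<in> borel_measurable borel" "\<And>t. norm (\<psi> t) \<le> M" "\<And>t. t \<notin> {0..\<sigma>} \<Longrightarrow> \<psi> t = 0"
    "\<And>z. Im z > 0 \<Longrightarrow> f z = (LINT t|lborel. \<psi> t * exp (2 * pi * \<i> * z * t))"
proof -
  define e where "e = (\<lambda>(x::real) (t::real). exp (- (2 * pi * \<i> * x * t)))"
  define F where "F = (\<lambda>a t. LINT x|lborel. f (Complex x a) * e x t)"
  define \<psi> where "\<psi> = (\<lambda>t. F 1 t * exp (of_real (2 * pi * t)))"
  have B0: "B \<ge> 0"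
  proof -
    have "0 \<le> B / (1 + (norm \<i>)\<^sup>2)" using order.trans[OF norm_ge_zero B[of \<i>]] by simp
    then show ?thesis by (simp add: zero_le_divide_iff)
  qed
  have norm_e [simp]: "norm (e x t) = 1" for x t by (simp add: e_def)
  have e_meas [measurable]: "(\<lambda>p. e (fst p) (snd p)) \<in> borel_measurable (borel \<Otimes>\<^sub>M borel)"
    unfolding e_def by measurable
  have e_meas1 [measurable]: "(\<lambda>x. e x t) \<in> borel_measurable borel" for t
    unfolding e_def by measurable
  have cnj_meas [measurable]: "cnj \<in> borel_measurable borel"
    by (intro borel_measurable_continuous_onI continuous_intros)
  have f_meas: "(\<lambda>x. f (Complex x a)) \<in> borel_measurable borel" if "a > 0" for a
    by (rule borel_measurable_on_horizontal_line[OF holf that])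
  have fB: "norm (f (Complex x a)) \<le> B / (1 + x\<^sup>2)" if "a > 0" for a x
  proof -
    have "norm (f (Complex x a)) \<le> B / (1 + (norm (Complex x a))\<^sup>2)" using that by (intro B) auto
    also have "\<dots> \<le> B / (1 + x\<^sup>2)"
      using B0 by (intro divide_left_mono mult_pos_pos) (auto simp: cmod_power2 add_pos_nonneg)
    finally show ?thesis .
  qed
  have F_int: "integrable lborel (\<lambda>x. f (Complex x a) * e x t)" and F_bound: "norm (F a t) \<le> B * pi"
    if a: "a > 0" for a t
  proof -
    have 1: "(\<lambda>x. f (Complex x a) * e x t) \<in> borel_measurable borel" using f_meas[OF a] by measurable
    have 2: "norm (f (Complex x a) * e x t) \<le> B / (1 + x\<^sup>2)" for x using fB[OF a] by (simp add: norm_mult)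
    show "integrable lborel (\<lambda>x. f (Complex x a) * e x t)" "norm (F a t) \<le> B * pi"
      unfolding F_def using integrable_of_inverse_square_bound[OF 1 2] by auto
  qed
  \<comment> \<open>By Cauchy's theorem \<open>\<psi> t\<close> can be computed on any horizontal line.\<close>
  have shift: "\<psi> t = F a t * exp (of_real (2 * pi * t * a))" if a: "a > 0" for a t
  proof -
    define g where "g = (\<lambda>w. f w * exp (- (2 * pi * \<i> * t) * w))"
    have holg: "g holomorphic_on {w. Im w > 0}" unfolding g_def by (intro holomorphic_intros holf)
    have gF: "(LINT x|lborel. g (Complex x c)) = F c t * exp (of_real (2 * pi * t * c))" if c: "c > 0" for c
    proof -
      have "g (Complex x c) = f (Complex x c) * e x t * exp (of_real (2 * pi * t * c))" for x
        unfolding g_def e_def mult.assoc exp_add[symmetric]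
        by (rule arg_cong[where f = "\<lambda>u. f (Complex x c) * exp u"]) (simp add: complex_eq_iff)
      then show ?thesis using F_int[OF c, of t] by (simp add: F_def)
    qed
    have sh: "(LINT x|lborel. g (Complex x c)) = (LINT x|lborel. g (Complex x d))" if cd: "0 < c" "c \<le> d" for c d
    proof (rule horizontal_integral_shift[OF holg cd])
      fix w assume w: "c \<le> Im w" "Im w \<le> d"
      have "norm (exp (- (2 * pi * \<i> * t) * w)) = exp (2 * pi * t * Im w)" by (simp add: norm_exp_eq_Re)
      also have "\<dots> \<le> exp (2 * pi * \<bar>t\<bar> * d)"
        using w cd by (auto intro!: mult_mono order.trans[OF mult_right_mono mult_left_mono, of _ "2*pi*\<bar>t\<bar>"])
      finally have "norm (exp (- (2 * pi * \<i> * t) * w)) \<le> exp (2 * pi * \<bar>t\<bar> * d)" .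
      moreover have "norm (f w) \<le> B / (1 + (norm w)\<^sup>2)" using w cd by (intro B) auto
      ultimately have "norm (g w) \<le> B / (1 + (norm w)\<^sup>2) * exp (2 * pi * \<bar>t\<bar> * d)"
        unfolding g_def norm_mult by (intro mult_mono) (auto intro: order.trans[OF norm_ge_zero])
      then show "norm (g w) \<le> B * exp (2 * pi * \<bar>t\<bar> * d) / (1 + (norm w)\<^sup>2)" by (simp add: ac_simps)
    qed
    have "(LINT x|lborel. g (Complex x a)) = (LINT x|lborel. g (Complex x 1))"
      using sh[of a 1] sh[of 1 a] a by (cases "a \<le> 1") auto
    then show ?thesis using gF[OF a] gF[of 1] by (simp add: \<psi>_def)
  qed
  have norm_psi: "norm (\<psi> t) \<le> B * pi * exp (2 * pi * t * a)" if a: "a > 0" for a t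
    unfolding shift[OF a] norm_mult using F_bound[OF a, of t] by (simp add: norm_exp_eq_Re)
  have neg: "\<psi> t = 0" if t: "t < 0" for t
  proof -
    have "norm (\<psi> t) \<le> 0"
    proof (rule tendsto_lowerbound)
      have "(\<lambda>n. exp (r * real n)) \<longlonglongrightarrow> 0" if "r < 0" for r :: real using that by real_asymp
      from this[of "2 * pi * t"] have "(\<lambda>n. exp (2 * pi * t * real n)) \<longlonglongrightarrow> 0"
        using t by (simp add: mult_pos_neg)
      then show "(\<lambda>n. B * pi * exp (2 * pi * t * real n)) \<longlonglongrightarrow> 0" by (rule tendsto_mult_right_zero)
      show "\<forall>\<^sub>F n in sequentially. norm (\<psi> t) \<le> B * pi * exp (2 * pi * t * real n)"
        using eventually_gt_at_top[of 0] by eventually_elim (rule norm_psi, simp)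
    qed simp
    then show ?thesis by simp
  qed
  have pos: "\<psi> t = 0" if t: "t > \<sigma>" for t
  proof -
    define a where "a = (\<lambda>n. 1 / real (Suc n))"
    have a0: "a n > 0" for n by (simp add: a_def)
    \<comment> \<open>Subtracting \<open>cnj (F (a n) (\<sigma> - t)) = 0\<close> from \<open>F (a n) t\<close> leaves an integrand that tends to zero.\<close>
    define d where "d = (\<lambda>n x. (f (Complex x (a n)) - exp (2 * pi * \<i> * \<sigma> * x) * cnj (f (Complex x (a n)))) * e x t)"
    have Fd: "F (a n) t = (LINT x|lborel. d n x)" for n
    proof -
      have z: "F (a n) (\<sigma> - t) = 0"
        using shift[OF a0, of "\<sigma> - t" n] neg[of "\<sigma> - t"] t by simp
      have "0 = cnj (F (a n) (\<sigma> - t))" by (simp add: z)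
      also have "\<dots> = (LINT x|lborel. cnj (f (Complex x (a n)) * e x (\<sigma> - t)))"
        unfolding F_def by (rule Bochner_Integration.integral_cnj [symmetric])
      also have "\<dots> = (LINT x|lborel. exp (2 * pi * \<i> * \<sigma> * x) * cnj (f (Complex x (a n))) * e x t)"
      proof (rule Bochner_Integration.integral_cong[OF refl])
        fix x :: real
        have "cnj (e x (\<sigma> - t)) = exp (2 * pi * \<i> * \<sigma> * x) * e x t"
          unfolding e_def exp_cnj exp_add[symmetric]
          by (rule arg_cong[where f = exp]) (simp add: algebra_simps)
        then show "cnj (f (Complex x (a n)) * e x (\<sigma> - t)) = exp (2 * pi * \<i> * \<sigma> * x) * cnj (f (Complex x (a n))) * e x t"
          by simp
      qed
      finally have zero: "(LINT x|lborel. exp (2 * pi * \<i> * \<sigma> * x) * cnj (f (Complex x (a n))) * e x t) = 0" by simp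
      have "integrable lborel (\<lambda>x. exp (2 * pi * \<i> * \<sigma> * x) * cnj (f (Complex x (a n))) * e x t)"
      proof (rule integrable_of_inverse_square_bound(1))
        show "(\<lambda>x. exp (2 * pi * \<i> * \<sigma> * x) * cnj (f (Complex x (a n))) * e x t) \<in> borel_measurable borel"
          using f_meas[OF a0] e_meas1[of t] by measurable
        show "norm (exp (2 * pi * \<i> * \<sigma> * x) * cnj (f (Complex x (a n))) * e x t) \<le> B / (1 + x\<^sup>2)" for x
          using fB[OF a0] by (simp add: norm_mult norm_exp_eq_Re)
      qed
      then have "(LINT x|lborel. d n x) = F (a n) t - 0"
        unfolding d_def left_diff_distrib F_def zero[symmetric] 
        by (intro Bochner_Integration.integral_diff F_int[OF a0])
      then show ?thesis by simp
    qed
    have "(\<lambda>n. LINT x|lborel. d n x) \<longlonglongrightarrow> (LINT (x::real)|lborel. (0::complex))"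
    proof (rule integral_dominated_convergence[where w = "\<lambda>x. 2 * B * (1 / (1 + x\<^sup>2))"])
      show "integrable lborel (\<lambda>x. 2 * B * (1 / (1 + x\<^sup>2)))"
        by (intro integrable_mult_right integrable_lorentz_std)
      show "d n \<in> borel_measurable lborel" for n
        unfolding d_def using f_meas[OF a0] by measurable
      show "AE x in lborel. (\<lambda>n. d n x) \<longlonglongrightarrow> 0"
        using sym
      proof eventually_elim
        case (elim x)
        from tendsto_mult[OF this tendsto_const[of "e x t"]] show ?case
          by (simp add: d_def a_def)
      qed
      show "AE x in lborel. norm (d n x) \<le> 2 * B * (1 / (1 + x\<^sup>2))" for n
      proof (rule AE_I2)
        fix x
        have "norm (d n x) \<le> norm (f (Complex x (a n))) + norm (exp (2 * pi * \<i> * \<sigma> * x) * cnj (f (Complex x (a n))))"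
          unfolding d_def norm_mult[of _ "e x t"] norm_e mult_1_right by (rule norm_triangle_ineq4)
        also have "\<dots> = 2 * norm (f (Complex x (a n)))" by (simp add: norm_mult norm_exp_eq_Re)
        also have "\<dots> \<le> 2 * (B / (1 + x\<^sup>2))" using fB[OF a0] by (intro mult_left_mono) auto
        finally show "norm (d n x) \<le> 2 * B * (1 / (1 + x\<^sup>2))" by simp
      qed
    qed auto
    then have F0: "(\<lambda>n. F (a n) t) \<longlonglongrightarrow> 0" by (simp add: Fd)
    have al: "a \<longlonglongrightarrow> 0"
      unfolding a_def by (rule LIMSEQ_Suc[OF lim_1_over_n])
    have "(\<lambda>n. F (a n) t * exp (of_real (2 * pi * t * a n))) \<longlonglongrightarrow> 0 * exp (of_real (2 * pi * t * 0))"
      by (intro tendsto_mult F0 tendsto_exp tendsto_of_real tendsto_const al)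
    then have "(\<lambda>n. \<psi> t) \<longlonglongrightarrow> 0" using shift[OF a0, of t] by simp
    then show ?thesis by (simp add: LIMSEQ_const_iff)
  qed
  have psi_meas [measurable]: "\<psi> \<in> borel_measurable borel"
  proof -
    have [measurable]: "(\<lambda>x. f (Complex x 1)) \<in> borel_measurable borel" using f_meas[of 1] by simp
    have "(\<lambda>t. LINT x|lborel. f (Complex x 1) * e x t) \<in> borel_measurable borel"
      unfolding e_def by measurable
    then show ?thesis unfolding \<psi>_def F_def by measurable
  qed
  have bound: "norm (\<psi> t) \<le> B * pi * exp (2 * pi * \<sigma>)" for t
  proof (cases "t \<in> {0..\<sigma>}")
    case True
    have "norm (\<psi> t) \<le> B * pi * exp (2 * pi * t * 1)" by (rule norm_psi) simp
    also have "\<dots> \<le> B * pi * exp (2 * pi * \<sigma>)" using True B0 by (intro mult_left_mono) auto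
    finally show ?thesis .
  next
    case False
    then have "\<psi> t = 0" using neg pos by auto
    then show ?thesis using B0 by simp
  qed
  have repr: "f z = (LINT t|lborel. \<psi> t * exp (2 * pi * \<i> * z * t))" if z: "Im z > 0" for z
  proof -
    define a where "a = Im z / 2"
    have a: "0 < a" "a < Im z" using z by (auto simp: a_def)
    define c where "c = 2 * pi * \<i> * (z - \<i> * a)"
    \<comment> \<open>Integrating \<open>G\<close> first over \<open>t\<close> yields the Cauchy kernel, first over \<open>x\<close> it yields \<open>\<psi>\<close>.\<close>
    define G where "G = (\<lambda>p::real \<times> real. f (Complex (fst p) a) * e (fst p) (snd p) * (indicator {0<..} (snd p) *\<^sub>R exp (c * of_real (snd p))))"
    have cre: "Re c < 0" using a by (simp add: c_def)
    note ie = integral_exp_half_line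
    have [measurable]: "(\<lambda>x. f (Complex x a)) \<in> borel_measurable borel" by (rule f_meas[OF a(1)])
    have G_int: "integrable (lborel \<Otimes>\<^sub>M lborel) G"
    proof (rule integrable_product_bound)
      show "G \<in> borel_measurable (lborel \<Otimes>\<^sub>M lborel)" unfolding G_def e_def by measurable
      show "integrable lborel (\<lambda>x. B * (1 / (1 + x\<^sup>2)))"
        by (intro integrable_mult_right integrable_lorentz_std)
      show "integrable lborel (\<lambda>t. norm (indicator {0<..} t *\<^sub>R exp (c * of_real t)))"
        by (intro integrable_norm ie(1) cre)
      show "norm (G (x, t)) \<le> B * (1 / (1 + x\<^sup>2)) * norm (indicator {0<..} t *\<^sub>R exp (c * of_real t))" for x t
        unfolding G_def norm_mult fst_conv snd_conv norm_e using fB[OF a(1)] by (intro mult_right_mono) auto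
    qed (use B0 in auto)
    have in1: "(LINT t|lborel. G (x, t)) = f (Complex x a) / (Complex x a - z) / (2 * pi * \<i>)" for x
    proof -
      have Geq: "G (x, t) = f (Complex x a) * (indicator {0<..} t *\<^sub>R exp ((c - 2 * pi * \<i> * x) * of_real t))" for t
        by (simp add: G_def e_def indicator_def exp_add[symmetric] algebra_simps exp_diff exp_minus field_simps)
      have re: "Re (c - 2 * pi * \<i> * x) < 0" using cre by simp
      have ceq: "c - 2 * pi * \<i> * x = - (2 * pi * \<i>) * (Complex x a - z)"
        by (simp add: c_def Complex_eq algebra_simps)
      have "(LINT t|lborel. G (x, t)) = f (Complex x a) * (- 1 / (c - 2 * pi * \<i> * x))"
        by (simp only: Geq integral_mult_right_zero ie(2)[OF re])
      then show ?thesis unfolding ceq by (simp add: power2_eq_square)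
    qed
    have in2: "(LINT x|lborel. G (x, t)) = \<psi> t * exp (2 * pi * \<i> * z * t)" if "t \<noteq> 0" for t
    proof (cases "t > 0")
      case True
      have "(LINT x|lborel. G (x, t)) = F a t * exp (c * of_real t)"
        using True by (simp add: G_def F_def)
      also have "\<dots> = F a t * exp (of_real (2 * pi * t * a)) * exp (2 * pi * \<i> * z * t)"
        unfolding mult.assoc exp_add[symmetric]
        by (rule arg_cong[where f = "\<lambda>u. F a t * exp u"]) (simp add: c_def algebra_simps)
      finally show ?thesis using shift[OF a(1), of t] by simp
    next
      case False
      then show ?thesis using neg[of t] that by (simp add: G_def)
    qed
    have "(LINT x|lborel. LINT t|lborel. G (x, t)) = 2 * pi * \<i> * f z / (2 * pi * \<i>)"
      by (simp only: in1 integral_divide_zero cauchy_formula_half_plane[OF holf a B])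
    also have "\<dots> = f z" by simp
    finally have "f z = (LINT x|lborel. LINT t|lborel. G (x, t))" by simp
    also have "\<dots> = (LINT t|lborel. LINT x|lborel. G (x, t))"
      using lborel_pair.Fubini_integral[of "\<lambda>x t. G (x, t)"] G_int by simp
    also have "\<dots> = (LINT t|lborel. \<psi> t * exp (2 * pi * \<i> * z * t))"
    proof (rule integral_cong_AE)
      show "AE t in lborel. (LINT x|lborel. G (x, t)) = \<psi> t * exp (2 * pi * \<i> * z * t)"
        using AE_lborel_singleton[of 0] by eventually_elim (rule in2)
      show "(\<lambda>t. LINT x|lborel. G (x, t)) \<in> borel_measurable lborel"
        unfolding G_def e_def by measurable
    qed measurable
    finally show ?thesis .
  qed
  show ?thesis
    by (rule that[OF psi_meas bound _ repr]) (use neg pos in auto)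
qed

section \<open>Size of the conjugate Poisson integral of a bounded function\<close>

lemma has_bochner_integral_odd_lorentz:
  fixes R :: real
  assumes "R \<ge> 0"
  shows "has_bochner_integral lborel (\<lambda>u. indicator {-R..R} u * (2 * \<bar>u\<bar> / (1 + u\<^sup>2))) (2 * ln (1 + R\<^sup>2))"
proof -
  have p: "1 + u\<^sup>2 > 0" for u :: real by (simp add: add_pos_nonneg)
  have 1: "has_bochner_integral lborel (\<lambda>u. (2 * u / (1 + u\<^sup>2)) * indicator {0..R} u) (ln (1 + R\<^sup>2) - ln (1 + 0\<^sup>2))"
    by (rule has_bochner_integral_FTC_Icc_real)
       (use assms p in \<open>auto intro!: derivative_eq_intros continuous_intros simp: less_imp_neq[THEN not_sym]\<close>)
  then have 2: "has_bochner_integral lborel (\<lambda>u. (2 * (- u) / (1 + (- u)\<^sup>2)) * indicator {0..R} (- u)) (ln (1 + R\<^sup>2) - ln (1 + 0\<^sup>2))"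
    using lborel_has_bochner_integral_real_affine_iff[of "-1" "\<lambda>u. (2 * u / (1 + u\<^sup>2)) * indicator {0..R} u" _ 0] by simp
  have eq: "(\<lambda>u. (2 * u / (1 + u\<^sup>2)) * indicator {0..R} u + (2 * (- u) / (1 + (- u)\<^sup>2)) * indicator {0..R} (- u))
      = (\<lambda>u. indicator {-R..R} u * (2 * \<bar>u\<bar> / (1 + u\<^sup>2)))"
    by (auto simp: fun_eq_iff indicator_def)
  show ?thesis using has_bochner_integral_add[OF 1 2] unfolding eq by simp
qed

lemma poisson_summable_bounded:
  assumes "s \<in> borel_measurable borel" "\<And>t. \<bar>s t\<bar> \<le> c"
  shows "poisson_summable s"
  unfolding poisson_summable_def
proof
  have i: "integrable lborel (\<lambda>t::real. c * (1 / (1 + t\<^sup>2)))"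
    using has_bochner_integral_lorentz_std by (intro integrable_mult_right) (simp add: has_bochner_integral_iff)
  have c0: "c \<ge> 0" using assms(2)[of 0] by linarith
  show "integrable lborel (\<lambda>t. s t / (1 + t\<^sup>2))"
  proof (rule Bochner_Integration.integrable_bound[OF i])
    show "(\<lambda>t. s t / (1 + t\<^sup>2)) \<in> borel_measurable lborel" using assms(1) by measurable
    show "AE t in lborel. norm (s t / (1 + t\<^sup>2)) \<le> norm (c * (1 / (1 + t\<^sup>2)))"
      using assms(2) c0 by (auto intro!: AE_I2 divide_right_mono simp: abs_mult)
  qed
qed fact

text \<open>
  An integrable majorant of the kernel \<open>Re (cauchy_kernel z)\<close> outside the window \<open>\<bar>t - Re z\<bar> \<le> 1\<close>, and of its
  regularising term inside. Up to \<open>\<bar>t\<bar> = T\<close>, which is comparable to \<open>1 + \<bar>z\<bar>\<close>, the two terms of the kernel are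
  estimated separately and cost logarithms of \<open>T\<close>; beyond \<open>T\<close> they cancel and leave a tail whose integral is
  bounded independently of \<open>z\<close>.
\<close>
definition far_weight :: "complex \<Rightarrow> real \<Rightarrow> real" where
  "far_weight z t = (let T = 2 * norm z + 2 in
     indicator {-T..T} t * (\<bar>t\<bar> / (1 + t\<^sup>2)) + indicator {-(2 * T)..2 * T} (t - Re z) * (2 * \<bar>t - Re z\<bar> / (1 + (t - Re z)\<^sup>2))
     + 2 * (T / (t\<^sup>2 + T\<^sup>2)) + indicator {Re z - 1..Re z + 1} t)"

lemma has_bochner_integral_far_weight:
  "\<exists>I. has_bochner_integral lborel (far_weight z) I \<and> I \<le> 6 * ln (4 * norm z + 5) + 2 * pi + 2"
proof -
  define T where "T = 2 * norm z + 2"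
  have T: "T \<ge> 2" by (simp add: T_def)
  note o = has_bochner_integral_odd_lorentz
  have 1: "has_bochner_integral lborel (\<lambda>t. indicator {-T..T} t * (\<bar>t\<bar> / (1 + t\<^sup>2))) (ln (1 + T\<^sup>2))"
  proof -
    have "has_bochner_integral lborel (\<lambda>u. (1/2) * (indicator {-T..T} u * (2 * \<bar>u\<bar> / (1 + u\<^sup>2)))) ((1/2) * (2 * ln (1 + T\<^sup>2)))"
      by (rule has_bochner_integral_mult_right, rule o) (use T in simp)
    then show ?thesis by simp
  qed
  have "has_bochner_integral lborel (\<lambda>t. indicator {-(2*T)..2*T} (- Re z + 1 * t) * (2 * \<bar>- Re z + 1 * t\<bar> / (1 + (- Re z + 1 * t)\<^sup>2))) (2 * ln (1 + (2*T)\<^sup>2) /\<^sub>R \<bar>1\<bar>)"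
    by (subst lborel_has_bochner_integral_real_affine_iff[symmetric]) (use o[of "2*T"] T in auto)
  then have 2: "has_bochner_integral lborel (\<lambda>t. indicator {-(2*T)..2*T} (t - Re z) * (2 * \<bar>t - Re z\<bar> / (1 + (t - Re z)\<^sup>2))) (2 * ln (1 + (2*T)\<^sup>2))"
    by simp
  have 3: "has_bochner_integral lborel (\<lambda>t. 2 * (T / (t\<^sup>2 + T\<^sup>2))) (2 * pi)"
  proof -
    have "has_bochner_integral lborel (\<lambda>t. 2 * (T / ((t - 0)\<^sup>2 + T\<^sup>2))) (2 * pi)"
      by (rule has_bochner_integral_mult_right, rule has_bochner_integral_lorentz) (use T in simp)
    then show ?thesis by simp
  qed
  have 4: "has_bochner_integral lborel (indicator {Re z - 1..Re z + 1}) (2::real)"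
    using has_bochner_integral_real_indicator[of "{Re z - 1..Re z + 1}" lborel] by simp
  have I: "has_bochner_integral lborel (far_weight z) (ln (1 + T\<^sup>2) + 2 * ln (1 + (2*T)\<^sup>2) + 2 * pi + 2)"
    unfolding far_weight_def[abs_def] Let_def T_def[symmetric]
    by (intro has_bochner_integral_add 1 2 3 4)
  have "ln (1 + r\<^sup>2) \<le> 2 * ln (1 + r)" if "r \<ge> 0" for r :: real
  proof -
    have "ln (1 + r\<^sup>2) \<le> ln ((1 + r)\<^sup>2)"
      using that by (subst ln_le_cancel_iff) (auto simp: add_pos_nonneg power2_sum)
    then show ?thesis using that by (simp add: ln_realpow)
  qed
  from this[of T] this[of "2 * T"] have "ln (1 + T\<^sup>2) + 2 * ln (1 + (2*T)\<^sup>2) \<le> 2 * ln (1 + T) + 4 * ln (1 + 2 * T)"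
    using T by simp
  also have "\<dots> \<le> 6 * ln (1 + 2 * T)" using T by simp
  also have "1 + 2 * T = 4 * norm z + 5" by (simp add: T_def)
  finally show ?thesis using I by (intro exI[of _ "ln (1 + T\<^sup>2) + 2 * ln (1 + (2*T)\<^sup>2) + 2 * pi + 2"]) auto
qed

lemma abs_odd_kernel_le: 
  fixes u \<eta> :: real
  shows "\<bar>u / (u\<^sup>2 + \<eta>\<^sup>2)\<bar> \<le> 1 / \<bar>u\<bar>"
proof (cases "u = 0")
  case False
  then have "u\<^sup>2 > 0" by simp
  then have "\<bar>u / (u\<^sup>2 + \<eta>\<^sup>2)\<bar> = \<bar>u\<bar> / (u\<^sup>2 + \<eta>\<^sup>2)" by (simp add: abs_divide add_pos_nonneg)
  also have "\<dots> \<le> \<bar>u\<bar> / u\<^sup>2" using \<open>u\<^sup>2 > 0\<close> by (intro divide_left_mono mult_pos_pos) (auto simp: add_pos_nonneg)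
  also have "\<dots> = \<bar>u\<bar> / (\<bar>u\<bar> * \<bar>u\<bar>)" by (simp add: power2_eq_square)
  also have "\<dots> = 1 / \<bar>u\<bar>" using False by (simp del: abs_mult_self_eq)
  finally show ?thesis .
qed simp

lemma far_kernel_le:
  assumes z: "Im z > 0"
  shows "\<bar>(if \<bar>t - Re z\<bar> \<le> 1 then 0 else (t - Re z) / ((t - Re z)\<^sup>2 + (Im z)\<^sup>2)) - t / (1 + t\<^sup>2)\<bar> \<le> far_weight z t"
proof -
  define T where "T = 2 * norm z + 2"
  have T: "T \<ge> 2" by (simp add: T_def)
  have q: "1 + v\<^sup>2 > 0" for v :: real by (simp add: add_pos_nonneg)
  define A where "A = indicator {-T..T} t * (\<bar>t\<bar> / (1 + t\<^sup>2))"
  define B where "B = indicator {-(2 * T)..2 * T} (t - Re z) * (2 * \<bar>t - Re z\<bar> / (1 + (t - Re z)\<^sup>2))"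
  define D where "D = 2 * (T / (t\<^sup>2 + T\<^sup>2))"
  define E where "E = (indicator {Re z - 1..Re z + 1} t :: real)"
  have fw: "far_weight z t = A + B + D + E"
    by (simp add: far_weight_def Let_def A_def B_def D_def E_def T_def)
  have nn: "A \<ge> 0" "B \<ge> 0" "D \<ge> 0" "E \<ge> 0"
    using T by (auto simp: A_def B_def D_def E_def indicator_def add_nonneg_nonneg)
  consider "\<bar>t - Re z\<bar> \<le> 1" | "\<bar>t - Re z\<bar> > 1" "\<bar>t\<bar> \<le> T" | "\<bar>t - Re z\<bar> > 1" "\<bar>t\<bar> > T" by linarith
  then show ?thesis
  proof cases
    case 1
    have "2 * \<bar>t\<bar> \<le> 1 + t\<^sup>2" using zero_le_power2[of "1 - \<bar>t\<bar>"] by (simp add: power2_diff)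
    then have "\<bar>t / (1 + t\<^sup>2)\<bar> \<le> 1" using q[of t] by (simp add: abs_divide divide_le_eq)
    moreover have "E = 1" using 1 by (auto simp: E_def indicator_def abs_le_iff)
    ultimately show ?thesis using 1 nn unfolding fw by simp
  next
    case 2
    define u where "u = t - Re z"
    have u: "\<bar>u\<bar> > 1" using 2 by (simp add: u_def)
    have "\<bar>u\<bar> \<le> \<bar>t\<bar> + \<bar>Re z\<bar>" unfolding u_def by (rule abs_triangle_ineq4)
    also have "\<dots> \<le> T + norm z" by (intro add_mono 2 abs_Re_le_cmod)
    also have "\<dots> \<le> 2 * T" by (simp add: T_def)
    finally have "\<bar>u\<bar> \<le> 2 * T" .
    then have B: "B = 2 * \<bar>u\<bar> / (1 + u\<^sup>2)" by (simp add: B_def u_def[symmetric] indicator_def abs_le_iff)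
    have A: "A = \<bar>t / (1 + t\<^sup>2)\<bar>" using 2 q[of t] by (simp add: A_def indicator_def abs_le_iff abs_divide)
    have u2: "u\<^sup>2 \<ge> 1" using u power_mono[of 1 "\<bar>u\<bar>" 2] by simp
    have "\<bar>u / (u\<^sup>2 + (Im z)\<^sup>2)\<bar> \<le> 1 / \<bar>u\<bar>" by (rule abs_odd_kernel_le)
    also have "\<dots> = 2 * \<bar>u\<bar> / (2 * (\<bar>u\<bar> * \<bar>u\<bar>))" using u by (simp del: abs_mult_self_eq)
    also have "\<dots> = 2 * \<bar>u\<bar> / (2 * u\<^sup>2)" by (simp add: power2_eq_square)
    also have "\<dots> \<le> B" unfolding B using u2 q[of u] by (intro divide_left_mono mult_pos_pos) auto
    finally have "\<bar>u / (u\<^sup>2 + (Im z)\<^sup>2) - t / (1 + t\<^sup>2)\<bar> \<le> A + B"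
      unfolding A by (intro order.trans[OF abs_triangle_ineq4]) simp
    then show ?thesis using 2 nn unfolding fw u_def by simp
  next
    case 3
    have tz: "of_real t \<noteq> z" by (rule of_real_neq_of_Im_pos[OF z])
    have n1: "norm (1 + of_real t * z) \<le> \<bar>t\<bar> * (T / 2)"
    proof -
      have "norm (1 + of_real t * z) \<le> 1 + \<bar>t\<bar> * norm z" by (rule norm_triangle_le) (simp add: norm_mult)
      also have "\<dots> \<le> \<bar>t\<bar> * (T / 2)"
      proof -
        have "1 \<le> \<bar>t\<bar>" using 3 T by linarith
        then show ?thesis by (simp add: T_def algebra_simps)
      qed
      finally show ?thesis .
    qed
    have n2: "norm (of_real t - z) \<ge> \<bar>t\<bar> / 2"
    proof -
      have "\<bar>t\<bar> - norm z \<le> norm (of_real t - z)" using norm_triangle_ineq2[of "of_real t" z] by simp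
      then show ?thesis using 3 by (simp add: T_def)
    qed
    have qq: "norm (1 + (complex_of_real t)\<^sup>2) = 1 + t\<^sup>2"
    proof -
      have "norm (complex_of_real (1 + t\<^sup>2)) = \<bar>1 + t\<^sup>2\<bar>" by (rule norm_of_real)
      then show ?thesis by simp
    qed
    have "\<bar>Re (cauchy_kernel z t)\<bar> \<le> norm (cauchy_kernel z t)" by (rule abs_Re_le_cmod)
    also have "\<dots> = norm (1 + of_real t * z) / norm (of_real t - z) / (1 + t\<^sup>2)"
      using tz by (simp add: cauchy_kernel_altdef norm_divide norm_mult qq)
    also have "\<dots> \<le> (\<bar>t\<bar> * (T / 2)) / (\<bar>t\<bar> / 2) / (1 + t\<^sup>2)"
      using n1 n2 3 T by (intro divide_right_mono frac_le) auto
    also have "\<dots> = T / (1 + t\<^sup>2)" using 3 T by simp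
    also have "\<dots> \<le> D"
    proof -
      have "T\<^sup>2 \<le> \<bar>t\<bar>\<^sup>2" using 3 T by (intro power_mono) auto
      then have "t\<^sup>2 + T\<^sup>2 \<le> 2 * (1 + t\<^sup>2)" by simp
      then have "T * (t\<^sup>2 + T\<^sup>2) \<le> T * (2 * (1 + t\<^sup>2))" using T by (intro mult_left_mono) auto
      moreover have "t\<^sup>2 + T\<^sup>2 > 0" using T by (simp add: add_nonneg_pos)
      ultimately show ?thesis using q[of t] unfolding D_def by (simp add: field_simps)
    qed
    finally have "\<bar>Re (cauchy_kernel z t)\<bar> \<le> D" .
    then show ?thesis using 3 nn unfolding fw Re_cauchy_kernel[OF z] by simp
  qed
qed

text \<open>
  The singular kernel is odd about \<open>Re z\<close>, so on the window it only sees the antisymmetric part of \<open>s\<close>. This is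
  what makes one-sided estimates possible for a function that jumps in one direction only.
\<close>
lemma Re_cauchy_transform_near_far:
  assumes s: "s \<in> borel_measurable borel" "\<And>t. \<bar>s t\<bar> \<le> pi / 2" and z: "Im z > 0"
  defines "x \<equiv> Re z" and "\<eta> \<equiv> Im z"
  defines "N \<equiv> (LINT u|lborel. indicator {-1..1} u * ((s (x + u) - s (x - u)) * (u / (u\<^sup>2 + \<eta>\<^sup>2))))"
  shows "integrable lborel (\<lambda>u. indicator {-1..1} u * ((s (x + u) - s (x - u)) * (u / (u\<^sup>2 + \<eta>\<^sup>2))))"
    and "\<bar>Re (cauchy_transform s z) - N / 2\<bar> \<le> pi / 2 * (6 * ln (4 * norm z + 5) + 2 * pi + 2)"
proof -
  have [measurable]: "s \<in> borel_measurable borel" by fact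
  have eta: "\<eta> > 0" using z by (simp add: \<eta>_def)
  have lc: "poisson_summable s" by (rule poisson_summable_bounded[OF s])
  define n where "n = (\<lambda>u. indicator {-1..1} u * (s (x + u) * (u / (u\<^sup>2 + \<eta>\<^sup>2))))"
  have n_int: "integrable lborel n"
  proof (rule Bochner_Integration.integrable_bound[where f = "\<lambda>u. indicator {-1..1} u *\<^sub>R (pi / 2 * (1 / \<eta>\<^sup>2))"])
    show "integrable lborel (\<lambda>u. indicator {-1..1::real} u *\<^sub>R (pi / 2 * (1 / \<eta>\<^sup>2)))"
      by (intro integrable_scaleR_left integrable_real_indicator) auto
    show "n \<in> borel_measurable lborel" unfolding n_def by measurable
    show "AE u in lborel. norm (n u) \<le> norm (indicator {-1..1} u *\<^sub>R (pi / 2 * (1 / \<eta>\<^sup>2)))"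
    proof (rule AE_I2)
      fix u :: real
      show "norm (n u) \<le> norm (indicator {-1..1} u *\<^sub>R (pi / 2 * (1 / \<eta>\<^sup>2)))"
      proof (cases "u \<in> {-1..1}")
        case True
        have "\<bar>u\<bar> / (u\<^sup>2 + \<eta>\<^sup>2) \<le> 1 / \<eta>\<^sup>2" using True eta by (intro frac_le) auto
        then have "\<bar>s (x + u)\<bar> * (\<bar>u\<bar> / (u\<^sup>2 + \<eta>\<^sup>2)) \<le> pi / 2 * (1 / \<eta>\<^sup>2)"
          using s(2)[of "x + u"] by (intro mult_mono) auto
        then show ?thesis using True by (simp add: n_def abs_mult abs_divide)
      qed (simp add: n_def)
    qed
  qed
  have nm_int: "integrable lborel (\<lambda>u. n (- u))" and nm: "(LINT u|lborel. n (- u)) = (LINT u|lborel. n u)"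
    using lborel_integrable_real_affine[OF n_int, of "-1" 0] lborel_integral_real_affine[of "-1" n 0] by simp_all
  have comb: "indicator {-1..1} u * ((s (x + u) - s (x - u)) * (u / (u\<^sup>2 + \<eta>\<^sup>2))) = n u + n (- u)" for u
    by (auto simp: n_def indicator_def left_diff_distrib diff_divide_distrib)
  show "integrable lborel (\<lambda>u. indicator {-1..1} u * ((s (x + u) - s (x - u)) * (u / (u\<^sup>2 + \<eta>\<^sup>2))))"
    unfolding comb by (intro Bochner_Integration.integrable_add n_int nm_int)
  have N: "N / 2 = (LINT u|lborel. n u)"
    unfolding N_def comb using n_int nm_int nm by simp
  have ns_int: "integrable lborel (\<lambda>t. n (t - x))" and ns: "(LINT t|lborel. n (t - x)) = (LINT u|lborel. n u)"
    using lborel_integrable_real_affine[OF n_int, of 1 "-x"] lborel_integral_real_affine[of 1 n "-x"] by simp_all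
  have k: "has_bochner_integral lborel (\<lambda>t. s t * ((t - x) / ((t - x)\<^sup>2 + \<eta>\<^sup>2) - t / (1 + t\<^sup>2))) (Re (cauchy_transform s z))"
    unfolding x_def \<eta>_def by (rule has_bochner_integral_Re_cauchy_transform[OF lc z])
  define r where "r = (\<lambda>t. s t * ((if \<bar>t - x\<bar> \<le> 1 then 0 else (t - x) / ((t - x)\<^sup>2 + \<eta>\<^sup>2)) - t / (1 + t\<^sup>2)))"
  have r: "r = (\<lambda>t. s t * ((t - x) / ((t - x)\<^sup>2 + \<eta>\<^sup>2) - t / (1 + t\<^sup>2)) - n (t - x))"
    by (auto simp: fun_eq_iff r_def n_def indicator_def abs_le_iff algebra_simps)
  have r_int: "has_bochner_integral lborel r (Re (cauchy_transform s z) - N / 2)"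
    unfolding r N ns[symmetric] by (intro has_bochner_integral_diff k has_bochner_integral_integrable ns_int)
  obtain I where I: "has_bochner_integral lborel (far_weight z) I" "I \<le> 6 * ln (4 * norm z + 5) + 2 * pi + 2"
    using has_bochner_integral_far_weight by blast
  have "norm (LINT t|lborel. r t) \<le> (LINT t|lborel. pi / 2 * far_weight z t)"
  proof (rule Bochner_Integration.integral_norm_bound_integral)
    show "integrable lborel r" using r_int by (simp add: has_bochner_integral_iff)
    show "integrable lborel (\<lambda>t. pi / 2 * far_weight z t)"
      using I by (intro integrable_mult_right) (simp add: has_bochner_integral_iff)
    show "norm (r t) \<le> pi / 2 * far_weight z t" for t
      unfolding r_def real_norm_def abs_mult x_def \<eta>_def using s(2)[of t] far_kernel_le[OF z, of t] by (intro mult_mono) auto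
  qed
  also have "\<dots> = pi / 2 * I" unfolding integral_mult_right_zero using I by (simp add: has_bochner_integral_iff)
  also have "\<dots> \<le> pi / 2 * (6 * ln (4 * norm z + 5) + 2 * pi + 2)" using I by (intro mult_left_mono) auto
  finally show "\<bar>Re (cauchy_transform s z) - N / 2\<bar> \<le> pi / 2 * (6 * ln (4 * norm z + 5) + 2 * pi + 2)"
    using r_int by (simp add: has_bochner_integral_iff)
qed

lemma LINT_indicator_bounds:
  fixes g :: "real \<Rightarrow> real"
  assumes i: "integrable lborel (\<lambda>u. indicator {-1..1} u * g u)"
  shows "(\<And>u. \<bar>u\<bar> \<le> 1 \<Longrightarrow> g u \<le> c) \<Longrightarrow> (LINT u|lborel. indicator {-1..1} u * g u) \<le> 2 * c"
    and "(\<And>u. \<bar>u\<bar> \<le> 1 \<Longrightarrow> c \<le> g u) \<Longrightarrow> 2 * c \<le> (LINT u|lborel. indicator {-1..1} u * g u)"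
proof -
  have ic: "integrable lborel (\<lambda>u. indicator {-1..1::real} u * c)"
    by (intro integrable_mult_left integrable_real_indicator) auto
  have c: "(LINT u|lborel. indicator {-1..1::real} u * c) = 2 * c" by simp
  show "(LINT u|lborel. indicator {-1..1} u * g u) \<le> 2 * c" if "\<And>u. \<bar>u\<bar> \<le> 1 \<Longrightarrow> g u \<le> c"
    unfolding c[symmetric] by (rule integral_mono[OF i ic]) (use that in \<open>auto simp: indicator_def abs_le_iff\<close>)
  show "2 * c \<le> (LINT u|lborel. indicator {-1..1} u * g u)" if "\<And>u. \<bar>u\<bar> \<le> 1 \<Longrightarrow> c \<le> g u"
    unfolding c[symmetric] by (rule integral_mono[OF ic i]) (use that in \<open>auto simp: indicator_def abs_le_iff\<close>)
qed

text \<open>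
  After the substitution \<open>t = x + a u\<close> the Poisson kernel no longer depends on \<open>a\<close>, and dominated convergence
  applies at every point of continuity.
\<close>
lemma poisson_integral_tendsto:
  assumes s: "s \<in> borel_measurable borel" "\<And>t. \<bar>s t\<bar> \<le> c" and cont: "isCont s x"
    and a: "\<And>n. a n > 0" "a \<longlonglongrightarrow> 0"
  shows "(\<lambda>n. Im (cauchy_transform s (Complex x (a n)))) \<longlonglongrightarrow> pi * s x"
proof -
  have [measurable]: "s \<in> borel_measurable borel" by fact
  have eq: "Im (cauchy_transform s (Complex x (a n))) = (LINT u|lborel. s (x + a n * u) * (1 / (1 + u\<^sup>2)))" for n
  proof -
    have "Im (cauchy_transform s (Complex x (a n))) = (LINT t|lborel. s t * (a n / ((t - x)\<^sup>2 + (a n)\<^sup>2)))"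
      using has_bochner_integral_Im_cauchy_transform[OF poisson_summable_bounded[OF s], of "Complex x (a n)"] a(1)[of n]
      by (simp add: has_bochner_integral_iff)
    also have "\<dots> = \<bar>a n\<bar> *\<^sub>R (LINT u|lborel. s (x + a n * u) * (a n / ((x + a n * u - x)\<^sup>2 + (a n)\<^sup>2)))"
      by (rule lborel_integral_real_affine) (use a(1)[of n] in simp)
    also have "\<dots> = (LINT u|lborel. a n * (s (x + a n * u) * (a n / ((x + a n * u - x)\<^sup>2 + (a n)\<^sup>2))))"
      unfolding integral_mult_right_zero using a(1)[of n] by simp
    also have "\<dots> = (LINT u|lborel. s (x + a n * u) * (1 / (1 + u\<^sup>2)))"
    proof (rule Bochner_Integration.integral_cong[OF refl])
      fix u :: real
      have "(x + a n * u - x)\<^sup>2 + (a n)\<^sup>2 = (a n)\<^sup>2 * (1 + u\<^sup>2)" by (simp add: power_mult_distrib algebra_simps)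
      then show "a n * (s (x + a n * u) * (a n / ((x + a n * u - x)\<^sup>2 + (a n)\<^sup>2))) = s (x + a n * u) * (1 / (1 + u\<^sup>2))"
        using a(1)[of n] by (simp add: power2_eq_square)
    qed
    finally show ?thesis .
  qed
  have "(\<lambda>n. LINT u|lborel. s (x + a n * u) * (1 / (1 + u\<^sup>2))) \<longlonglongrightarrow> (LINT u|lborel. s x * (1 / (1 + u\<^sup>2)))"
  proof (rule integral_dominated_convergence[where w = "\<lambda>u. c * (1 / (1 + u\<^sup>2))"])
    show "integrable lborel (\<lambda>u::real. c * (1 / (1 + u\<^sup>2)))"
      using has_bochner_integral_lorentz_std by (intro integrable_mult_right) (simp add: has_bochner_integral_iff)
    show "AE u in lborel. (\<lambda>n. s (x + a n * u) * (1 / (1 + u\<^sup>2))) \<longlonglongrightarrow> s x * (1 / (1 + u\<^sup>2))"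
    proof (rule AE_I2)
      fix u :: real
      have "(\<lambda>n. x + a n * u) \<longlonglongrightarrow> x + 0 * u" by (intro tendsto_intros a)
      then have "(\<lambda>n. s (x + a n * u)) \<longlonglongrightarrow> s x" using cont by (intro isCont_tendsto_compose[of x s]) auto
      then show "(\<lambda>n. s (x + a n * u) * (1 / (1 + u\<^sup>2))) \<longlonglongrightarrow> s x * (1 / (1 + u\<^sup>2))"
        by (intro tendsto_mult tendsto_const)
    qed
    show "AE u in lborel. norm (s (x + a n * u) * (1 / (1 + u\<^sup>2))) \<le> c * (1 / (1 + u\<^sup>2))" for n
      using s(2) by (auto intro!: AE_I2 divide_right_mono simp: abs_mult)
  qed measurable
  moreover have "(LINT u|lborel. s x * (1 / (1 + u\<^sup>2))) = pi * s x"
    unfolding integral_mult_right_zero using has_bochner_integral_lorentz_std by (simp add: has_bochner_integral_iff)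
  ultimately show ?thesis unfolding eq by simp
qed

section \<open>Correcting the argument\<close>

text \<open>
  The function \<open>exp G\<close> corrects the argument of an outer function to a prescribed phase modulo \<open>\<pi>\<close>: the integer
  part \<open>N\<close> of the phase is removed, and \<open>G\<close> is built from the remaining sawtooth \<open>s\<close>. The numerical constants come
  from \<open>Re_cauchy_transform_near_far\<close>, divided by \<open>\<pi>\<close>; the window adds at most \<open>2/5\<close> to \<open>Re G\<close> and, in the
  absence of jumps at distance less than \<open>1/2\<close>, subtracts at most \<open>2\<close>.
\<close>
lemma sawtooth_outer:
  fixes \<phi> :: "real \<Rightarrow> real"
  assumes mono: "mono \<phi>" and lip: "\<And>x y. \<bar>\<phi> x - \<phi> y\<bar> \<le> pi / 5 * \<bar>x - y\<bar>"
  obtains G where "G holomorphic_on {z. Im z > 0}"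
    "\<And>z. Im z > 0 \<Longrightarrow> exp (Re (G z)) \<le> exp (pi + 2) * (4 * norm z + 5) ^ 3"
    "(\<forall>z. Im z > 0 \<longrightarrow> Re z \<in> {-1<..<-1/2} \<longrightarrow> exp (Re (G z)) \<ge> exp (- (pi + 3)) / (4 * norm z + 5) ^ 3) \<or>
     (\<forall>z. Im z > 0 \<longrightarrow> Re z \<in> {1/2<..<1} \<longrightarrow> exp (Re (G z)) \<ge> exp (- (pi + 3)) / (4 * norm z + 5) ^ 3)"
    "AE x in lborel. \<exists>k::int. (\<lambda>n. Im (G (Complex x (1 / real (Suc n))))) \<longlonglongrightarrow> \<phi> x - pi * k"
proof -
  define N where "N = (\<lambda>x. \<lfloor>\<phi> x / pi + 1 / 2\<rfloor>)"
  define s where "s = (\<lambda>x. \<phi> x - pi * N x)"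
  have contphi: "continuous_on UNIV \<phi>"
  proof (rule continuous_onI)
    fix x e :: real assume e: "e > 0"
    show "\<exists>d>0. \<forall>x'\<in>UNIV. dist x' x < d \<longrightarrow> dist (\<phi> x') (\<phi> x) \<le> e"
    proof (intro exI[of _ "5 * e / pi"] conjI ballI impI)
      fix x' assume "dist x' x < 5 * e / pi"
      then have "pi / 5 * \<bar>x' - x\<bar> \<le> pi / 5 * (5 * e / pi)" by (intro mult_left_mono) (auto simp: dist_real_def)
      then show "dist (\<phi> x') (\<phi> x) \<le> e" using lip[of x' x] by (simp add: dist_real_def)
    qed (use e in auto)
  qed
  have [measurable]: "\<phi> \<in> borel_measurable borel" by (rule borel_measurable_continuous_onI[OF contphi])
  have s_meas: "s \<in> borel_measurable borel" unfolding s_def N_def by measurable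
  have s_bd: "\<bar>s x\<bar> \<le> pi / 2" for x
  proof -
    have "of_int (N x) \<le> \<phi> x / pi + 1 / 2" "\<phi> x / pi + 1 / 2 < of_int (N x) + 1"
      unfolding N_def by linarith+
    then have "pi * of_int (N x) \<le> pi * (\<phi> x / pi + 1 / 2)" "pi * (\<phi> x / pi + 1 / 2) \<le> pi * (of_int (N x) + 1)"
      by (intro mult_left_mono; simp)+
    then have "pi * of_int (N x) \<le> \<phi> x + pi / 2" "\<phi> x + pi / 2 \<le> pi + pi * of_int (N x)"
      by (simp_all add: algebra_simps)
    then show ?thesis unfolding s_def by (intro abs_leI) linarith+
  qed
  have N_mono: "N x \<le> N y" if "x \<le> y" for x y
    unfolding N_def using monoD[OF mono that] by (intro floor_mono add_right_mono divide_right_mono) auto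
  have lc: "poisson_summable s" by (rule poisson_summable_bounded[OF s_meas s_bd])
  define G where "G = (\<lambda>z. cauchy_transform s z / pi)"
  have "G holomorphic_on {z. Im z > 0}"
    unfolding G_def by (intro holomorphic_intros holomorphic_cauchy_transform lc) simp
  moreover
  define I where "I = (\<lambda>z. LINT u|lborel. indicator {-1..1} u * ((s (Re z + u) - s (Re z - u)) * (u / (u\<^sup>2 + (Im z)\<^sup>2))))"
  have ReG: "\<bar>Re (G z) - I z / (2 * pi)\<bar> \<le> 3 * ln (4 * norm z + 5) + pi + 1" if z: "Im z > 0" for z
  proof -
    have "Re (G z) - I z / (2 * pi) = (Re (cauchy_transform s z) - I z / 2) / pi" by (simp add: G_def diff_divide_distrib)
    moreover have "\<bar>Re (cauchy_transform s z) - I z / 2\<bar> \<le> pi * (3 * ln (4 * norm z + 5) + pi + 1)"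
      using Re_cauchy_transform_near_far(2)[OF s_meas s_bd z] by (simp add: I_def algebra_simps)
    ultimately show ?thesis by (simp add: abs_divide divide_le_eq mult.commute)
  qed
  have intg: "integrable lborel (\<lambda>u. indicator {-1..1} u * ((s (Re z + u) - s (Re z - u)) * (u / (u\<^sup>2 + (Im z)\<^sup>2))))"
    if z: "Im z > 0" for z
    by (rule Re_cauchy_transform_near_far(1)[OF s_meas s_bd z])
  \<comment> \<open>The integrand is even in \<open>u\<close>, so it is enough to estimate it for \<open>v = \<bar>u\<bar>\<close>.\<close>
  have symm: "(s (x + u) - s (x - u)) * (u / (u\<^sup>2 + \<eta>\<^sup>2)) = (s (x + \<bar>u\<bar>) - s (x - \<bar>u\<bar>)) * (\<bar>u\<bar> / (u\<^sup>2 + \<eta>\<^sup>2))" for x u \<eta>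
    by (cases "u \<ge> 0") (auto simp: left_diff_distrib diff_divide_distrib)
  have kb: "0 \<le> \<bar>u\<bar> / (u\<^sup>2 + \<eta>\<^sup>2)" "\<bar>u\<bar> / (u\<^sup>2 + \<eta>\<^sup>2) \<le> 1 / \<bar>u\<bar>" for u \<eta> :: real
    using abs_odd_kernel_le[of u \<eta>] by (auto simp: abs_divide)
  have e3: "exp (3 * ln (4 * norm z + 5)) = (4 * norm z + 5) ^ 3" for z :: complex
  proof -
    have "4 * norm z + 5 > 0" by (simp add: add_nonneg_pos)
    then show ?thesis using exp_of_nat_mult[of 3 "ln (4 * norm z + 5)"] by simp
  qed
  have "exp (Re (G z)) \<le> exp (pi + 2) * (4 * norm z + 5) ^ 3" if z: "Im z > 0" for z
  proof -
    have "I z \<le> 2 * (2 * (pi / 5))"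
      unfolding I_def
    proof (rule LINT_indicator_bounds(1)[OF intg[OF z]])
      fix u :: real
      define v where "v = \<bar>u\<bar>"
      have v: "v \<ge> 0" by (simp add: v_def)
      \<comment> \<open>The jumps of \<open>s\<close> are downward, so they can only help here.\<close>
      have "s (Re z + v) - s (Re z - v) \<le> \<phi> (Re z + v) - \<phi> (Re z - v)"
        unfolding s_def using N_mono[of "Re z - v" "Re z + v"] v by (simp add: algebra_simps)
      also have "\<dots> \<le> pi / 5 * \<bar>Re z + v - (Re z - v)\<bar>" by (rule order.trans[OF abs_ge_self lip])
      also have "\<dots> = 2 * (pi / 5) * v" using v by simp
      finally have "(s (Re z + v) - s (Re z - v)) * (v / (u\<^sup>2 + (Im z)\<^sup>2)) \<le> (2 * (pi / 5) * v) * (v / (u\<^sup>2 + (Im z)\<^sup>2))"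
        using kb(1)[of u "Im z"] unfolding v_def by (rule mult_right_mono)
      also have "\<dots> \<le> 2 * (pi / 5) * (v * (1 / v))"
        using kb(2)[of u "Im z"] v unfolding mult.assoc v_def by (intro mult_left_mono) auto
      also have "\<dots> \<le> 2 * (pi / 5)" by (cases "v = 0") auto
      finally show "(s (Re z + u) - s (Re z - u)) * (u / (u\<^sup>2 + (Im z)\<^sup>2)) \<le> 2 * (pi / 5)"
        unfolding symm v_def .
    qed
    then have "I z / (2 * pi) \<le> (2 * (2 * (pi / 5))) / (2 * pi)" by (intro divide_right_mono) auto
    then have "Re (G z) \<le> (pi + 2) + 3 * ln (4 * norm z + 5)" using ReG[OF z] by simp
    then have "exp (Re (G z)) \<le> exp ((pi + 2) + 3 * ln (4 * norm z + 5))" by simp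
    then show ?thesis by (simp only: exp_add e3)
  qed
  moreover
  have low: "exp (Re (G z)) \<ge> exp (- (pi + 3)) / (4 * norm z + 5) ^ 3"
    if z: "Im z > 0" and const: "N (Re z - 1/2) = N (Re z + 1/2)" for z
  proof -
    have "2 * (- (2 * pi)) \<le> I z"
      unfolding I_def
    proof (rule LINT_indicator_bounds(2)[OF intg[OF z]])
      fix u :: real
      define v where "v = \<bar>u\<bar>"
      have v: "v \<ge> 0" by (simp add: v_def)
      have "- (2 * pi) \<le> (s (Re z + v) - s (Re z - v)) * (v / (u\<^sup>2 + (Im z)\<^sup>2))"
      proof (cases "v \<le> 1/2")
        case True
        have "N (Re z - 1/2) \<le> N (Re z - v)" "N (Re z - v) \<le> N (Re z + v)" "N (Re z + v) \<le> N (Re z + 1/2)"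
          using True v by (auto intro!: N_mono)
        then have "N (Re z - v) = N (Re z + v)" using const by linarith
        then have "0 \<le> s (Re z + v) - s (Re z - v)"
          unfolding s_def using monoD[OF mono, of "Re z - v" "Re z + v"] v by simp
        then have "0 \<le> (s (Re z + v) - s (Re z - v)) * (v / (u\<^sup>2 + (Im z)\<^sup>2))"
          using kb(1)[of u "Im z"] unfolding v_def by (rule mult_nonneg_nonneg)
        moreover have "- (2 * pi) \<le> 0" by simp
        ultimately show ?thesis by linarith
      next
        case False
        have "v / (u\<^sup>2 + (Im z)\<^sup>2) \<le> 1 / v" unfolding v_def by (rule kb(2))
        also have "\<dots> \<le> 2" using False by (simp add: field_simps)
        finally have k2: "v / (u\<^sup>2 + (Im z)\<^sup>2) \<le> 2" .
        have "\<bar>s (Re z + v) - s (Re z - v)\<bar> \<le> pi"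
          using s_bd[of "Re z + v"] s_bd[of "Re z - v"] by linarith
        then have "\<bar>(s (Re z + v) - s (Re z - v)) * (v / (u\<^sup>2 + (Im z)\<^sup>2))\<bar> \<le> pi * 2"
          unfolding abs_mult using k2 kb(1)[of u "Im z"] unfolding v_def by (intro mult_mono) auto
        then show ?thesis by linarith
      qed
      then show "- (2 * pi) \<le> (s (Re z + u) - s (Re z - u)) * (u / (u\<^sup>2 + (Im z)\<^sup>2))"
        unfolding symm v_def .
    qed
    then have "(2 * (- (2 * pi))) / (2 * pi) \<le> I z / (2 * pi)" by (intro divide_right_mono) auto
    then have "- (pi + 3) - 3 * ln (4 * norm z + 5) \<le> Re (G z)" using ReG[OF z] by simp
    then have "exp (- (pi + 3) - 3 * ln (4 * norm z + 5)) \<le> exp (Re (G z))" by simp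
    then show ?thesis by (simp only: exp_diff e3)
  qed
  \<comment> \<open>The phase grows by at most \<open>3\<pi>/5 < \<pi>\<close> over an interval of length 3.\<close>
  have jump: "N (3/2) \<le> N (-3/2) + 1"
  proof -
    have "\<phi> (3/2) - \<phi> (-3/2) \<le> pi / 5 * \<bar>3/2 - (-3/2)\<bar>" by (rule order.trans[OF abs_ge_self lip])
    also have "\<dots> = 3 * pi / 5" by simp
    finally have "\<phi> (3/2) \<le> \<phi> (-3/2) + pi" using pi_gt_zero by linarith
    then have "\<phi> (3/2) / pi \<le> (\<phi> (-3/2) + pi) / pi" by (intro divide_right_mono) auto
    then have "\<phi> (3/2) / pi + 1/2 \<le> \<phi> (-3/2) / pi + 1/2 + 1" by (simp add: add_divide_distrib)
    then have "N (3/2) \<le> \<lfloor>\<phi> (-3/2) / pi + 1/2 + 1\<rfloor>" unfolding N_def by (rule floor_mono)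
    then show ?thesis unfolding N_def by linarith
  qed
  have "(\<forall>z. Im z > 0 \<longrightarrow> Re z \<in> {-1<..<-1/2} \<longrightarrow> exp (Re (G z)) \<ge> exp (- (pi + 3)) / (4 * norm z + 5) ^ 3) \<or>
     (\<forall>z. Im z > 0 \<longrightarrow> Re z \<in> {1/2<..<1} \<longrightarrow> exp (Re (G z)) \<ge> exp (- (pi + 3)) / (4 * norm z + 5) ^ 3)"
  proof (cases "N 0 = N (-3/2)")
    case True
    have "N (x - 1/2) = N (x + 1/2)" if "x \<in> {-1<..<-1/2}" for x
    proof -
      have "N (-3/2) \<le> N (x - 1/2)" "N (x - 1/2) \<le> N (x + 1/2)" "N (x + 1/2) \<le> N 0"
        using that by (auto intro!: N_mono)
      with True show ?thesis by linarith
    qed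
    then show ?thesis using low by blast
  next
    case False
    have "N (-3/2) \<le> N 0" "N 0 \<le> N (3/2)" by (auto intro!: N_mono)
    with False jump have eq: "N 0 = N (3/2)" by linarith
    have "N (x - 1/2) = N (x + 1/2)" if "x \<in> {1/2<..<1}" for x
    proof -
      have "N 0 \<le> N (x - 1/2)" "N (x - 1/2) \<le> N (x + 1/2)" "N (x + 1/2) \<le> N (3/2)"
        using that by (auto intro!: N_mono)
      with eq show ?thesis by linarith
    qed
    then show ?thesis using low by blast
  qed
  moreover
  have "AE x in lborel. \<exists>k::int. (\<lambda>n. Im (G (Complex x (1 / real (Suc n))))) \<longlonglongrightarrow> \<phi> x - pi * k"
  proof -
    \<comment> \<open>The monotone function \<open>N\<close> has countably many jumps, and \<open>s\<close> is continuous elsewhere.\<close>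
    have "countable {x. \<not> isCont (\<lambda>x. real_of_int (N x)) x}"
      by (rule mono_ctble_discont) (use N_mono in \<open>auto simp: mono_def\<close>)
    then have "{x. \<not> isCont (\<lambda>x. real_of_int (N x)) x} \<in> null_sets lborel"
      by (rule countable_imp_null_set_lborel)
    then have "AE x in lborel. isCont (\<lambda>x. real_of_int (N x)) x"
      by (rule AE_I') auto
    then show ?thesis
    proof eventually_elim
      case (elim x)
      have "isCont \<phi> x" using contphi by (simp add: continuous_on_eq_continuous_at)
      then have "isCont s x" unfolding s_def using elim by (intro continuous_intros)
      then have "(\<lambda>n. Im (cauchy_transform s (Complex x (1 / real (Suc n))))) \<longlonglongrightarrow> pi * s x"
        by (intro poisson_integral_tendsto[OF s_meas s_bd] LIMSEQ_Suc[OF lim_1_over_n]) auto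
      from tendsto_divide[OF this tendsto_const[of pi]]
      have "(\<lambda>n. Im (G (Complex x (1 / real (Suc n))))) \<longlonglongrightarrow> \<phi> x - pi * N x"
        by (simp add: G_def s_def)
      then show ?case by blast
    qed
  qed
  ultimately show ?thesis using that by blast
qed

section \<open>Dirichlet factors\<close>

text \<open>
  Up to a constant, the Fourier transform of the indicator function of an interval whose length is proportional to
  \<open>\<tau>\<close>; in the upper half-plane it is bounded by 1 and decays like \<open>1/\<bar>z\<bar>\<close>.
\<close>
definition dirichlet_factor :: "real \<Rightarrow> complex \<Rightarrow> complex" where
  "dirichlet_factor \<tau> z = (exp (\<i> * \<tau> * z) - 1) / (\<i> * \<tau> * z)"

lemma norm_exp_minus_one_le:
  fixes w :: complex
  assumes "Re w \<le> 0"
  shows "norm (exp w - 1) \<le> norm w"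
proof -
  have "norm (exp w - exp 0) \<le> 1 * norm (w - 0)"
  proof (rule field_differentiable_bound[where S = "{w. Re w \<le> 0}"])
    show "convex {w::complex. Re w \<le> 0}" by (rule convex_halfspace_Re_le)
    show "(exp has_field_derivative exp z) (at z within {w. Re w \<le> 0})" for z :: complex
      by (rule has_field_derivative_at_within) (rule DERIV_exp)
  qed (use assms in auto)
  then show ?thesis by simp
qed

lemma norm_exp_minus_one_ge:
  fixes w :: complex
  assumes "norm w \<le> 1 / 4"
  shows "norm w / 2 \<le> norm (exp w - 1)"
proof -
  have "norm (exp w - (\<Sum>i\<le>1. w ^ i / fact i)) \<le> exp \<bar>Re w\<bar> * norm w ^ Suc 1 / fact 1"
    by (rule Taylor_exp)
  then have "norm (exp w - 1 - w) \<le> exp \<bar>Re w\<bar> * (norm w)\<^sup>2"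
    by (simp add: diff_diff_eq power2_eq_square)
  also have "\<dots> \<le> 2 * (norm w * (1 / 4))"
    unfolding power2_eq_square
  proof (intro mult_mono)
    have "\<bar>Re w\<bar> \<le> 1 / 4" using abs_Re_le_cmod[of w] assms by linarith
    then have "exp \<bar>Re w\<bar> \<le> exp (1/4)" by simp
    also have "\<dots> \<le> 1 + 1/4 + (1/4)\<^sup>2" by (rule exp_bound) auto
    also have "\<dots> \<le> (2::real)" by (simp add: power2_eq_square)
    finally show "exp \<bar>Re w\<bar> \<le> 2" .
  qed (use assms in auto)
  finally have "norm (exp w - 1 - w) \<le> norm w / 2" by simp
  moreover have "norm w \<le> norm (exp w - 1) + norm (exp w - 1 - w)"
    using norm_triangle_ineq4[of "exp w - 1" "exp w - 1 - w"] by simp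
  ultimately show ?thesis by linarith
qed

lemma norm_dirichlet_factor:
  assumes "Im z > 0" "\<tau> > 0"
  shows "norm (dirichlet_factor \<tau> z) \<le> 1" "norm (dirichlet_factor \<tau> z) * (\<tau> * norm z) \<le> 2"
    and "\<tau> * norm z \<le> 1 / 4 \<Longrightarrow> 1 / 2 \<le> norm (dirichlet_factor \<tau> z)"
proof -
  have n: "norm (\<i> * \<tau> * z) = \<tau> * norm z" using assms by (simp add: norm_mult)
  have z: "norm z > 0" using assms by auto
  have re: "Re (\<i> * \<tau> * z) \<le> 0" using assms by simp
  have nd: "norm (dirichlet_factor \<tau> z) = norm (exp (\<i> * \<tau> * z) - 1) / (\<tau> * norm z)"
    unfolding dirichlet_factor_def norm_divide n ..
  show "norm (dirichlet_factor \<tau> z) \<le> 1"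
    unfolding nd using norm_exp_minus_one_le[OF re] assms z unfolding n by (simp add: divide_le_eq)
  have "norm (exp (\<i> * \<tau> * z) - 1) \<le> norm (exp (\<i> * \<tau> * z)) + norm (1::complex)" by (rule norm_triangle_ineq4)
  also have "norm (exp (\<i> * \<tau> * z)) \<le> 1" using re by (simp add: norm_exp_eq_Re)
  finally have "norm (exp (\<i> * \<tau> * z) - 1) \<le> 2" by simp
  then show "norm (dirichlet_factor \<tau> z) * (\<tau> * norm z) \<le> 2" unfolding nd using assms z by simp
  show "1 / 2 \<le> norm (dirichlet_factor \<tau> z)" if "\<tau> * norm z \<le> 1 / 4"
    using norm_exp_minus_one_ge[of "\<i> * \<tau> * z"] that assms z unfolding n nd by (simp add: field_simps)
qed

text \<open>
  On the real line the factor has argument \<open>\<tau>x/2\<close> modulo \<open>\<pi>\<close>.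
\<close>
lemma cnj_dirichlet_factor:
  "cnj (dirichlet_factor \<tau> (of_real x)) = exp (- (\<i> * \<tau> * x)) * dirichlet_factor \<tau> (of_real x)"
proof -
  define w where "w = \<i> * complex_of_real \<tau> * of_real x"
  have c: "cnj w = - w" by (simp add: w_def)
  have "cnj (dirichlet_factor \<tau> (of_real x)) = (exp (- w) - 1) / (- w)"
    by (simp add: dirichlet_factor_def c exp_cnj flip: w_def)
  also have "\<dots> = (1 - exp (- w)) / w"
    using minus_divide_divide[of "1 - exp (- w)" w] by (simp only: minus_diff_eq)
  also have "1 - exp (- w) = exp (- w) * (exp w - 1)"
    by (simp add: right_diff_distrib exp_minus)
  finally show ?thesis by (simp add: dirichlet_factor_def flip: w_def)
qed

text \<open>
  Here \<open>r\<close> stands for \<open>\<bar>z\<bar>\<close> and \<open>e\<close> for the modulus of the Dirichlet factor. Three of the six powers of \<open>e\<close>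
  compensate the cubic growth, at the cost of \<open>\<tau>\<^sup>-\<^sup>3\<close>; all six also provide the decay needed for integrability, where
  the dependence on \<open>\<tau>\<close> is irrelevant.
\<close>
lemma decay_estimates:
  fixes r e \<tau> :: real
  assumes "0 \<le> r" "0 \<le> e" "e \<le> 1" "e * (\<tau> * r) \<le> 2" "0 < \<tau>" "\<tau> \<le> 1"
  shows "(4 * r + 5) ^ 3 * e ^ 6 \<le> 5832 / \<tau> ^ 3"
    and "(4 * r + 5) ^ 3 * e ^ 6 * (1 + r\<^sup>2) \<le> 93312 / \<tau> ^ 6"
proof -
  define E R where "E = e ^ 3" and "R = r ^ 3"
  have e6: "e ^ 6 = E * E" and r6: "r ^ 6 = R * R" by (simp_all add: E_def R_def flip: power_add)
  have r3: "R = r\<^sup>2 * r" by (simp add: R_def power2_eq_square power3_eq_cube)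
  have r9: "(9 * r) ^ 3 = 729 * R" and er3: "(e * r) ^ 3 = E * R" by (simp_all add: power_mult_distrib E_def R_def)
  have er6: "(e * r) ^ 6 = E * E * (R * R)" by (simp add: power_mult_distrib e6 r6)
  have key: "(4 * r + 5) ^ 3 * e ^ 6 \<le> 5832 / \<tau> ^ 3 \<and> (4 * r + 5) ^ 3 * e ^ 6 * (1 + r\<^sup>2) \<le> 93312 / \<tau> ^ 6"
  proof (cases "r \<le> 1")
    case True
    have t: "\<tau> ^ k \<le> 1" "\<tau> ^ k > 0" for k using assms by (auto intro: power_le_one)
    have "(4 * r + 5) ^ 3 \<le> 9 ^ 3" using assms True by (intro power_mono) auto
    moreover have "e ^ 6 \<le> 1" using assms by (intro power_le_one) auto
    ultimately have 1: "(4 * r + 5) ^ 3 * e ^ 6 \<le> 729 * 1" using assms by (intro mult_mono) auto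
    have "1 + r\<^sup>2 \<le> 2" using assms True by (simp add: power_le_one)
    have 2: "(4 * r + 5) ^ 3 * e ^ 6 * (1 + r\<^sup>2) \<le> (729 * 1) * 2"
      by (rule mult_mono[OF 1 \<open>1 + r\<^sup>2 \<le> 2\<close>]) auto
    have "5832 \<le> 5832 / \<tau> ^ 3" "93312 \<le> 93312 / \<tau> ^ 6" using t[of 3] t[of 6] by (simp_all add: le_divide_eq)
    with 1 2 show ?thesis by linarith
  next
    case False
    have w: "4 * r + 5 \<le> 9 * r" using False by simp
    have e\<tau>: "e * r \<le> 2 / \<tau>" using assms by (simp add: field_simps)
    have er: "(e * r) ^ k \<le> (2 / \<tau>) ^ k" for k using e\<tau> assms by (intro power_mono) auto
    have "(4 * r + 5) ^ 3 \<le> (9 * r) ^ 3" using w assms by (intro power_mono) auto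
    then have b: "(4 * r + 5) ^ 3 * e ^ 6 \<le> (9 * r) ^ 3 * e ^ 6" using assms by (intro mult_right_mono) auto
    also have "\<dots> = 729 * (e * r) ^ 3 * e ^ 3" unfolding e6 r9 er3 E_def[symmetric] by simp
    also have "\<dots> \<le> 729 * (2 / \<tau>) ^ 3 * 1"
      using er[of 3] assms by (intro mult_mono power_le_one) auto
    also have "\<dots> = 5832 / \<tau> ^ 3" by (simp add: power_divide)
    finally have 1: "(4 * r + 5) ^ 3 * e ^ 6 \<le> 5832 / \<tau> ^ 3" .
    have "1 + r\<^sup>2 \<le> 2 * r\<^sup>2" using False power_mono[of 1 r 2] by simp
    moreover have "r\<^sup>2 * 1 \<le> r\<^sup>2 * r" using False by (intro mult_left_mono) auto
    ultimately have "1 + r\<^sup>2 \<le> 2 * r ^ 3" unfolding R_def[symmetric] r3 by linarith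
    have "(4 * r + 5) ^ 3 * e ^ 6 * (1 + r\<^sup>2) \<le> ((9 * r) ^ 3 * e ^ 6) * (2 * r ^ 3)"
      by (rule mult_mono[OF b \<open>1 + r\<^sup>2 \<le> 2 * r ^ 3\<close>]) (use assms in auto)
    also have "\<dots> = 1458 * (e * r) ^ 6" unfolding e6 r9 er6 R_def[symmetric] by simp
    also have "\<dots> \<le> 1458 * (2 / \<tau>) ^ 6" using er[of 6] by simp
    also have "\<dots> = 93312 / \<tau> ^ 6" by (simp add: power_divide)
    finally show ?thesis using 1 by simp
  qed
  then show "(4 * r + 5) ^ 3 * e ^ 6 \<le> 5832 / \<tau> ^ 3" "(4 * r + 5) ^ 3 * e ^ 6 * (1 + r\<^sup>2) \<le> 93312 / \<tau> ^ 6" by auto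
qed

section \<open>The multiplier for a regularised weight\<close>

lemma holomorphic_on_upper_tendsto:
  assumes "f holomorphic_on {z. Im z > 0}" "Im z > 0" "(w \<longlongrightarrow> z) F"
  shows "((\<lambda>n. f (w n)) \<longlongrightarrow> f z) F"
proof -
  have "open {z. Im z > 0}" by (rule open_halfspace_Im_gt)
  then have "isCont f z"
    using holomorphic_on_imp_continuous_on[OF assms(1)] assms(2) by (simp add: continuous_on_eq_continuous_at)
  then show ?thesis by (rule isCont_tendsto_compose) (rule assms(3))
qed

lemma tendsto_Complex_vertical:
  assumes "b \<longlonglongrightarrow> y"
  shows "(\<lambda>n::nat. Complex x (b n)) \<longlonglongrightarrow> Complex x y"
  unfolding Complex_eq by (intro tendsto_intros assms)

text \<open>
  The boundary values of the Laplace transform of a bounded function with bounded support exist at every point.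
  They carry pointwise bounds on the half-plane over to the Fourier transform at every real point, without
  exceptional sets.
\<close>
lemma tendsto_laplace_transform:
  fixes \<psi> :: "real \<Rightarrow> complex"
  assumes meas: "\<psi> \<in> borel_measurable borel" and bd: "\<And>t. norm (\<psi> t) \<le> M" and supp: "\<And>t::real. t \<notin> {0..\<sigma>} \<Longrightarrow> \<psi> t = 0"
    and a: "\<And>n. a n > 0" "a \<longlonglongrightarrow> 0"
  shows "(\<lambda>n. LINT t|lborel. \<psi> t * exp (2 * pi * \<i> * Complex x (a n) * t))
    \<longlonglongrightarrow> (LINT t|lborel. \<psi> t * exp (2 * pi * \<i> * x * t))"
proof (rule integral_dominated_convergence[where w = "\<lambda>t. indicator {0..\<sigma>} t * M"])
  have [measurable]: "\<psi> \<in> borel_measurable borel" by (rule meas)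
  show "integrable lborel (\<lambda>t. indicator {0..\<sigma>} t * M)"
    by (intro integrable_mult_left integrable_real_indicator) (auto simp: emeasure_lborel_Icc_eq)
  show "AE t in lborel. (\<lambda>n. \<psi> t * exp (2 * pi * \<i> * Complex x (a n) * t)) \<longlonglongrightarrow> \<psi> t * exp (2 * pi * \<i> * x * t)"
  proof (rule AE_I2)
    fix t :: real
    have "(\<lambda>n. Complex x (a n)) \<longlonglongrightarrow> of_real x"
      using tendsto_Complex_vertical[OF a(2), of x] by (simp add: Complex_eq)
    then show "(\<lambda>n. \<psi> t * exp (2 * pi * \<i> * Complex x (a n) * t)) \<longlonglongrightarrow> \<psi> t * exp (2 * pi * \<i> * x * t)"
      by (intro tendsto_intros)
  qed
  show "AE t in lborel. norm (\<psi> t * exp (2 * pi * \<i> * Complex x (a n) * t)) \<le> indicator {0..\<sigma>} t * M" for n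
  proof (rule AE_I2)
    fix t :: real
    show "norm (\<psi> t * exp (2 * pi * \<i> * Complex x (a n) * t)) \<le> indicator {0..\<sigma>} t * M"
    proof (cases "t \<in> {0..\<sigma>}")
      case True
      have "norm (exp (2 * pi * \<i> * Complex x (a n) * t)) = exp (- (2 * pi * a n * t))" by (simp add: norm_exp_eq_Re)
      also have "\<dots> \<le> 1" using True a(1)[of n] by simp
      finally have "norm (\<psi> t * exp (2 * pi * \<i> * Complex x (a n) * t)) \<le> M * 1"
        unfolding norm_mult using bd[of t] order.trans[OF norm_ge_zero bd[of t]] by (intro mult_mono) auto
      then show ?thesis using True by simp
    qed (use supp[of t] in simp)
  qed
qed (use meas in measurable)

text \<open>
  The construction of \<open>\<psi>\<close> for a weight \<open>P = exp u\<close> whose logarithm has a conjugate function with Lipschitz constant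
  \<open>\<pi>\<sigma>'\<close>. The function \<open>f\<close> is the product of the outer function of \<open>P\<close>, the sawtooth correction \<open>exp G\<close>, the sixth
  power of the Dirichlet factor and a normalising constant \<open>\<kappa>\<close>. Its argument on the real line is
  \<open>\<pi>\<sigma>'x + 3\<tau>x = \<pi>\<sigma>x\<close> modulo \<open>\<pi>\<close>. The constant \<open>c\<close> is \<open>\<kappa> / (\<sigma> - \<sigma>')\<^sup>3\<close> times the lower bounds for \<open>\<bar>exp G\<bar>\<close> and for
  the Dirichlet factor on \<open>\<bar>z\<bar> \<le> 3/2\<close>.
\<close>
lemma multiplier_of_regularized_weight:
  fixes h :: "real \<Rightarrow> real" and \<sigma> \<sigma>' y M :: real
  assumes lc: "poisson_summable h" and hM: "\<And>z. Im z > 0 \<Longrightarrow> Im (cauchy_transform h z) \<le> pi * M"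
    and \<sigma>: "0 < \<sigma>'" "\<sigma>' < \<sigma>" "\<sigma> < 1 / 10" and y: "y > 0"
    and lip: "\<And>u v. \<bar>Re (cauchy_transform h (Complex u y)) - Re (cauchy_transform h (Complex v y))\<bar> \<le> pi * (pi * \<sigma>') * \<bar>u - v\<bar>"
  defines "P \<equiv> (\<lambda>x. exp (Im (cauchy_transform h (Complex x y)) / pi))"
    and "c \<equiv> (pi / 3) ^ 3 / (5832 * exp (pi + 2)) * (exp (- (pi + 3)) / 11 ^ 3) * (1 / 2) ^ 6"
  obtains \<psi> :: "real \<Rightarrow> complex" and L :: real
  where "\<psi> \<in> borel_measurable borel" "\<And>t. norm (\<psi> t) \<le> L" "\<And>t. t \<notin> {0..\<sigma>} \<Longrightarrow> \<psi> t = 0"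
    "\<And>x::real. norm (LINT t|lborel. \<psi> t * exp (2 * pi * \<i> * x * t)) \<le> P x"
    "(\<forall>x\<in>{-1<..<-1/2::real}. norm (LINT t|lborel. \<psi> t * exp (2 * pi * \<i> * x * t)) \<ge> c * (\<sigma> - \<sigma>') ^ 3 * P x) \<or>
     (\<forall>x\<in>{1/2<..<1::real}. norm (LINT t|lborel. \<psi> t * exp (2 * pi * \<i> * x * t)) \<ge> c * (\<sigma> - \<sigma>') ^ 3 * P x)"
proof -
  \<comment> \<open>Chosen so that \<open>\<pi>\<sigma>' + 3\<tau> = \<pi>\<sigma>\<close>.\<close>
  define \<tau> where "\<tau> = pi * (\<sigma> - \<sigma>') / 3"
  have \<tau>0: "\<tau> > 0" using \<sigma> by (simp add: \<tau>_def)
  have \<tau>1: "\<tau> \<le> 4 / 30"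
  proof -
    have "pi * (\<sigma> - \<sigma>') \<le> 4 * (1 / 10)" using \<sigma> pi_less_4 by (intro mult_mono) auto
    then show ?thesis by (simp add: \<tau>_def)
  qed
  define A where "A = (\<lambda>x. - Re (cauchy_transform h (Complex x y)) / pi)"
  define \<phi> where "\<phi> = (\<lambda>x. pi * \<sigma>' * x - A x)"
  have A_lip: "\<bar>A u - A v\<bar> \<le> pi * \<sigma>' * \<bar>u - v\<bar>" for u v
  proof -
    have "A u - A v = (Re (cauchy_transform h (Complex v y)) - Re (cauchy_transform h (Complex u y))) / pi"
      by (simp add: A_def diff_divide_distrib)
    then have "\<bar>A u - A v\<bar> = \<bar>Re (cauchy_transform h (Complex v y)) - Re (cauchy_transform h (Complex u y))\<bar> / pi"
      by (simp add: abs_divide)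
    also have "\<dots> \<le> (pi * (pi * \<sigma>') * \<bar>v - u\<bar>) / pi" by (intro divide_right_mono lip) simp
    also have "\<dots> = pi * \<sigma>' * \<bar>u - v\<bar>" by (simp add: abs_minus_commute)
    finally show ?thesis .
  qed
  have mono_phi: "mono \<phi>"
  proof (rule monoI)
    fix u v :: real assume uv: "u \<le> v"
    have "A v - A u \<le> pi * \<sigma>' * \<bar>v - u\<bar>" by (rule order.trans[OF abs_ge_self A_lip])
    also have "\<dots> = pi * \<sigma>' * v - pi * \<sigma>' * u" using uv by (simp add: right_diff_distrib)
    finally show "\<phi> u \<le> \<phi> v" by (simp add: \<phi>_def)
  qed
  have lip_phi: "\<bar>\<phi> u - \<phi> v\<bar> \<le> pi / 5 * \<bar>u - v\<bar>" for u v
  proof -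
    have "\<phi> u - \<phi> v = pi * \<sigma>' * (u - v) - (A u - A v)" by (simp add: \<phi>_def algebra_simps)
    then have "\<bar>\<phi> u - \<phi> v\<bar> \<le> \<bar>pi * \<sigma>' * (u - v)\<bar> + \<bar>A u - A v\<bar>" by (simp only: abs_triangle_ineq4)
    also have "\<dots> \<le> pi * \<sigma>' * \<bar>u - v\<bar> + pi * \<sigma>' * \<bar>u - v\<bar>"
      using A_lip \<sigma> by (intro add_mono) (auto simp: abs_mult)
    also have "\<dots> = 2 * \<sigma>' * (pi * \<bar>u - v\<bar>)" by simp
    also have "\<dots> \<le> 1 / 5 * (pi * \<bar>u - v\<bar>)" using \<sigma> by (intro mult_right_mono) auto
    finally show ?thesis by simp
  qed
  obtain G where holG: "G holomorphic_on {z. Im z > 0}"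
    and G_upper: "\<And>z. Im z > 0 \<Longrightarrow> exp (Re (G z)) \<le> exp (pi + 2) * (4 * norm z + 5) ^ 3"
    and G_lower: "(\<forall>z. Im z > 0 \<longrightarrow> Re z \<in> {-1<..<-1/2} \<longrightarrow> exp (Re (G z)) \<ge> exp (- (pi + 3)) / (4 * norm z + 5) ^ 3) \<or>
     (\<forall>z. Im z > 0 \<longrightarrow> Re z \<in> {1/2<..<1} \<longrightarrow> exp (Re (G z)) \<ge> exp (- (pi + 3)) / (4 * norm z + 5) ^ 3)"
    and G_arg: "AE x in lborel. \<exists>k::int. (\<lambda>n. Im (G (Complex x (1 / real (Suc n))))) \<longlonglongrightarrow> \<phi> x - pi * k"
    by (rule sawtooth_outer[OF mono_phi lip_phi]) (rule that)
  \<comment> \<open>The largest constant for which the estimates below give \<open>\<bar>f\<bar> \<le> exp (Im T / \<pi>)\<close>.\<close>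
  define \<kappa> where "\<kappa> = \<tau> ^ 3 / (5832 * exp (pi + 2))"
  have \<kappa>0: "\<kappa> > 0" using \<tau>0 by (simp add: \<kappa>_def)
  define T where "T = (\<lambda>z. cauchy_transform h (z + \<i> * y))"
  define p where "p = (\<lambda>z. G z - \<i> * T z / pi)"
  define E where "E = dirichlet_factor \<tau>"
  define f where "f = (\<lambda>z. \<kappa> * exp (p z) * E z ^ 6)"
  have holT: "T holomorphic_on {z. Im z > 0}"
    unfolding T_def
    by (rule holomorphic_on_compose_gen[OF _ holomorphic_cauchy_transform[OF lc], unfolded o_def])
       (use y in \<open>auto intro!: holomorphic_intros\<close>)
  have holE: "E holomorphic_on {z. Im z > 0}"
    unfolding E_def dirichlet_factor_def using \<tau>0 by (intro holomorphic_intros) auto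
  have holf: "f holomorphic_on {z. Im z > 0}"
    unfolding f_def p_def by (intro holomorphic_intros holG holT holE) simp
  have Re_p: "Re (p z) = Im (T z) / pi + Re (G z)" for z by (simp add: p_def)
  have norm_f: "norm (f z) = \<kappa> * exp (Im (T z) / pi) * exp (Re (G z)) * norm (E z) ^ 6" for z
    using \<kappa>0 by (simp add: f_def norm_mult norm_power norm_exp_eq_Re Re_p exp_add)
  have E1: "norm (E z) \<le> 1" "norm (E z) * (\<tau> * norm z) \<le> 2" if "Im z > 0" for z
    using norm_dirichlet_factor(1,2)[OF that \<tau>0] by (simp_all add: E_def)
  note est = decay_estimates[OF norm_ge_zero norm_ge_zero E1 \<tau>0 order.trans[OF \<tau>1]]
  have \<kappa>mult: "\<kappa> * exp (Re (G z)) * norm (E z) ^ 6 \<le> \<tau> ^ 3 / 5832 * ((4 * norm z + 5) ^ 3 * norm (E z) ^ 6)"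
    if z: "Im z > 0" for z
  proof -
    have "\<kappa> * exp (Re (G z)) * norm (E z) ^ 6 \<le> \<kappa> * (exp (pi + 2) * (4 * norm z + 5) ^ 3) * norm (E z) ^ 6"
      using \<kappa>0 by (intro mult_right_mono mult_left_mono G_upper z) auto
    also have "\<dots> = \<tau> ^ 3 / 5832 * ((4 * norm z + 5) ^ 3 * norm (E z) ^ 6)" by (simp add: \<kappa>_def)
    finally show ?thesis .
  qed
  have upper: "norm (f z) \<le> exp (Im (T z) / pi)" if z: "Im z > 0" for z
  proof -
    have "\<kappa> * exp (Re (G z)) * norm (E z) ^ 6 \<le> \<tau> ^ 3 / 5832 * ((4 * norm z + 5) ^ 3 * norm (E z) ^ 6)" by (rule \<kappa>mult[OF z])
    also have "\<dots> \<le> \<tau> ^ 3 / 5832 * (5832 / \<tau> ^ 3)"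
      using \<tau>0 z by (intro mult_left_mono est(1)) auto
    also have "\<dots> = 1" using \<tau>0 by simp
    finally have "exp (Im (T z) / pi) * (\<kappa> * exp (Re (G z)) * norm (E z) ^ 6) \<le> exp (Im (T z) / pi) * 1"
      by (intro mult_left_mono) auto
    then show ?thesis unfolding norm_f by (simp add: ac_simps)
  qed
  have T_bound: "exp (Im (T z) / pi) \<le> exp M" if "Im z > 0" for z
  proof -
    have "Im (T z) / pi \<le> (pi * M) / pi" unfolding T_def using that y by (intro divide_right_mono hM) auto
    then show ?thesis by simp
  qed
  define B where "B = exp M * (\<tau> ^ 3 / 5832 * (93312 / \<tau> ^ 6))"
  have decay: "norm (f z) \<le> B / (1 + (norm z)\<^sup>2)" if z: "Im z > 0" for z
  proof -
    have "norm (f z) * (1 + (norm z)\<^sup>2) = exp (Im (T z) / pi) * ((\<kappa> * exp (Re (G z)) * norm (E z) ^ 6) * (1 + (norm z)\<^sup>2))"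
      unfolding norm_f by (simp only: ac_simps)
    also have "\<dots> \<le> exp M * ((\<tau> ^ 3 / 5832 * ((4 * norm z + 5) ^ 3 * norm (E z) ^ 6)) * (1 + (norm z)\<^sup>2))"
      using \<kappa>0 by (intro mult_mono[OF T_bound[OF z]] mult_right_mono[OF \<kappa>mult[OF z]]) auto
    also have "\<dots> = exp M * (\<tau> ^ 3 / 5832 * ((4 * norm z + 5) ^ 3 * norm (E z) ^ 6 * (1 + (norm z)\<^sup>2)))"
      by (simp only: ac_simps)
    also have "\<dots> \<le> B"
      unfolding B_def using \<tau>0 z by (intro mult_left_mono est(2)) auto
    finally show ?thesis by (subst pos_le_divide_eq) (auto simp: add_pos_nonneg)
  qed
  define a where "a = (\<lambda>n. 1 / real (Suc n))"
  have a: "a n > 0" "a \<longlonglongrightarrow> 0" for n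
    unfolding a_def using LIMSEQ_Suc[OF lim_1_over_n] by auto
  have T_lim: "(\<lambda>n. T (Complex x (a n))) \<longlonglongrightarrow> cauchy_transform h (Complex x y)" for x
  proof -
    have "(\<lambda>n. a n + y) \<longlonglongrightarrow> 0 + y" by (intro tendsto_intros a)
    then have "(\<lambda>n. cauchy_transform h (Complex x (a n + y))) \<longlonglongrightarrow> cauchy_transform h (Complex x y)"
      by (intro holomorphic_on_upper_tendsto[OF holomorphic_cauchy_transform[OF lc]] tendsto_Complex_vertical) (use y in auto)
    moreover have "Complex x (a n + y) = Complex x (a n) + \<i> * y" for n by (simp add: complex_eq_iff)
    ultimately show ?thesis by (simp add: T_def)
  qed
  have sym: "AE x in lborel. (\<lambda>n. f (Complex x (1 / real (Suc n)))
        - exp (2 * pi * \<i> * \<sigma> * x) * cnj (f (Complex x (1 / real (Suc n))))) \<longlonglongrightarrow> 0"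
    using G_arg AE_lborel_singleton[of 0]
  proof eventually_elim
    case (elim x)
    then obtain k :: int where k: "(\<lambda>n. Im (G (Complex x (a n)))) \<longlonglongrightarrow> \<phi> x - pi * k" by (auto simp: a_def)
    define \<theta> where "\<theta> = (\<lambda>n. Im (p (Complex x (a n))))"
    have \<theta>: "\<theta> \<longlonglongrightarrow> pi * \<sigma>' * x - pi * k"
    proof -
      have "(\<lambda>n. Im (G (Complex x (a n))) - Re (T (Complex x (a n))) / pi) \<longlonglongrightarrow> (\<phi> x - pi * k) - Re (cauchy_transform h (Complex x y)) / pi"
        by (intro tendsto_intros k T_lim) simp
      then show ?thesis by (simp add: \<theta>_def p_def \<phi>_def A_def)
    qed
    define e where "e = E (of_real x)"
    have E_lim: "(\<lambda>n. E (Complex x (a n))) \<longlonglongrightarrow> e"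
    proof -
      have l: "(\<lambda>n. Complex x (a n)) \<longlonglongrightarrow> of_real x"
        using tendsto_Complex_vertical[OF a(2), of x] by (simp add: Complex_eq)
      show ?thesis unfolding e_def E_def dirichlet_factor_def
        using elim \<tau>0 by (intro tendsto_intros l) auto
    qed
    define r where "r = (\<lambda>n. \<kappa> * exp (Re (p (Complex x (a n)))))"
    \<comment> \<open>The modulus \<open>r n\<close> is split off: it stays bounded, although it may fail to converge, while \<open>d\<close> tends to zero.\<close>
    define d where "d = (\<lambda>n. exp (\<i> * \<theta> n) * E (Complex x (a n)) ^ 6
        - exp (2 * pi * \<i> * \<sigma> * x) * (exp (- (\<i> * \<theta> n)) * cnj (E (Complex x (a n))) ^ 6))"
    have fr: "f (Complex x (a n)) - exp (2 * pi * \<i> * \<sigma> * x) * cnj (f (Complex x (a n))) = of_real (r n) * d n" for n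
    proof -
      have "exp (p (Complex x (a n))) = of_real (exp (Re (p (Complex x (a n))))) * exp (\<i> * \<theta> n)"
        unfolding \<theta>_def by (metis exp_eq_polar cis_conv_exp exp_of_real)
      then have "f (Complex x (a n)) = of_real (r n) * (exp (\<i> * \<theta> n) * E (Complex x (a n)) ^ 6)"
        by (simp add: f_def r_def)
      then show ?thesis by (simp add: d_def exp_cnj algebra_simps)
    qed
    have "d \<longlonglongrightarrow> exp (\<i> * of_real (pi * \<sigma>' * x - pi * k)) * e ^ 6
        - exp (2 * pi * \<i> * \<sigma> * x) * (exp (- (\<i> * of_real (pi * \<sigma>' * x - pi * k))) * cnj e ^ 6)"
      unfolding d_def by (intro tendsto_intros \<theta> E_lim)
    also have "exp (2 * pi * \<i> * \<sigma> * x) * (exp (- (\<i> * of_real (pi * \<sigma>' * x - pi * k))) * cnj e ^ 6)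
        = exp (\<i> * of_real (pi * \<sigma>' * x - pi * k)) * e ^ 6"
    proof -
      define \<beta> where "\<beta> = \<i> * of_real (pi * \<sigma>' * x - pi * k)"
      have "cnj e ^ 6 = exp (- (6 * (\<i> * \<tau> * x))) * e ^ 6"
        unfolding e_def E_def cnj_dirichlet_factor power_mult_distrib
        using exp_of_nat_mult[of 6 "- (\<i> * \<tau> * x)"] by simp
      moreover have \<tau>6: "6 * (\<i> * \<tau> * x) = 2 * complex_of_real pi * \<i> * (complex_of_real \<sigma> - complex_of_real \<sigma>') * complex_of_real x"
      proof -
        have "complex_of_real (6 * \<tau>) = complex_of_real (2 * pi * (\<sigma> - \<sigma>'))" by (simp add: \<tau>_def)
        then have "6 * complex_of_real \<tau> = 2 * complex_of_real pi * (complex_of_real \<sigma> - complex_of_real \<sigma>')" by simp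
        then have "\<i> * complex_of_real x * (6 * complex_of_real \<tau>) = \<i> * complex_of_real x * (2 * complex_of_real pi * (complex_of_real \<sigma> - complex_of_real \<sigma>'))" by (simp only:)
        then show ?thesis by (simp only: ac_simps)
      qed
      moreover have "exp (2 * pi * \<i> * \<sigma> * x) * (exp (- \<beta>) * exp (- (6 * (\<i> * \<tau> * x)))) = exp (\<beta> + 2 * of_int k * of_real pi * \<i>)"
        unfolding exp_add[symmetric] \<tau>6
        by (rule arg_cong[where f = exp]) (simp add: \<beta>_def algebra_simps)
      moreover have "exp (\<beta> + 2 * of_int k * of_real pi * \<i>) = exp \<beta>"
        by (subst exp_eq) (intro exI[of _ k], simp add: mult_ac)
      ultimately show ?thesis unfolding \<beta>_def[symmetric] by (simp add: mult.assoc[symmetric])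
    qed
    finally have d0: "d \<longlonglongrightarrow> 0" by simp
    define R where "R = \<kappa> * (exp M * (exp (pi + 2) * (4 * (\<bar>x\<bar> + 1) + 5) ^ 3))"
    have r_bd: "norm (complex_of_real (r n)) \<le> R" for n
    proof -
      define z where "z = Complex x (a n)"
      have z: "Im z > 0" using a by (simp add: z_def)
      have "norm z \<le> \<bar>x\<bar> + \<bar>a n\<bar>" using cmod_le[of z] by (simp add: z_def)
      also have "\<bar>a n\<bar> \<le> 1" by (simp add: a_def)
      finally have nz: "norm z \<le> \<bar>x\<bar> + 1" by simp
      have "norm (complex_of_real (r n)) = \<kappa> * (exp (Im (T z) / pi) * exp (Re (G z)))"
        using \<kappa>0 by (simp add: r_def Re_p exp_add z_def[symmetric] norm_mult)
      also have "\<dots> \<le> \<kappa> * (exp M * (exp (pi + 2) * (4 * norm z + 5) ^ 3))"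
        using \<kappa>0 by (intro mult_left_mono mult_mono T_bound G_upper z) auto
      also have "\<dots> \<le> R" unfolding R_def using \<kappa>0 nz by (intro mult_left_mono power_mono) auto
      finally show ?thesis .
    qed
    have "(\<lambda>n. of_real (r n) * d n) \<longlonglongrightarrow> 0"
    proof (rule Lim_null_comparison)
      show "\<forall>\<^sub>F n in sequentially. norm (of_real (r n) * d n) \<le> R * norm (d n)"
        using r_bd by (intro always_eventually allI) (simp only: norm_mult, intro mult_right_mono, auto)
      show "(\<lambda>n. R * norm (d n)) \<longlonglongrightarrow> 0" using tendsto_mult[OF tendsto_const tendsto_norm[OF d0], of R] by simp
    qed
    then show ?case unfolding fr[symmetric] by (simp add: a_def)
  qed
  obtain \<psi> :: "real \<Rightarrow> complex" and L :: real where \<psi>: "\<psi> \<in> borel_measurable borel" "\<And>t. norm (\<psi> t) \<le> L" "\<And>t. t \<notin> {0..\<sigma>} \<Longrightarrow> \<psi> t = 0"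
    and repr: "\<And>z. Im z > 0 \<Longrightarrow> f z = (LINT t|lborel. \<psi> t * exp (2 * pi * \<i> * z * t))"
    by (rule paley_wiener_half_plane[OF holf less_imp_le[OF order.strict_trans[OF \<sigma>(1,2)]] decay sym], assumption) (rule that)
  define F where "F = (\<lambda>x::real. LINT t|lborel. \<psi> t * exp (2 * pi * \<i> * x * t))"
  have F_lim: "(\<lambda>n. norm (f (Complex x (a n)))) \<longlonglongrightarrow> norm (F x)" for x
    unfolding F_def using tendsto_norm[OF tendsto_laplace_transform[where x = x, OF \<psi> a]] repr a(1) by simp
  have P_lim: "(\<lambda>n. exp (Im (T (Complex x (a n))) / pi)) \<longlonglongrightarrow> P x" for x
    unfolding P_def by (intro tendsto_intros T_lim) simp
  have F_upper: "norm (F x) \<le> P x" for x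
    by (rule tendsto_le[OF _ P_lim F_lim]) (use upper a in auto)
  have F_lower: "c * (\<sigma> - \<sigma>') ^ 3 * P x \<le> norm (F x)"
    if x: "\<bar>x\<bar> < 1" and Gx: "\<And>n. exp (Re (G (Complex x (a n)))) \<ge> exp (- (pi + 3)) / (4 * norm (Complex x (a n)) + 5) ^ 3" for x
  proof (rule tendsto_le[OF _ F_lim tendsto_mult[OF tendsto_const P_lim]])
    show "\<forall>\<^sub>F n in sequentially. c * (\<sigma> - \<sigma>') ^ 3 * exp (Im (T (Complex x (a n))) / pi) \<le> norm (f (Complex x (a n)))"
      \<comment> \<open>From \<open>n = 1\<close> on the points lie in \<open>\<bar>z\<bar> \<le> 3/2\<close>, where \<open>4\<bar>z\<bar> + 5 \<le> 11\<close> and \<open>\<tau>\<bar>z\<bar> \<le> 1/4\<close>.\<close>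
      using eventually_ge_at_top[of 1]
    proof eventually_elim
      case (elim n)
      define z where "z = Complex x (a n)"
      have z: "Im z > 0" using a by (simp add: z_def)
      have "norm z \<le> \<bar>x\<bar> + \<bar>a n\<bar>" using cmod_le[of z] by (simp add: z_def)
      also have "\<bar>a n\<bar> \<le> 1 / 2" using elim by (simp add: a_def field_simps)
      finally have nz: "norm z \<le> 3 / 2" using x by simp
      have e: "1 / 2 \<le> norm (E z)"
        unfolding E_def
      proof (rule norm_dirichlet_factor(3)[OF z \<tau>0])
        have "\<tau> * norm z \<le> 4 / 30 * (3 / 2)" using \<tau>0 \<tau>1 nz by (intro mult_mono) auto
        then show "\<tau> * norm z \<le> 1 / 4" by simp
      qed
      have "exp (- (pi + 3)) / 11 ^ 3 \<le> exp (- (pi + 3)) / (4 * norm z + 5) ^ 3"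
        using nz by (intro divide_left_mono power_mono mult_pos_pos zero_less_power add_nonneg_pos) auto
      also have "\<dots> \<le> exp (Re (G z))" using Gx[of n] by (simp add: z_def)
      finally have g: "exp (- (pi + 3)) / 11 ^ 3 \<le> exp (Re (G z))" .
      have "c * (\<sigma> - \<sigma>') ^ 3 = \<kappa> * (exp (- (pi + 3)) / 11 ^ 3) * (1 / 2) ^ 6"
        by (simp add: c_def \<kappa>_def \<tau>_def power_mult_distrib power_divide)
      also have "\<dots> \<le> \<kappa> * exp (Re (G z)) * norm (E z) ^ 6"
        using \<kappa>0 g e by (intro mult_mono power_mono) auto
      finally have "c * (\<sigma> - \<sigma>') ^ 3 * exp (Im (T z) / pi) \<le> \<kappa> * exp (Re (G z)) * norm (E z) ^ 6 * exp (Im (T z) / pi)"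
        by (intro mult_right_mono) auto
      then show ?case unfolding norm_f z_def[symmetric] by (simp only: ac_simps)
    qed
  qed simp
  have "(\<forall>x\<in>{-1<..<-1/2}. norm (F x) \<ge> c * (\<sigma> - \<sigma>') ^ 3 * P x) \<or> (\<forall>x\<in>{1/2<..<1}. norm (F x) \<ge> c * (\<sigma> - \<sigma>') ^ 3 * P x)"
    using G_lower
  proof (rule disj_forward)
    assume "\<forall>z. Im z > 0 \<longrightarrow> Re z \<in> {-1<..<-1/2} \<longrightarrow> exp (Re (G z)) \<ge> exp (- (pi + 3)) / (4 * norm z + 5) ^ 3"
    then show "\<forall>x\<in>{-1<..<-1/2}. norm (F x) \<ge> c * (\<sigma> - \<sigma>') ^ 3 * P x"
      by (intro ballI F_lower) (use a in auto)
  next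
    assume "\<forall>z. Im z > 0 \<longrightarrow> Re z \<in> {1/2<..<1} \<longrightarrow> exp (Re (G z)) \<ge> exp (- (pi + 3)) / (4 * norm z + 5) ^ 3"
    then show "\<forall>x\<in>{1/2<..<1}. norm (F x) \<ge> c * (\<sigma> - \<sigma>') ^ 3 * P x"
      by (intro ballI F_lower) (use a in auto)
  qed
  with F_upper show ?thesis using that[OF \<psi>] unfolding F_def by blast
qed

section \<open>The multiplier theorem\<close>

theorem theorem1p3:
  shows "\<exists>C::real. C > 0 \<and>
    (\<forall>(\<omega>::real \<Rightarrow> real) (\<alpha>::real) (K0::real) (\<sigma>'::real) (\<sigma>::real).
       (\<forall>x. \<omega> x > 0) \<longrightarrow>
       \<omega> \<in> borel_measurable lebesgue \<longrightarrow>
       essentially_bounded \<omega> \<longrightarrow>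
       log_integral \<omega> > -\<infinity> \<longrightarrow>
       0 < \<alpha> \<longrightarrow> \<alpha> < 1 \<longrightarrow> K0 > 0 \<longrightarrow>
       (\<forall>x y. \<bar>ln (\<omega> x) - ln (\<omega> y)\<bar> \<le> K0 * \<bar>x - y\<bar> powr \<alpha>) \<longrightarrow>
       0 < \<sigma>' \<longrightarrow> \<sigma>' < \<sigma> \<longrightarrow> \<sigma> < 1 / 10 \<longrightarrow>
       (\<exists>\<psi>::real \<Rightarrow> complex.
          in_L2 \<psi> \<and>
          \<not> (AE x in lebesgue. \<psi> x = 0) \<and>
          ess_support \<psi> \<subseteq> {0..\<sigma>} \<and>
          (\<forall>x. norm (fourier_transform \<psi> x)
             \<le> exp ((K0 / cos (pi * \<alpha> / 2)) powr (1 / (1 - \<alpha>))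
                      * (1 / (pi * \<sigma>')) powr (\<alpha> / (1 - \<alpha>))) * \<omega> x) \<and>
          ((\<forall>x\<in>{-1<..<-1/2}. norm (fourier_transform \<psi> x)
             \<ge> C * (\<sigma> - \<sigma>') ^ 6
                 * exp (- ((K0 / cos (pi * \<alpha> / 2)) powr (1 / (1 - \<alpha>))
                             * (1 / (pi * \<sigma>')) powr (\<alpha> / (1 - \<alpha>)))) * \<omega> x) \<or>
           (\<forall>x\<in>{1/2<..<1}. norm (fourier_transform \<psi> x)
             \<ge> C * (\<sigma> - \<sigma>') ^ 6
                 * exp (- ((K0 / cos (pi * \<alpha> / 2)) powr (1 / (1 - \<alpha>))
                             * (1 / (pi * \<sigma>')) powr (\<alpha> / (1 - \<alpha>)))) * \<omega> x))))"
proof -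
  define c :: real where "c = (pi / 3) ^ 3 / (5832 * exp (pi + 2)) * (exp (- (pi + 3)) / 11 ^ 3) * (1 / 2) ^ 6"
  have c0: "c > 0" unfolding c_def by simp
  show ?thesis
  proof (intro exI[of _ c] conjI c0 allI impI)
    fix \<omega> :: "real \<Rightarrow> real" and \<alpha> K0 \<sigma>' \<sigma> :: real
    assume \<omega>0: "\<forall>x. \<omega> x > 0" and ess: "essentially_bounded \<omega>"
      and \<alpha>: "0 < \<alpha>" "\<alpha> < 1" and K0: "K0 > 0"
      and hol: "\<forall>x y. \<bar>ln (\<omega> x) - ln (\<omega> y)\<bar> \<le> K0 * \<bar>x - y\<bar> powr \<alpha>"
      and \<sigma>: "0 < \<sigma>'" "\<sigma>' < \<sigma>" "\<sigma> < 1 / 10"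
    define h where "h = (\<lambda>x. ln (\<omega> x))"
    interpret holder_function h K0 \<alpha>
      by unfold_locales (use hol \<alpha> K0 in \<open>auto simp: h_def\<close>)
    obtain M0 where M0: "AE x in lebesgue. \<bar>\<omega> x\<bar> \<le> M0" using ess by (auto simp: essentially_bounded_def)
    have hM: "AE t in lborel. h t \<le> ln M0"
    proof -
      have "AE t in lborel. \<bar>\<omega> t\<bar> \<le> M0" using M0 by (simp add: AE_completion_iff)
      then show ?thesis
      proof eventually_elim
        case (elim t)
        then show ?case using \<omega>0[rule_format, of t] unfolding h_def by (intro ln_mono) auto
      qed
    qed
    define D where "D = K0 / cos (pi * \<alpha> / 2)"
    have D: "D > 0" using K0 cos_pos by (simp add: D_def)
    \<comment> \<open>The height at which the conjugate function has Lipschitz constant \<open>\<pi>\<sigma>'\<close>.\<close>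
    define y where "y = (D / (pi * \<sigma>')) powr (1 / (1 - \<alpha>))"
    define B where "B = D powr (1 / (1 - \<alpha>)) * (1 / (pi * \<sigma>')) powr (\<alpha> / (1 - \<alpha>))"
    have y: "y > 0" using D \<sigma> by (simp add: y_def)
    have y_rate: "K0 * y powr \<alpha> / cos (pi * \<alpha> / 2) / y = pi * \<sigma>'"
    proof -
      have "y powr (1 - \<alpha>) = D / (pi * \<sigma>')" using D \<sigma> \<alpha> by (simp add: y_def powr_powr)
      moreover have "y powr \<alpha> * y powr (1 - \<alpha>) = y" using y by (simp flip: powr_add)
      ultimately have "y powr \<alpha> * (D / (pi * \<sigma>')) = y" by simp
      then have "D * y powr \<alpha> = pi * \<sigma>' * y" using \<sigma> by (simp add: field_simps)
      moreover have "K0 * y powr \<alpha> / cos (pi * \<alpha> / 2) / y = D * y powr \<alpha> / y" by (simp add: D_def)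
      ultimately show ?thesis using y by simp
    qed
    have y_close: "K0 * y powr \<alpha> / cos (pi * \<alpha> / 2) = B"
    proof -
      have "y powr \<alpha> = (D * (1 / (pi * \<sigma>'))) powr (\<alpha> / (1 - \<alpha>))" by (simp add: y_def powr_powr)
      also have "\<dots> = D powr (\<alpha> / (1 - \<alpha>)) * (1 / (pi * \<sigma>')) powr (\<alpha> / (1 - \<alpha>))"
        by (rule powr_mult)
      finally have y\<alpha>: "y powr \<alpha> = D powr (\<alpha> / (1 - \<alpha>)) * (1 / (pi * \<sigma>')) powr (\<alpha> / (1 - \<alpha>))" .
      have "K0 * y powr \<alpha> / cos (pi * \<alpha> / 2) = D * y powr \<alpha>" by (simp add: D_def)
      also have "\<dots> = D * (D powr (\<alpha> / (1 - \<alpha>)) * (1 / (pi * \<sigma>')) powr (\<alpha> / (1 - \<alpha>)))"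
        by (simp only: y\<alpha>)
      also have "\<dots> = (D powr 1 * D powr (\<alpha> / (1 - \<alpha>))) * (1 / (pi * \<sigma>')) powr (\<alpha> / (1 - \<alpha>))" using D by simp
      also have "D powr 1 * D powr (\<alpha> / (1 - \<alpha>)) = D powr (1 + \<alpha> / (1 - \<alpha>))" by (simp only: powr_add)
      also have "1 + \<alpha> / (1 - \<alpha>) = 1 / (1 - \<alpha>)" using \<alpha> by (simp add: field_simps)
      finally show ?thesis by (simp add: B_def)
    qed
    define P where "P = (\<lambda>x. exp (Im (cauchy_transform h (Complex x y)) / pi))"
    have P: "P x \<le> exp B * \<omega> x" "exp (- B) * \<omega> x \<le> P x" for x
    proof -
      define q where "q = Im (cauchy_transform h (Complex x y)) / pi"
      have "Im (cauchy_transform h (Complex x y)) - pi * h x = pi * (q - h x)" by (simp add: q_def right_diff_distrib)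
      then have "pi * \<bar>q - h x\<bar> \<le> pi * B"
        using poisson_extension_close[OF y, of x] unfolding y_close by (simp add: abs_mult)
      then have "\<bar>q - h x\<bar> \<le> B" by simp
      then have "q \<le> B + h x" "- B + h x \<le> q" by linarith+
      then have "exp q \<le> exp (B + h x)" "exp (- B + h x) \<le> exp q" by (simp_all only: exp_le_cancel_iff)
      moreover have "exp (h x) = \<omega> x" using \<omega>0 by (simp add: h_def)
      ultimately show "P x \<le> exp B * \<omega> x" "exp (- B) * \<omega> x \<le> P x"
        by (simp_all only: P_def q_def exp_add)
    qed
    have lip: "\<bar>Re (cauchy_transform h (Complex u y)) - Re (cauchy_transform h (Complex v y))\<bar> \<le> pi * (pi * \<sigma>') * \<bar>u - v\<bar>" for u v
    proof -
      have "pi * (K0 * y powr \<alpha> / cos (pi * \<alpha> / 2)) / y = pi * (K0 * y powr \<alpha> / cos (pi * \<alpha> / 2) / y)"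
        by (rule times_divide_eq_right[symmetric])
      then show ?thesis using Re_cauchy_transform_lipschitz[OF y, of u v] unfolding y_rate by (simp only:)
    qed
    obtain \<psi>' :: "real \<Rightarrow> complex" and L :: real
      where \<psi>': "\<psi>' \<in> borel_measurable borel" "\<And>t. norm (\<psi>' t) \<le> L" "\<And>t. t \<notin> {0..\<sigma>} \<Longrightarrow> \<psi>' t = 0"
        and up: "\<And>x::real. norm (LINT t|lborel. \<psi>' t * exp (2 * pi * \<i> * x * t)) \<le> P x"
        and low: "(\<forall>x\<in>{-1<..<-1/2::real}. norm (LINT t|lborel. \<psi>' t * exp (2 * pi * \<i> * x * t)) \<ge> c * (\<sigma> - \<sigma>') ^ 3 * P x) \<or>
          (\<forall>x\<in>{1/2<..<1::real}. norm (LINT t|lborel. \<psi>' t * exp (2 * pi * \<i> * x * t)) \<ge> c * (\<sigma> - \<sigma>') ^ 3 * P x)"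
      by (rule multiplier_of_regularized_weight[OF poisson_summable poisson_extension_le[OF hM] \<sigma> y lip], assumption)
        (rule that, unfold P_def c_def, assumption+)
    \<comment> \<open>The transform of \<open>\<psi>'\<close> has the opposite sign in the exponent; conjugation keeps the support and the modulus.\<close>
    define \<psi> where "\<psi> = (\<lambda>t. cnj (\<psi>' t))"
    have [measurable]: "\<psi>' \<in> borel_measurable borel" by (rule \<psi>'(1))
    have [measurable]: "cnj \<in> borel_measurable borel" by (intro borel_measurable_continuous_onI continuous_intros)
    have \<psi>_meas [measurable]: "\<psi> \<in> borel_measurable borel" unfolding \<psi>_def by measurable
    have supp: "\<psi> t = 0" if "t \<notin> {0..\<sigma>}" for t using \<psi>'(3)[OF that] by (simp add: \<psi>_def)
    have ft: "fourier_transform \<psi> x = cnj (LINT t|lborel. \<psi>' t * exp (2 * pi * \<i> * x * t))" for x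
    proof -
      have "fourier_transform \<psi> x = (LINT t|lborel. exp (- (2 * pi * \<i> * t * x)) * \<psi> t)"
        unfolding fourier_transform_def by (rule integral_completion) measurable
      also have "\<dots> = (LINT t|lborel. cnj (\<psi>' t * exp (2 * pi * \<i> * x * t)))"
        by (rule Bochner_Integration.integral_cong) (auto simp: \<psi>_def exp_cnj mult_ac)
      also have "\<dots> = cnj (LINT t|lborel. \<psi>' t * exp (2 * pi * \<i> * x * t))" by (rule Bochner_Integration.integral_cnj)
      finally show ?thesis .
    qed
    have nft: "norm (fourier_transform \<psi> x) = norm (LINT t|lborel. \<psi>' t * exp (2 * pi * \<i> * x * t))" for x
      unfolding ft by simp
    have upper: "norm (fourier_transform \<psi> x) \<le> exp B * \<omega> x" for x
      unfolding nft using up[of x] P(1)[of x] by linarith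
    have step: "c * (\<sigma> - \<sigma>') ^ 6 * exp (- B) * \<omega> x \<le> norm (fourier_transform \<psi> x)"
      if "c * (\<sigma> - \<sigma>') ^ 3 * P x \<le> norm (LINT t|lborel. \<psi>' t * exp (2 * pi * \<i> * x * t))" for x
    proof -
      have "(\<sigma> - \<sigma>') ^ 6 \<le> (\<sigma> - \<sigma>') ^ 3" using \<sigma> by (intro power_decreasing) auto
      then have "c * (\<sigma> - \<sigma>') ^ 6 * (exp (- B) * \<omega> x) \<le> c * (\<sigma> - \<sigma>') ^ 3 * P x"
        using c0 \<sigma> \<omega>0[rule_format, of x] by (intro mult_mono P(2) order.refl) auto
      with that show ?thesis unfolding nft by (simp add: mult.assoc)
    qed
    have lower: "(\<forall>x\<in>{-1<..<-1/2}. norm (fourier_transform \<psi> x) \<ge> c * (\<sigma> - \<sigma>') ^ 6 * exp (- B) * \<omega> x) \<or>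
        (\<forall>x\<in>{1/2<..<1}. norm (fourier_transform \<psi> x) \<ge> c * (\<sigma> - \<sigma>') ^ 6 * exp (- B) * \<omega> x)"
      using low by (rule disj_forward) (auto intro: step)
    have L2: "in_L2 \<psi>"
      unfolding in_L2_def
    proof
      show "\<psi> \<in> borel_measurable lebesgue" by (rule measurable_completion) measurable
      have "integrable lborel (\<lambda>t. (norm (\<psi> t))\<^sup>2)"
      proof (rule Bochner_Integration.integrable_bound)
        show "integrable lborel (\<lambda>t. indicator {0..\<sigma>} t * L\<^sup>2)"
          by (intro integrable_mult_left integrable_real_indicator) (auto simp: emeasure_lborel_Icc_eq)
        show "AE t in lborel. norm ((norm (\<psi> t))\<^sup>2) \<le> norm (indicator {0..\<sigma>} t * L\<^sup>2)"
        proof (rule AE_I2)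
          fix t
          show "norm ((norm (\<psi> t))\<^sup>2) \<le> norm (indicator {0..\<sigma>} t * L\<^sup>2)"
            using power_mono[OF \<psi>'(2)[of t], of 2] supp[of t] by (cases "t \<in> {0..\<sigma>}") (auto simp: \<psi>_def)
        qed
      qed measurable
      then show "integrable lebesgue (\<lambda>t. (norm (\<psi> t))\<^sup>2)" by (rule integrable_completion[THEN iffD2, rotated]) measurable
    qed
    have nonzero: "\<not> (AE t in lebesgue. \<psi> t = 0)"
    proof
      assume "AE t in lebesgue. \<psi> t = 0"
      then have z: "fourier_transform \<psi> x = 0" for x
        unfolding fourier_transform_def by (intro integral_eq_zero_AE) (auto elim!: eventually_mono)
      have "c * (\<sigma> - \<sigma>') ^ 6 * exp (- B) * \<omega> x > 0" for x using c0 \<sigma> \<omega>0 by simp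
      then have "\<not> norm (fourier_transform \<psi> x) \<ge> c * (\<sigma> - \<sigma>') ^ 6 * exp (- B) * \<omega> x" for x
        unfolding z by (simp add: not_le)
      moreover have "-3/4 \<in> {-1<..<-1/2::real}" "3/4 \<in> {1/2<..<1::real}" by simp_all
      ultimately show False using lower by blast
    qed
    have "ess_support \<psi> \<subseteq> {0..\<sigma>}"
    proof -
      have "open (- {0..\<sigma>})" by (simp add: open_Compl)
      moreover have "AE t in lebesgue. t \<in> - {0..\<sigma>} \<longrightarrow> \<psi> t = 0" using supp by auto
      ultimately have "- {0..\<sigma>} \<subseteq> \<Union>{U. open U \<and> (AE x in lebesgue. x \<in> U \<longrightarrow> \<psi> x = 0)}" by blast
      then show ?thesis unfolding ess_support_def by blast
    qed
    with L2 nonzero upper lower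
    show "\<exists>\<psi>::real \<Rightarrow> complex.
          in_L2 \<psi> \<and>
          \<not> (AE x in lebesgue. \<psi> x = 0) \<and>
          ess_support \<psi> \<subseteq> {0..\<sigma>} \<and>
          (\<forall>x. norm (fourier_transform \<psi> x)
             \<le> exp ((K0 / cos (pi * \<alpha> / 2)) powr (1 / (1 - \<alpha>))
                      * (1 / (pi * \<sigma>')) powr (\<alpha> / (1 - \<alpha>))) * \<omega> x) \<and>
          ((\<forall>x\<in>{-1<..<-1/2}. norm (fourier_transform \<psi> x)
             \<ge> c * (\<sigma> - \<sigma>') ^ 6
                 * exp (- ((K0 / cos (pi * \<alpha> / 2)) powr (1 / (1 - \<alpha>))
                             * (1 / (pi * \<sigma>')) powr (\<alpha> / (1 - \<alpha>)))) * \<omega> x) \<or>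
           (\<forall>x\<in>{1/2<..<1}. norm (fourier_transform \<psi> x)
             \<ge> c * (\<sigma> - \<sigma>') ^ 6
                 * exp (- ((K0 / cos (pi * \<alpha> / 2)) powr (1 / (1 - \<alpha>))
                             * (1 / (pi * \<sigma>')) powr (\<alpha> / (1 - \<alpha>)))) * \<omega> x))"
      unfolding D_def[symmetric] B_def[symmetric] by blast
  qed
qed

end
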